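(* Let $q=p^n\ge 5$ with $p$ prime, $T=\mathrm{PSL}(2,q)$ and $T\le G\le\mathrm{P\Gamma L}(2,q)$. Let $m$ be a positive integer with $p^m>2$ such that either $n/m$ is an odd prime, or $p=2$ and $n=2m$. Let $M$ be a maximal subgroup of $G$ with $M\cap T\cong\mathrm{PSL}(2,p^m)$, and consider the (primitive) action of $G$ on the set $[G:M]$ of right cosets of $M$ by right multiplication. Then $b(G)=2$ if and only if $n/m$ is an odd prime; and in that case the Saxl graph $\Sigma(G)$ has diameter $2$.
   Context: $\mathrm{P\Gamma L}(2,q)$ is the group $\mathrm{PGL}(2,q):\langle f\rangle$ where $f$ is induced by the field automorphism $x\mapsto x^p$. For a group acting on a finite set, a base is a subset whose pointwise stabilizer is trivial, and $b(G)$ is the minimal size of a base. If $b(G)=2$, the Saxl graph $\Sigma(G)$ has vertex set the acted-on set, two distinct points being adjacent iff they form a base for $G$. *)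

theory Defs
  imports
    "HOL-Analysis.Analysis"
    "HOL-Computational_Algebra.Computational_Algebra"
    "HOL-Algebra.Group_Action"
    "HOL-Algebra.Generated_Groups"
    "Graph_Theory.Graph_Theory"
begin

section \<open>Two-dimensional linear groups over a field\<close>

definition GL2 :: "('a::field ^ 2 ^ 2) monoid" where
  "GL2 = \<lparr>carrier = {A. invertible A}, mult = (**), one = mat 1\<rparr>"

definition scalars2 :: "('a::field ^ 2 ^ 2) set" where
  "scalars2 = {mat c | c. c \<noteq> 0}"

definition PGL2 :: "('a::field ^ 2 ^ 2) set monoid" where
  "PGL2 = GL2 Mod scalars2"

text \<open>\<open>PSL(2,q)\<close> is taken as a subgroup of \<open>PGL(2,q)\<close>, namely the image of \<open>SL(2,q)\<close>
  under the quotient map.\<close>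

definition PSL2_carrier :: "('a::field ^ 2 ^ 2) set set" where
  "PSL2_carrier = (\<lambda>A. scalars2 #>\<^bsub>GL2\<^esub> A) ` {A. det A = 1}"

definition PSL2 :: "('a::field ^ 2 ^ 2) set monoid" where
  "PSL2 = PGL2\<lparr>carrier := PSL2_carrier\<rparr>"


section \<open>The group \<open>P\<Gamma>L(2,q)\<close>\<close>

text \<open>The semidirect product \<open>N : A\<close> for a subgroup \<open>A\<close> of the automorphism group of \<open>N\<close>.\<close>

definition semidirect :: "'a monoid \<Rightarrow> ('a \<Rightarrow> 'a) set \<Rightarrow> ('a \<times> ('a \<Rightarrow> 'a)) monoid" where
  "semidirect N A =
     \<lparr>carrier = carrier N \<times> A,
      mult = (\<lambda>(x, a) (y, b). (x \<otimes>\<^bsub>N\<^esub> a y, a \<otimes>\<^bsub>AutoGroup N\<^esub> b)),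
      one = (\<one>\<^bsub>N\<^esub>, \<one>\<^bsub>AutoGroup N\<^esub>)\<rparr>"

text \<open>The automorphism of \<open>PGL(2,q)\<close> induced by \<open>x \<mapsto> x\<^sup>p\<close>, where \<open>p\<close> is the characteristic:
  it is applied to all entries of all matrices in a coset of the scalars.\<close>

definition frob_PGL2 :: "('a::field ^ 2 ^ 2) set \<Rightarrow> ('a ^ 2 ^ 2) set" where
  "frob_PGL2 = (\<lambda>X \<in> carrier PGL2. map_matrix (\<lambda>x. x ^ CHAR('a)) ` X)"

definition PGammaL2 ::
  "(('a::field ^ 2 ^ 2) set \<times> (('a ^ 2 ^ 2) set \<Rightarrow> ('a ^ 2 ^ 2) set)) monoid" where
  "PGammaL2 = semidirect PGL2 (generate (AutoGroup PGL2) {frob_PGL2})"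

text \<open>The copy of \<open>PSL(2,q)\<close> inside \<open>P\<Gamma>L(2,q)\<close>.\<close>

definition PSL2_in_PGammaL2 ::
  "(('a::field ^ 2 ^ 2) set \<times> (('a ^ 2 ^ 2) set \<Rightarrow> ('a ^ 2 ^ 2) set)) set" where
  "PSL2_in_PGammaL2 = PSL2_carrier \<times> {\<one>\<^bsub>AutoGroup PGL2\<^esub>}"


section \<open>Maximal subgroups, bases and Saxl graphs\<close>

definition maximal_subgroup :: "'a set \<Rightarrow> ('a, 'b) monoid_scheme \<Rightarrow> bool" where
  "maximal_subgroup M G \<longleftrightarrow>
     subgroup M G \<and> M \<noteq> carrier G \<and>
     (\<forall>H. subgroup H G \<and> M \<subseteq> H \<longrightarrow> H = M \<or> H = carrier G)"

text \<open>Actions are given by a function \<open>\<phi>\<close> as in \<^locale>\<open>group_action\<close>. Bases depend only on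
  stabilizers, so the definitions below apply verbatim to right actions as well.\<close>

definition is_base :: "('g, 'r) monoid_scheme \<Rightarrow> 'x set \<Rightarrow> ('g \<Rightarrow> 'x \<Rightarrow> 'x) \<Rightarrow> 'x set \<Rightarrow> bool" where
  "is_base G E \<phi> B \<longleftrightarrow> B \<subseteq> E \<and> carrier G \<inter> (\<Inter>x\<in>B. stabilizer G \<phi> x) = {\<one>\<^bsub>G\<^esub>}"

definition base_size :: "('g, 'r) monoid_scheme \<Rightarrow> 'x set \<Rightarrow> ('g \<Rightarrow> 'x \<Rightarrow> 'x) \<Rightarrow> nat" where
  "base_size G E \<phi> = (LEAST k. \<exists>B. finite B \<and> is_base G E \<phi> B \<and> card B = k)"

definition saxl_graph ::
  "('g, 'r) monoid_scheme \<Rightarrow> 'x set \<Rightarrow> ('g \<Rightarrow> 'x \<Rightarrow> 'x) \<Rightarrow> ('x, 'x \<times> 'x) pre_digraph" where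
  "saxl_graph G E \<phi> =
     \<lparr>verts = E, arcs = {(x, y). x \<in> E \<and> y \<in> E \<and> x \<noteq> y \<and> is_base G E \<phi> {x, y}},
      tail = fst, head = snd\<rparr>"

text \<open>With unit arc weights, \<^const>\<open>wf_digraph.\<mu>\<close> is the usual graph distance
  (\<open>\<infinity>\<close> for vertices in different components).\<close>

definition graph_diameter :: "('v, 'e) pre_digraph \<Rightarrow> ereal" where
  "graph_diameter \<Gamma> = (SUP u\<in>verts \<Gamma>. SUP v\<in>verts \<Gamma>. wf_digraph.\<mu> \<Gamma> (\<lambda>_. 1) u v)"

text \<open>Right multiplication on right cosets (a right action of \<open>G\<close> on \<^term>\<open>rcosets\<^bsub>G\<^esub> M\<close>).\<close>

definition right_mult :: "('g, 'r) monoid_scheme \<Rightarrow> 'g \<Rightarrow> 'g set \<Rightarrow> 'g set" where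
  "right_mult G g X = X #>\<^bsub>G\<^esub> g"

lemma graph_saxl_graph:
  assumes "finite E"
  shows "graph (saxl_graph G E \<phi>)"
proof -
  have "finite (arcs (saxl_graph G E \<phi>))"
    by (rule finite_subset[of _ "E \<times> E"]) (use assms in \<open>auto simp: saxl_graph_def\<close>)
  moreover have "symmetric (saxl_graph G E \<phi>)"
    by (auto simp: symmetric_conv saxl_graph_def insert_commute)
  ultimately show ?thesis
    using assms by unfold_locales (auto simp: saxl_graph_def arc_to_ends_def symmetric_def)
qed


section \<open>Well-definedness of the groups above\<close>

lemma group_GL2: "group (GL2 :: ('a::field^2^2) monoid)"
proof (rule groupI)
  fix x :: "'a^2^2" assume "x \<in> carrier GL2"
  then obtain y where "x ** y = mat 1" "y ** x = mat 1" by (auto simp: GL2_def invertible_def)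
  then show "\<exists>y\<in>carrier GL2. y \<otimes>\<^bsub>GL2\<^esub> x = \<one>\<^bsub>GL2\<^esub>"
    by (auto simp: GL2_def invertible_def)
next
  show "\<one>\<^bsub>GL2\<^esub> \<in> carrier (GL2 :: ('a^2^2) monoid)"
    by (auto simp: GL2_def invertible_def intro: exI[of _ "mat 1"])
qed (auto simp: GL2_def invertible_mult matrix_mul_assoc)

lemma mat_comm: "mat c ** (A::'a::field^2^2) = A ** mat c"
  by (simp add: matrix_matrix_mult_def mat_def vec_eq_iff sum_2 forall_2)

lemma mat_mult: "mat c ** (mat d::'a::field^2^2) = mat (c*d)"
  by (simp add: matrix_matrix_mult_def mat_def vec_eq_iff sum_2 forall_2)

lemma invertible_mat: "c \<noteq> 0 \<Longrightarrow> invertible (mat c :: 'a::field^2^2)"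
  unfolding invertible_def by (rule exI[of _ "mat (inverse c)"]) (simp add: mat_mult)

lemma normal_scalars2: "scalars2 \<lhd> (GL2 :: ('a::field^2^2) monoid)"
proof -
  interpret group "GL2 :: ('a::field^2^2) monoid" by (rule group_GL2)
  have "subgroup scalars2 (GL2 :: ('a::field^2^2) monoid)"
  proof (rule subgroupI)
    fix a :: "'a^2^2" assume "a \<in> scalars2"
    then obtain c where c: "a = mat c" "c \<noteq> 0" by (auto simp: scalars2_def)
    have "inv\<^bsub>GL2\<^esub> a = mat (inverse c)"
      by (rule inv_equality) (use c in \<open>auto simp: GL2_def mat_mult invertible_mat\<close>)
    then show "inv\<^bsub>GL2\<^esub> a \<in> scalars2" using c by (auto simp: scalars2_def)
  next
    show "scalars2 \<noteq> ({} :: ('a^2^2) set)" by (auto simp: scalars2_def intro: exI[of _ 1])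
  next
    show "scalars2 \<subseteq> carrier (GL2 :: ('a^2^2) monoid)"
      by (auto simp: scalars2_def GL2_def invertible_mat)
  next
    fix a b :: "'a^2^2" assume "a \<in> scalars2" "b \<in> scalars2"
    then obtain c d where "a = mat c" "c \<noteq> 0" "b = mat d" "d \<noteq> 0" by (auto simp: scalars2_def)
    then have "a \<otimes>\<^bsub>GL2\<^esub> b = mat (c * d)" "c * d \<noteq> 0" by (simp_all add: GL2_def mat_mult)
    then show "a \<otimes>\<^bsub>GL2\<^esub> b \<in> scalars2" by (auto simp: scalars2_def)
  qed
  moreover have "x \<otimes>\<^bsub>GL2\<^esub> h \<otimes>\<^bsub>GL2\<^esub> inv\<^bsub>GL2\<^esub> x \<in> scalars2"
    if "x \<in> carrier GL2" "h \<in> scalars2" for x h :: "'a^2^2"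
  proof -
    have "x \<otimes>\<^bsub>GL2\<^esub> h = h \<otimes>\<^bsub>GL2\<^esub> x" "h \<in> carrier GL2"
      using that by (auto simp: GL2_def scalars2_def mat_comm invertible_mat)
    then show ?thesis using that by (simp add: m_assoc)
  qed
  ultimately show ?thesis by (simp add: normal_inv_iff)
qed

lemma group_PGL2: "group (PGL2 :: ('a::field^2^2) set monoid)"
  unfolding PGL2_def by (rule normal.factorgroup_is_group[OF normal_scalars2])

lemma group_semidirect:
  assumes "group N" "subgroup A (AutoGroup N)"
  shows "group (semidirect N A)"
proof -
  interpret N: group N by fact
  interpret AN: group "AutoGroup N" by (rule N.AutoGroup)
  interpret A: subgroup A "AutoGroup N" by fact
  have hom: "a \<in> hom N N" "a \<in> Bij (carrier N)" if "a \<in> A" for a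
    using A.subset that by (auto simp: AutoGroup_def auto_def)
  have clo [simp]: "a x \<in> carrier N" if "a \<in> A" "x \<in> carrier N" for a x
    using hom[of a] that by (auto simp: hom_def)
  have mu [simp]: "a (x \<otimes>\<^bsub>N\<^esub> y) = a x \<otimes>\<^bsub>N\<^esub> a y" if "a \<in> A" "x \<in> carrier N" "y \<in> carrier N" for a x y
    using hom(1)[of a] that by (auto simp: hom_def)
  have co [simp]: "(a \<otimes>\<^bsub>AutoGroup N\<^esub> b) x = a (b x)" if "a \<in> A" "b \<in> A" "x \<in> carrier N" for a b x
    using hom(2)[of a] hom(2)[of b] that by (simp add: AutoGroup_def BijGroup_def compose_def)
  have on [simp]: "\<one>\<^bsub>AutoGroup N\<^esub> x = x" if "x \<in> carrier N" for x
    using that by (simp add: AutoGroup_def BijGroup_def)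
  show ?thesis
  proof (rule groupI)
    fix z assume "z \<in> carrier (semidirect N A)"
    then obtain x a where z: "z = (x, a)" "x \<in> carrier N" "a \<in> A" by (auto simp: semidirect_def)
    let ?b = "inv\<^bsub>AutoGroup N\<^esub> a"
    have b: "?b \<in> A" "?b \<otimes>\<^bsub>AutoGroup N\<^esub> a = \<one>\<^bsub>AutoGroup N\<^esub>" using z by auto
    show "\<exists>y\<in>carrier (semidirect N A). y \<otimes>\<^bsub>semidirect N A\<^esub> z = \<one>\<^bsub>semidirect N A\<^esub>"
      by (rule bexI[of _ "(inv\<^bsub>N\<^esub> (?b x), ?b)"]) (use z b in \<open>auto simp: semidirect_def\<close>)
  qed (auto simp: semidirect_def N.m_assoc AN.m_assoc)
qed

lemma frob_add: "(x + y :: 'a::finite_field) ^ CHAR('a) = x ^ CHAR('a) + y ^ CHAR('a)"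
  by (rule freshmans_dream) auto

lemma frob_auto: "(frob_PGL2 :: ('a::finite_field^2^2) set \<Rightarrow> _) \<in> carrier (AutoGroup PGL2)"
proof -
  let ?F = "\<lambda>x::'a. x ^ CHAR('a)" let ?M = "map_matrix ?F :: 'a^2^2 \<Rightarrow> 'a^2^2"
  interpret GL: group "GL2 :: ('a^2^2) monoid" by (rule group_GL2)
  interpret Z: normal scalars2 "GL2 :: ('a^2^2) monoid" by (rule normal_scalars2)
  interpret P: group "PGL2 :: ('a^2^2) set monoid" by (rule group_PGL2)
  have injF: "inj ?F"
  proof (rule injI)
    fix x y :: 'a assume "?F x = ?F y"
    moreover have "?F ((x - y) + y) = ?F (x - y) + ?F y" by (rule frob_add)
    ultimately show "x = y" by simp
  qed
  then have bijF: "bij ?F" by (simp add: bij_def finite_UNIV_inj_surj)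
  have Mm: "?M (A ** B) = ?M A ** ?M B" for A B
    by (simp add: vec_eq_iff matrix_matrix_mult_def sum_2 forall_2 frob_add power_mult_distrib)
  have Mmat: "?M (mat c) = mat (?F c)" for c
    by (simp add: vec_eq_iff forall_2 mat_def)
  have surjF: "\<exists>y. x = ?F y" for x using bijF by (metis bij_pointE)
  have MZ: "?M ` scalars2 = scalars2"
  proof -
    have "x \<in> ?M ` scalars2" if x: "x \<in> scalars2" for x
    proof -
      obtain c where "x = mat c" "c \<noteq> 0" using x by (auto simp: scalars2_def)
      moreover obtain d where "c = ?F d" using surjF by blast
      ultimately have "x = ?M (mat d)" "d \<noteq> 0" by (auto simp: Mmat)
      then show ?thesis by (auto simp: scalars2_def)
    qed
    then show ?thesis by (auto simp: scalars2_def Mmat)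
  qed
  have Minj: "inj ?M"
    by (rule injI) (use injF in \<open>auto simp: vec_eq_iff dest: injD\<close>)
  have detM: "det (?M A) = ?F (det A)" for A
  proof -
    have "?F (det A) + ?F (A$1$2 * A$2$1) = ?F (A$1$1 * A$2$2)"
      unfolding frob_add[symmetric] by (simp add: det_2)
    then show ?thesis by (simp add: det_2 power_mult_distrib algebra_simps)
  qed
  have Minv: "invertible (?M A) = invertible A" for A
    by (simp add: invertible_det_nz detM)
  have coset: "?M ` (scalars2 #>\<^bsub>GL2\<^esub> A) = scalars2 #>\<^bsub>GL2\<^esub> ?M A" for A
  proof -
    have "?M ` (scalars2 #>\<^bsub>GL2\<^esub> A) = (\<lambda>z. z ** ?M A) ` (?M ` scalars2)"
      by (simp add: r_coset_def GL2_def Mm image_image UNION_singleton_eq_range)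
    then show ?thesis unfolding MZ by (auto simp: r_coset_def GL2_def)
  qed
  have cP: "carrier PGL2 = (\<lambda>A. scalars2 #>\<^bsub>GL2\<^esub> A) ` (carrier GL2 :: ('a^2^2) set)"
    by (auto simp: PGL2_def FactGroup_def RCOSETS_def)
  have mP: "(scalars2 #>\<^bsub>GL2\<^esub> A) \<otimes>\<^bsub>PGL2\<^esub> (scalars2 #>\<^bsub>GL2\<^esub> B) = scalars2 #>\<^bsub>GL2\<^esub> (A ** B)"
    if "A \<in> carrier GL2" "B \<in> carrier GL2" for A B :: "'a^2^2"
    using Z.rcos_sum[OF that] by (simp add: PGL2_def GL2_def)
  have cGM: "?M A \<in> carrier GL2 \<longleftrightarrow> A \<in> carrier GL2" for A by (simp add: GL2_def Minv)
  have cGm: "A ** B \<in> carrier GL2" if "A \<in> carrier GL2" "B \<in> carrier GL2" for A B :: "'a^2^2"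
    using that by (simp add: GL2_def invertible_mult)
  have f: "frob_PGL2 (scalars2 #>\<^bsub>GL2\<^esub> A) = scalars2 #>\<^bsub>GL2\<^esub> ?M A" if "A \<in> carrier GL2" for A
    unfolding frob_PGL2_def using that by (simp add: coset cP)
  have clos: "frob_PGL2 \<in> carrier PGL2 \<rightarrow> (carrier PGL2 :: ('a^2^2) set set)"
    by (auto simp: cP f cGM)
  have "frob_PGL2 \<in> hom PGL2 (PGL2 :: ('a^2^2) set monoid)"
    by (rule homI) (use clos in \<open>auto simp: cP mP f cGM cGm Mm\<close>)
  moreover have "inj_on frob_PGL2 (carrier PGL2 :: ('a^2^2) set set)"
    using Minj by (auto simp: inj_on_def frob_PGL2_def inj_image_eq_iff)
  then have "bij_betw frob_PGL2 (carrier PGL2) (carrier PGL2 :: ('a^2^2) set set)"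
    using clos by (simp add: bij_betw_def endo_inj_surj funcset_image image_subset_iff_funcset)
  ultimately show ?thesis
    by (auto simp: AutoGroup_def auto_def Bij_def frob_PGL2_def[abs_def])
qed

lemma group_PGammaL2: "group (PGammaL2 :: (('a::finite_field^2^2) set \<times> _) monoid)"
proof -
  interpret group "PGL2 :: ('a^2^2) set monoid" by (rule group_PGL2)
  show ?thesis unfolding PGammaL2_def
    by (intro group_semidirect group_PGL2 group.generate_is_subgroup AutoGroup) (use frob_auto in auto)
qed

end

theory Submission
  imports Defs "HOL-Number_Theory.Residues"
begin

no_notation fps_nth (infixl "$" 75)

text \<open>
  Let \<open>K\<close> be the subfield of order \<open>q\<^sub>0 = p\<^sup>m\<close>, and call the images \<open>h L\<close> of the projective line \<open>L\<close> over
  \<open>K\<close> sublines. An embedding of \<open>PSL(2,q\<^sub>0)\<close> into \<open>PSL(2,q)\<close> maps elements of order \<open>p\<close> to elements with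
  a unique fixed point. When the fixed points of two opposite ones are moved to \<open>\<infinity>\<close> and \<open>0\<close>, the
  embedding is described by an additive map with \<open>\<alpha> (c\<^sup>2 a) = \<alpha> (c\<^sup>2) \<alpha> a\<close>, and such a map is a field
  homomorphism. So \<open>M \<inter> T\<close> is a conjugate of \<open>PSL(2,K)\<close> and, by maximality, \<open>M\<close> is the stabilizer of a
  subline: \<open>G\<close> acts on sublines.

  If \<open>q = q\<^sub>0\<^sup>2\<close>, any two sublines are fixed by a common nontrivial element of \<open>PGL(2,q)\<close>. If \<open>n/m\<close> is an
  odd prime, any two sublines have a common neighbour. When a point of one is moved to \<open>\<infinity>\<close> and a
  point of the other to \<open>0\<close> (or a common point to \<open>\<infinity>\<close>), the neighbour can be taken to be
  \<open>a K + b\<close> together with \<open>\<infinity>\<close>, since fewer than \<open>q - 1\<close> values of \<open>a\<close> are excluded; only \<open>64\<close> over \<open>4\<close> needs a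
  careful choice of the two points. The diameter is \<open>2\<close> because a subline and its image under a
  suitable translation have a common nontrivial stabilizer.
\<close>

section \<open>Matrices of size two and semilinear maps\<close>

text \<open>Points of the projective line never occur: a subline is a matrix up to scalars and right
  multiplication by GL(2,K), and stabilizers become equations between entries with coefficients in
  \<open>K\<close>. Neighbours are neighbours for the whole of P\<Gamma>L(2,q), hence for every
  \<open>G\<close> at once. An element showing that a pair is not a base must lie in
  \<open>G\<close>, so it is taken from \<open>T\<close>; in the quadratic case this works because
  every determinant is a square when p = 2. That the two fixed points in the embedding are distinct
  rests on the relations W^2 = (W U)^3 = 1 in PSL(2), where U is the translation by 1 and W
  exchanges 0 and \<infinity>. In the count, a value a is excluded if a nontrivial field
  automorphism maps the relevant multiple of a K to itself, which makes that multiple a root of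
  x^((p^j - 1)(Q - 1)) = 1 for a proper divisor j of n, or if a subline is met in a further point,
  which costs at most Q(Q - 1) values. Every bound has the factor Q - 1, so the comparison is with 1
  + Q + ... + Q^(r-1), where r = n/m. For 64 over 4 two of the root sets are made to coincide by
  prescribing a norm.\<close>

definition M2 :: "'a \<Rightarrow> 'a \<Rightarrow> 'a \<Rightarrow> 'a \<Rightarrow> 'a ^ 2 ^ 2" where
  "M2 a b c d = (\<chi> i j. if i = 1 then (if j = 1 then a else b) else (if j = 1 then c else d))"

lemma M2_nth [simp]:
  "M2 a b c d $ 1 $ 1 = a" "M2 a b c d $ 1 $ 2 = b" "M2 a b c d $ 2 $ 1 = c" "M2 a b c d $ 2 $ 2 = d"
  by (auto simp: M2_def)

lemma M2_eq_iff [simp]: "M2 a b c d = M2 a' b' c' d' \<longleftrightarrow> a = a' \<and> b = b' \<and> c = c' \<and> d = d'"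
  by (auto simp: vec_eq_iff forall_2)

lemma M2_collapse: "M2 (A$1$1) (A$1$2) (A$2$1) (A$2$2) = A"
  by (auto simp: vec_eq_iff forall_2)

lemma M2_cases: obtains a b c d where "A = M2 a b c d"
  by (metis M2_collapse)

lemma M2_mult [simp]:
  "M2 a b c d ** M2 a' b' c' d' = M2 (a * a' + b * c') (a * b' + b * d') (c * a' + d * c') (c * b' + d * d')"
  by (simp add: vec_eq_iff forall_2 matrix_matrix_mult_def sum_2)

lemma mat_M2: "mat c = M2 c 0 0 c"
  by (simp add: vec_eq_iff forall_2 mat_def)

lemma det_M2 [simp]: "det (M2 a b c d) = a * d - b * c"
  by (simp add: det_2)

lemma map_matrix_M2 [simp]: "map_matrix f (M2 a b c d) = M2 (f a) (f b) (f c) (f d)"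
  by (simp add: vec_eq_iff forall_2 map_matrix_def)

definition inv2 :: "'a::field ^ 2 ^ 2 \<Rightarrow> 'a ^ 2 ^ 2" where
  "inv2 A = M2 (A$2$2 / det A) (- A$1$2 / det A) (- A$2$1 / det A) (A$1$1 / det A)"

lemma inv2_left: "det A \<noteq> 0 \<Longrightarrow> inv2 A ** A = mat 1" for A :: "'a::field^2^2"
  by (rule M2_cases[of A]) (simp add: inv2_def mat_M2 add_divide_distrib[symmetric] diff_divide_distrib[symmetric] algebra_simps)

lemma inv2_right: "det A \<noteq> 0 \<Longrightarrow> A ** inv2 A = mat 1" for A :: "'a::field^2^2"
  by (rule M2_cases[of A]) (simp add: inv2_def mat_M2 add_divide_distrib[symmetric] diff_divide_distrib[symmetric] algebra_simps)

lemma det_mat_2 [simp]: "det (mat c :: 'a::field^2^2) = c * c"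
  by (simp add: mat_M2)

lemma det_inv2: "det A \<noteq> 0 \<Longrightarrow> det (inv2 A) * det A = 1" for A :: "'a::field^2^2"
  using arg_cong[OF inv2_left, of A det] by (simp add: det_mul)

lemma det_inv2_nz: "det A \<noteq> 0 \<Longrightarrow> det (inv2 A) \<noteq> 0" for A :: "'a::field^2^2"
  using det_inv2 by force

lemma inv2_mult_cancel [simp]:
  fixes A :: "'a::field^2^2"
  assumes "det A \<noteq> 0"
  shows "inv2 A ** (A ** B) = B" "A ** (inv2 A ** B) = B"
  using assms by (simp_all add: matrix_mul_assoc inv2_left inv2_right)

lemma mult_inv2_cancel [simp]:
  fixes A :: "'a::field^2^2"
  assumes "det A \<noteq> 0"
  shows "B ** A ** inv2 A = B" "B ** inv2 A ** A = B"
  using assms by (simp_all add: matrix_mul_assoc[symmetric] inv2_left inv2_right)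

lemma mat_left_commute: "A ** (mat c ** B) = mat c ** (A ** B)" for A :: "'a::field^2^2"
  by (metis mat_comm matrix_mul_assoc)

lemma mat_mult_mat: "mat c ** (mat d ** A) = mat (c * d) ** A" for A :: "'a::field^2^2"
  by (simp add: matrix_mul_assoc mat_mult)

section \<open>Powers of the Frobenius map on matrices\<close>

definition frm :: "nat \<Rightarrow> 'a::field ^ 2 ^ 2 \<Rightarrow> 'a ^ 2 ^ 2" where
  "frm i = map_matrix (\<lambda>x. x ^ (CHAR('a) ^ i))"

lemma frm_M2 [simp]:
  "frm i (M2 a b c (d::'a::field)) =
     M2 (a ^ (CHAR('a) ^ i)) (b ^ (CHAR('a) ^ i)) (c ^ (CHAR('a) ^ i)) (d ^ (CHAR('a) ^ i))"
  by (simp add: frm_def)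

lemma fr_add: "(x + y :: 'a::finite_field) ^ (CHAR('a) ^ i) = x ^ (CHAR('a) ^ i) + y ^ (CHAR('a) ^ i)"
  by (rule freshmans_dream') auto

lemma fr_zero [simp]: "(0 :: 'a::finite_field) ^ (CHAR('a) ^ i) = 0"
  by (simp add: zero_power)

lemma fr_uminus: "(- x :: 'a::finite_field) ^ (CHAR('a) ^ i) = - (x ^ (CHAR('a) ^ i))"
  using fr_add[of "- x" x i] by (simp add: eq_neg_iff_add_eq_0)

lemma fr_diff: "(x - y :: 'a::finite_field) ^ (CHAR('a) ^ i) = x ^ (CHAR('a) ^ i) - y ^ (CHAR('a) ^ i)"
  using fr_add[of x "- y" i] by (simp add: fr_uminus)

lemma fr_inj: "(x :: 'a::finite_field) ^ (CHAR('a) ^ i) = y ^ (CHAR('a) ^ i) \<longleftrightarrow> x = y"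
proof
  assume "x ^ (CHAR('a) ^ i) = y ^ (CHAR('a) ^ i)"
  then have "(x - y) ^ (CHAR('a) ^ i) = 0" by (simp add: fr_diff)
  then show "x = y" by simp
qed simp

lemma frm_inj: "frm i A = frm i B \<longleftrightarrow> A = B" for A :: "'a::finite_field^2^2"
  by (rule M2_cases[of A]; rule M2_cases[of B]) (simp add: fr_inj)

lemma frm_mult: "frm i (A ** B) = frm i A ** frm i B" for A :: "'a::finite_field^2^2"
  by (rule M2_cases[of A]; rule M2_cases[of B]) (simp add: fr_add power_mult_distrib)

lemma frm_mat [simp]: "frm i (mat c) = mat (c ^ (CHAR('a) ^ i))" for c :: "'a::finite_field"
  by (simp add: mat_M2)

lemma det_frm: "det (frm i A) = det A ^ (CHAR('a) ^ i)" for A :: "'a::finite_field^2^2"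
  by (rule M2_cases[of A]) (simp add: fr_diff power_mult_distrib)

lemma det_frm_nz [simp]: "det (frm i A) = 0 \<longleftrightarrow> det A = 0" for A :: "'a::finite_field^2^2"
  by (simp add: det_frm)

lemma frm_0 [simp]: "frm 0 A = A" for A :: "'a::finite_field^2^2"
  by (rule M2_cases[of A]) simp

lemma frm_frm: "frm i (frm j A) = frm (i + j) A" for A :: "'a::finite_field^2^2"
  by (rule M2_cases[of A]) (simp add: power_mult[symmetric] power_add mult.commute)

section \<open>Elements of P\<Gamma>L as a matrix with a Frobenius exponent\<close>

abbreviation cos2 :: "'a::field ^ 2 ^ 2 \<Rightarrow> ('a ^ 2 ^ 2) set" where
  "cos2 A \<equiv> scalars2 #>\<^bsub>GL2\<^esub> A"

lemma cos2_alt: "cos2 A = {mat c ** A | c. c \<noteq> 0}"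
  by (auto simp: r_coset_def GL2_def scalars2_def)

lemma carrier_GL2: "carrier GL2 = {A :: 'a::field^2^2. det A \<noteq> 0}"
  by (simp add: GL2_def invertible_det_nz)

lemma carrier_PGL2: "carrier PGL2 = cos2 ` {A :: 'a::field^2^2. det A \<noteq> 0}"
  by (auto simp: PGL2_def FactGroup_def RCOSETS_def carrier_GL2)

lemma cos2_mult:
  fixes A :: "'a::field^2^2"
  assumes "det A \<noteq> 0" "det B \<noteq> 0"
  shows "cos2 A \<otimes>\<^bsub>PGL2\<^esub> cos2 B = cos2 (A ** B)"
proof -
  interpret Z: normal scalars2 "GL2 :: ('a^2^2) monoid" by (rule normal_scalars2)
  show ?thesis using Z.rcos_sum[of A B] assms by (simp add: PGL2_def carrier_GL2) (simp add: GL2_def)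
qed

lemma cos2_self: "A \<in> cos2 (A :: 'a::field^2^2)"
  unfolding cos2_alt by (auto intro!: exI[of _ 1])

lemma cos2_eq_iff:
  fixes A :: "'a::field^2^2"
  shows "cos2 A = cos2 B \<longleftrightarrow> (\<exists>c. c \<noteq> 0 \<and> B = mat c ** A)"
proof
  assume "cos2 A = cos2 B"
  then show "\<exists>c. c \<noteq> 0 \<and> B = mat c ** A" using cos2_self[of B] by (auto simp: cos2_alt)
next
  assume "\<exists>c. c \<noteq> 0 \<and> B = mat c ** A"
  then obtain c where c: "c \<noteq> 0" "B = mat c ** A" by blast
  show "cos2 A = cos2 B"
  proof (intro equalityI subsetI)
    fix X assume "X \<in> cos2 A"
    then obtain d where "d \<noteq> 0" "X = mat d ** A" by (auto simp: cos2_alt)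
    then have "X = mat (d / c) ** B" "d / c \<noteq> 0" using c by (simp_all add: mat_mult_mat)
    then show "X \<in> cos2 B" unfolding cos2_alt by blast
  next
    fix X assume "X \<in> cos2 B"
    then obtain d where "d \<noteq> 0" "X = mat (d * c) ** A" using c by (auto simp: cos2_alt mat_mult_mat)
    then show "X \<in> cos2 A" unfolding cos2_alt using c by (metis (mono_tags, lifting) mem_Collect_eq mult_eq_0_iff)
  qed
qed

lemma one_PGL2: "\<one>\<^bsub>PGL2\<^esub> = cos2 (mat 1 :: 'a::field^2^2)"
  unfolding cos2_alt by (auto simp: PGL2_def FactGroup_def scalars2_def)

lemma frob_PGL2_cos2:
  fixes A :: "'a::finite_field^2^2"
  assumes "det A \<noteq> 0"
  shows "frob_PGL2 (cos2 A) = cos2 (frm 1 A)"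
proof -
  have "frob_PGL2 (cos2 A) = frm 1 ` cos2 A"
    using assms by (simp add: frob_PGL2_def carrier_PGL2 frm_def)
  also have "\<dots> = cos2 (frm 1 A)"
  proof (intro equalityI subsetI)
    fix X assume "X \<in> frm 1 ` cos2 A"
    then show "X \<in> cos2 (frm 1 A)" by (auto simp: cos2_alt frm_mult)
  next
    fix X assume "X \<in> cos2 (frm 1 A)"
    then obtain c where c: "c \<noteq> 0" "X = mat c ** frm 1 A" by (auto simp: cos2_alt)
    have "surj (\<lambda>x::'a. x ^ (CHAR('a) ^ 1))"
      by (rule finite_UNIV_inj_surj[OF finite]) (simp only: inj_def fr_inj, blast)
    then obtain d where d: "c = d ^ (CHAR('a) ^ 1)" by (rule surjE)
    with c have "X = frm 1 (mat d ** A)" "d \<noteq> 0" by (auto simp: frm_mult)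
    then show "X \<in> frm 1 ` cos2 A" by (auto simp: cos2_alt)
  qed
  finally show ?thesis .
qed

lemma group_Auto_PGL2: "group (AutoGroup (PGL2 :: ('a::finite_field^2^2) set monoid))"
  by (intro group.AutoGroup group_PGL2)

text \<open>Natural exponents are enough, since in a finite group they already exhaust the generated
  subgroup.\<close>

definition frob_pow :: "nat \<Rightarrow> ('a::finite_field ^ 2 ^ 2) set \<Rightarrow> ('a ^ 2 ^ 2) set" where
  "frob_pow i = frob_PGL2 [^]\<^bsub>AutoGroup PGL2\<^esub> i"

lemma frob_pow_carrier [simp]: "frob_pow i \<in> carrier (AutoGroup PGL2)"
  unfolding frob_pow_def using monoid.nat_pow_closed[OF group.is_monoid[OF group_Auto_PGL2] frob_auto] .

lemma Auto_mult_apply: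
  assumes "a \<in> carrier (AutoGroup N)" "b \<in> carrier (AutoGroup N)" "x \<in> carrier N"
  shows "(a \<otimes>\<^bsub>AutoGroup N\<^esub> b) x = a (b x)"
  using assms by (simp add: AutoGroup_def auto_def BijGroup_def compose_def)

lemma cos2_in_carrier [simp]: "det A \<noteq> 0 \<Longrightarrow> cos2 A \<in> carrier PGL2" for A :: "'a::field^2^2"
  by (auto simp: carrier_PGL2)

lemma frob_pow_cos2:
  fixes A :: "'a::finite_field^2^2"
  assumes "det A \<noteq> 0"
  shows "frob_pow i (cos2 A) = cos2 (frm i A)"
proof (induction i)
  case 0
  then show ?case using assms by (simp add: frob_pow_def AutoGroup_def BijGroup_def)
next
  case (Suc i)
  interpret AG: group "AutoGroup (PGL2 :: ('a^2^2) set monoid)" by (rule group_Auto_PGL2)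
  have "frob_pow (Suc i) = frob_PGL2 \<otimes>\<^bsub>AutoGroup PGL2\<^esub> (frob_pow i :: ('a^2^2) set \<Rightarrow> _)"
    unfolding frob_pow_def using AG.nat_pow_Suc2[OF frob_auto] by simp
  then show ?case
    using Suc assms by (simp add: Auto_mult_apply frob_auto frob_PGL2_cos2 frm_frm)
qed

lemma frob_pow_add: "frob_pow i \<otimes>\<^bsub>AutoGroup PGL2\<^esub> frob_pow j = frob_pow (i + j)"
  unfolding frob_pow_def by (rule monoid.nat_pow_mult[OF group.is_monoid[OF group_Auto_PGL2] frob_auto])

lemma frob_pow_eq_one:
  assumes "\<And>x::'a::finite_field. x ^ (CHAR('a) ^ i) = x"
  shows "frob_pow i = (\<one>\<^bsub>AutoGroup PGL2\<^esub> :: ('a^2^2) set \<Rightarrow> ('a^2^2) set)"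
proof
  fix X :: "('a^2^2) set"
  show "frob_pow i X = \<one>\<^bsub>AutoGroup PGL2\<^esub> X"
  proof (cases "X \<in> carrier PGL2")
    case True
    then obtain A :: "'a^2^2" where A: "X = cos2 A" "det A \<noteq> 0" by (auto simp: carrier_PGL2)
    have "frm i A = A" by (rule M2_cases[of A]) (simp add: assms)
    with A True show ?thesis by (simp add: frob_pow_cos2 AutoGroup_def BijGroup_def)
  next
    case False
    have "frob_pow i \<in> extensional (carrier (PGL2 :: ('a^2^2) set monoid))"
      using frob_pow_carrier[of i, where 'a='a] unfolding AutoGroup_def auto_def Bij_def by simp
    with False show ?thesis by (simp add: AutoGroup_def BijGroup_def extensional_def)
  qed
qed

text \<open>The class of the semilinear map v \<mapsto> A v^(p^i). The exponent is not reduced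
  modulo the order of the Frobenius map, so one element is given by many exponents.\<close>

definition gam ::
  "'a::finite_field ^ 2 ^ 2 \<Rightarrow> nat \<Rightarrow> ('a ^ 2 ^ 2) set \<times> (('a ^ 2 ^ 2) set \<Rightarrow> ('a ^ 2 ^ 2) set)" where
  "gam A i = (cos2 A, frob_pow i)"

lemma carrier_PGammaL2: "carrier PGammaL2 = {gam A i | A i. det A \<noteq> (0::'a::finite_field)}"
proof -
  interpret AG: group "AutoGroup (PGL2 :: ('a^2^2) set monoid)" by (rule group_Auto_PGL2)
  have "generate (AutoGroup PGL2) {frob_PGL2 :: ('a^2^2) set \<Rightarrow> _} = range frob_pow"
    using AG.generate_pow_on_finite_carrier[OF _ frob_auto] by (auto simp: frob_pow_def)
  then show ?thesis by (auto simp: PGammaL2_def semidirect_def gam_def carrier_PGL2)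
qed

lemma gam_carrier [simp]: "det A \<noteq> 0 \<Longrightarrow> gam A i \<in> carrier PGammaL2" for A :: "'a::finite_field^2^2"
  by (auto simp: carrier_PGammaL2)

lemma gam_mult [simp]:
  "det A \<noteq> 0 \<Longrightarrow> det B \<noteq> 0 \<Longrightarrow> gam A i \<otimes>\<^bsub>PGammaL2\<^esub> gam B j = gam (A ** frm i B) (i + j)"
  for A :: "'a::finite_field^2^2"
  by (simp add: PGammaL2_def semidirect_def gam_def frob_pow_cos2 cos2_mult frob_pow_add)

lemma one_PGammaL2: "\<one>\<^bsub>PGammaL2\<^esub> = gam (mat 1 :: 'a::finite_field^2^2) 0"
  by (simp add: PGammaL2_def semidirect_def gam_def one_PGL2 frob_pow_def)

lemma gam_eq_iff: "gam A i = gam B i \<longleftrightarrow> (\<exists>c. c \<noteq> 0 \<and> B = mat c ** A)"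
  by (simp add: gam_def cos2_eq_iff)

lemma gam_eq_one:
  assumes "\<And>x::'a::finite_field. x ^ (CHAR('a) ^ i) = x" "c \<noteq> 0"
  shows "gam (mat c :: 'a^2^2) i = \<one>\<^bsub>PGammaL2\<^esub>"
proof -
  have "cos2 (mat c :: 'a^2^2) = cos2 (mat 1)"
    unfolding cos2_eq_iff by (rule exI[of _ "1 / c"]) (use assms in \<open>simp add: mat_mult\<close>)
  then show ?thesis
    using frob_pow_eq_one[OF assms(1)] by (simp add: gam_def one_PGammaL2 frob_pow_def)
qed

lemma PSL2_in_PGammaL2_alt: "PSL2_in_PGammaL2 = {gam A 0 | A :: 'a::finite_field^2^2. det A = 1}"
  by (auto simp: PSL2_in_PGammaL2_def PSL2_carrier_def gam_def frob_pow_def)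

section \<open>Sublines\<close>

locale subfield =
  fixes m r :: nat and K :: "'a::finite_field set"
  assumes card_field: "CARD('a) = CHAR('a) ^ (m * r)"
    and m_pos: "m > 0" and r_pos: "r > 0"
    and K_def: "K = {x. x ^ (CHAR('a) ^ m) = x}"
begin

definition Q :: nat where "Q = CHAR('a) ^ m"

lemma K_iff: "x \<in> K \<longleftrightarrow> x ^ Q = x"
  by (simp add: K_def Q_def)

lemma CARD_Q: "CARD('a) = Q ^ r"
  by (simp add: card_field Q_def power_mult)

lemma Q_gt_1: "Q > 1"
  using m_pos CHAR_prime[where 'a='a] unfolding Q_def by (metis one_less_power prime_gt_1_nat)

lemma K_zero [simp]: "0 \<in> K" and K_one [simp]: "1 \<in> K"
  using Q_gt_1 by (auto simp: K_iff)

lemma K_add: "x \<in> K \<Longrightarrow> y \<in> K \<Longrightarrow> x + y \<in> K"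
  by (simp add: K_iff Q_def fr_add)

lemma K_mult: "x \<in> K \<Longrightarrow> y \<in> K \<Longrightarrow> x * y \<in> K"
  by (simp add: K_iff power_mult_distrib)

lemma K_uminus: "x \<in> K \<Longrightarrow> - x \<in> K"
  by (simp add: K_iff Q_def fr_uminus)

lemma K_diff: "x \<in> K \<Longrightarrow> y \<in> K \<Longrightarrow> x - y \<in> K"
  by (simp add: K_iff Q_def fr_diff)

lemma K_divide: "x \<in> K \<Longrightarrow> y \<in> K \<Longrightarrow> x / y \<in> K"
  by (simp add: K_iff power_divide)

lemma K_power: "x \<in> K \<Longrightarrow> x ^ k \<in> K"
  by (metis K_iff mult.commute power_mult)

lemmas K_intros = K_add K_mult K_uminus K_diff K_divide K_power K_zero K_one

lemma K_frob_iff: "x ^ (CHAR('a) ^ i) \<in> K \<longleftrightarrow> x \<in> K"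
proof -
  have "(x ^ (CHAR('a) ^ i)) ^ Q = (x ^ Q) ^ (CHAR('a) ^ i)"
    by (simp flip: power_mult add: mult.commute)
  then show ?thesis by (simp add: K_iff fr_inj)
qed

lemma frob_surj: "\<exists>y::'a. y ^ (CHAR('a) ^ i) = x"
proof -
  have "surj (\<lambda>x::'a. x ^ (CHAR('a) ^ i))"
    by (rule finite_UNIV_inj_surj[OF finite]) (simp only: inj_def fr_inj, blast)
  then show ?thesis by (metis surjD)
qed

text \<open>The exponent of the norm from the whole field to \<open>K\<close>, equal to (q - 1) / (Q
  - 1).\<close>

definition norm_exp :: nat where "norm_exp = (\<Sum>i<r. Q ^ i)"

lemma norm_exp_mult: "(Q - 1) * norm_exp = CARD('a) - 1"
proof -
  have "int ((Q - 1) * norm_exp) = (int Q - 1) * (\<Sum>i<r. int Q ^ i)"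
    using Q_gt_1 by (simp add: norm_exp_def of_nat_diff)
  also have "\<dots> = int Q ^ r - 1" by (rule power_diff_1_eq[symmetric])
  also have "\<dots> = int (CARD('a) - 1)" using Q_gt_1 by (simp add: CARD_Q of_nat_diff)
  finally show ?thesis by (simp only: of_nat_eq_iff)
qed

lemma power_CARD_minus_1: "x \<noteq> 0 \<Longrightarrow> x ^ (CARD('a) - 1) = (1::'a)"
proof -
  assume "x \<noteq> 0"
  have "x ^ (CARD('a) - 1) * x = x"
    using finite_field_power_card_eq_same[of x]
    by (metis CARD_Q Q_gt_1 One_nat_def Suc_pred' mult.commute neq0_conv not_less_zero power_Suc zero_less_power)
  with \<open>x \<noteq> 0\<close> show ?thesis by simp
qed

lemma K_nz_iff: "x \<noteq> 0 \<Longrightarrow> x \<in> K \<longleftrightarrow> x ^ (Q - 1) = 1"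
proof -
  assume "x \<noteq> 0"
  have "x ^ Q = x ^ (Q - 1) * x" using Q_gt_1 by (metis Suc_diff_1 less_trans mult.commute power_Suc zero_less_one)
  with \<open>x \<noteq> 0\<close> show ?thesis by (simp add: K_iff)
qed

lemma norm_in_K: "x ^ norm_exp \<in> K"
proof (cases "x = 0")
  case True
  have "norm_exp > 0" unfolding norm_exp_def using r_pos Q_gt_1 by (intro sum_pos) auto
  with True show ?thesis by (simp add: zero_power)
next
  case False
  have "(x ^ norm_exp) ^ (Q - 1) = 1"
    using power_CARD_minus_1[OF False] by (metis norm_exp_mult mult.commute power_mult)
  with False show ?thesis by (simp add: K_nz_iff)
qed

lemma card_power_eq:
  assumes "k > 0"
  shows "card {x::'a. x ^ k = c} \<le> k"
proof -
  have "Polynomial.coeff (Polynomial.monom 1 k - [:c:]) k = (1::'a)" using assms by (cases k) auto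
  then have "Polynomial.monom 1 k - [:c:] \<noteq> 0" by (metis coeff_0 zero_neq_one)
  moreover have "degree (Polynomial.monom 1 k - [:c:]) \<le> k" by (rule degree_diff_le) (auto simp: degree_monom_le)
  ultimately show ?thesis
    using card_poly_roots_bound[of "Polynomial.monom 1 k - [:c:]"] by (auto simp: poly_monom)
qed

text \<open>Counting roots of x^(Q-1) = 1 bounds \<open>K\<close> from above. For the lower bound,
  the norm maps the q - 1 nonzero elements to nonzero elements of \<open>K\<close>, with fibres of
  size at most \<open>norm_exp\<close>.\<close>

lemma card_K: "card K = Q"
proof (rule antisym)
  have "K = insert 0 {x. x ^ (Q - 1) = 1}"
    using K_nz_iff Q_gt_1 by (auto simp: zero_power) (metis One_nat_def zero_less_diff zero_neq_one zero_power)
  also have "card \<dots> \<le> Suc (card {x::'a. x ^ (Q - 1) = 1})" by (simp add: card_insert_le_m1 card_insert_if)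
  also have "\<dots> \<le> Suc (Q - 1)" using card_power_eq[of "Q - 1" 1] Q_gt_1 by simp
  finally show "card K \<le> Q" using Q_gt_1 by simp
next
  let ?f = "\<lambda>x::'a. x ^ norm_exp"
  have N: "norm_exp > 0" unfolding norm_exp_def using r_pos Q_gt_1 by (intro sum_pos) auto
  have "(UNIV - {0::'a}) \<subseteq> (\<Union>c\<in>K - {0}. {x. ?f x = c})" using norm_in_K by auto
  then have "card (UNIV - {0::'a}) \<le> card (\<Union>c\<in>K - {0}. {x. ?f x = c})" by (rule card_mono[rotated]) simp
  also have "\<dots> \<le> (\<Sum>c\<in>K - {0}. card {x. ?f x = c})" by (rule card_UN_le) simp
  also have "\<dots> \<le> (\<Sum>c\<in>K - {0}. norm_exp)" by (rule sum_mono) (use card_power_eq N in auto)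
  also have "\<dots> = (card K - 1) * norm_exp" by simp
  finally have "(Q - 1) * norm_exp \<le> (card K - 1) * norm_exp" unfolding norm_exp_mult by (simp add: card_Diff_singleton)
  then have "Q - 1 \<le> card K - 1" using N by (simp del: One_nat_def)
  then show "Q \<le> card K" using Q_gt_1 by linarith
qed

text \<open>If \<open>norm_exp\<close> = 2 j + 1, then the norm of d lies in \<open>K\<close> and
  differs from d by the square of d^j; in characteristic 2 every d is a square. This is what makes
  \<open>T\<close> transitive on sublines.\<close>

lemma square_times_K:
  assumes "CHAR('a) = 2 \<or> odd r" "d \<noteq> (0::'a)"
  obtains c s where "c \<noteq> 0" "s \<in> K" "s \<noteq> 0" "d = c * c * s"
proof (cases "CHAR('a) = 2")
  case True
  obtain c :: 'a where "c ^ (CHAR('a) ^ 1) = d" using frob_surj by blast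
  then have "d = c * c * 1" unfolding True by (simp add: power2_eq_square)
  moreover have "c \<noteq> 0" using assms(2) calculation by auto
  ultimately show ?thesis using that[of c 1] by simp
next
  case False
  then have "odd (CHAR('a))"
    using primes_dvd_imp_eq[OF two_is_prime_nat CHAR_prime[where 'a='a]] by auto
  then have "odd Q" by (simp add: Q_def)
  have "odd (\<Sum>i<k. Q ^ i) \<longleftrightarrow> odd k" for k
  proof (induction k)
    case (Suc k)
    have "odd (Q ^ k)" using \<open>odd Q\<close> by simp
    then show ?case using Suc by (simp only: sum.lessThan_Suc even_add even_Suc) blast
  qed simp
  then have "odd norm_exp" using assms False by (simp add: norm_exp_def)
  then obtain j where j: "norm_exp = 2 * j + 1" by (rule oddE)
  define s where "s = d ^ norm_exp"
  define c where "c = inverse (d ^ j)"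
  have "s = d ^ j * d ^ j * d" by (simp add: s_def j power_add mult_2)
  moreover have "d ^ j \<noteq> 0" using assms(2) by simp
  moreover have *: "inverse x * inverse x * (x * x * d) = d" if "x \<noteq> 0" for x
    using that by (simp add: field_simps)
  ultimately have "c * c * s = d" using *[of "d ^ j"] by (simp only: c_def)
  then have "d = c * c * s" by (rule sym)
  show ?thesis
  proof (rule that[OF _ _ _ \<open>d = c * c * s\<close>])
    show "c \<noteq> 0" "s \<noteq> 0" using assms(2) by (simp_all add: c_def s_def)
    show "s \<in> K" using norm_in_K by (simp add: s_def)
  qed
qed

definition MK :: "'a ^ 2 ^ 2 \<Rightarrow> bool" where
  "MK A \<longleftrightarrow> (\<forall>i j. A $ i $ j \<in> K)"

lemma MK_M2 [simp]: "MK (M2 a b c d) \<longleftrightarrow> a \<in> K \<and> b \<in> K \<and> c \<in> K \<and> d \<in> K"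
  by (auto simp: MK_def forall_2)

lemma MK_mat [simp]: "MK (mat c) \<longleftrightarrow> c \<in> K"
  by (simp add: mat_M2)

lemma MK_mult: "MK A \<Longrightarrow> MK B \<Longrightarrow> MK (A ** B)"
  by (rule M2_cases[of A]; rule M2_cases[of B]) (auto intro: K_intros)

lemma MK_det: "MK A \<Longrightarrow> det A \<in> K"
  by (rule M2_cases[of A]) (auto intro: K_intros)

lemma MK_inv2: "MK A \<Longrightarrow> MK (inv2 A)"
  using MK_det[of A] by (cases rule: M2_cases[of A]) (auto simp: inv2_def intro!: K_intros)

lemma MK_frm_iff: "MK (frm i A) \<longleftrightarrow> MK A"
  by (rule M2_cases[of A]) (simp add: K_frob_iff)

lemma frm_surj: "\<exists>B::'a^2^2. frm i B = A"
proof -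
  obtain a b c d where A: "A = M2 a b c d" by (rule M2_cases)
  obtain a' where a: "a' ^ (CHAR('a) ^ i) = a" using frob_surj by blast
  obtain b' where b: "b' ^ (CHAR('a) ^ i) = b" using frob_surj by blast
  obtain c' where c: "c' ^ (CHAR('a) ^ i) = c" using frob_surj by blast
  obtain d' where d: "d' ^ (CHAR('a) ^ i) = d" using frob_surj by blast
  from a b c d have "frm i (M2 a' b' c' d') = A" using A by simp
  then show ?thesis ..
qed

text \<open>An invertible matrix \<open>h\<close> stands for the subline \<open>h L\<close>, where \<open>L\<close> is the projective line over
  \<^term>\<open>K\<close>; two matrices are equivalent iff they yield the same subline.\<close>

definition eqv :: "'a ^ 2 ^ 2 \<Rightarrow> 'a ^ 2 ^ 2 \<Rightarrow> bool" where
  "eqv h h' \<longleftrightarrow> (\<exists>c S. c \<noteq> 0 \<and> MK S \<and> det S \<noteq> 0 \<and> h' = mat c ** (h ** S))"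

lemma eqv_refl [simp]: "eqv h h"
  unfolding eqv_def by (rule exI[of _ 1], rule exI[of _ "mat 1"]) simp

lemma eqv_sym: "eqv h h' \<Longrightarrow> eqv h' h"
proof -
  assume "eqv h h'"
  then obtain c S where *: "c \<noteq> 0" "MK S" "det S \<noteq> 0" "h' = mat c ** (h ** S)" by (auto simp: eqv_def)
  have "h = mat (1 / c) ** (h' ** inv2 S)"
    using * by (simp add: matrix_mul_assoc[symmetric] inv2_right mat_mult_mat)
  with * show ?thesis unfolding eqv_def using MK_inv2 det_inv2_nz
    by (intro exI[of _ "1/c"] exI[of _ "inv2 S"]) auto
qed

lemma eqv_trans [trans]: "eqv h h' \<Longrightarrow> eqv h' h'' \<Longrightarrow> eqv h h''"
proof -
  assume "eqv h h'" "eqv h' h''"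
  then obtain c S d R where *: "c \<noteq> 0" "MK S" "det S \<noteq> 0" "h' = mat c ** (h ** S)"
    "d \<noteq> 0" "MK R" "det R \<noteq> 0" "h'' = mat d ** (h' ** R)" by (auto simp: eqv_def)
  then have "h'' = mat (d * c) ** (h ** (S ** R))"
    by (simp add: matrix_mul_assoc mat_mult)
  with * show ?thesis unfolding eqv_def
    by (intro exI[of _ "d * c"] exI[of _ "S ** R"]) (auto simp: det_mul MK_mult)
qed

lemma eqv_mult: "eqv h h' \<Longrightarrow> eqv (g ** h) (g ** h')"
  unfolding eqv_def by (metis mat_left_commute matrix_mul_assoc)

lemma eqv_mult_iff: "det g \<noteq> 0 \<Longrightarrow> eqv (g ** h) (g ** h') \<longleftrightarrow> eqv h h'"
  using eqv_mult[of "g ** h" "g ** h'" "inv2 g"] eqv_mult[of h h' g] by auto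

lemma eqv_smult: "c \<noteq> 0 \<Longrightarrow> eqv h (mat c ** h)"
  unfolding eqv_def by (rule exI[of _ c], rule exI[of _ "mat 1"]) simp

lemma eqv_K: "MK S \<Longrightarrow> det S \<noteq> 0 \<Longrightarrow> eqv h (h ** S)"
  unfolding eqv_def by (rule exI[of _ 1], rule exI[of _ S]) simp

lemma eqv_det: "eqv h h' \<Longrightarrow> det h \<noteq> 0 \<Longrightarrow> det h' \<noteq> 0"
  by (auto simp: eqv_def det_mul)

lemma eqv_frm: "eqv h h' \<Longrightarrow> eqv (frm i h) (frm i h')"
proof -
  assume "eqv h h'"
  then obtain c S where "c \<noteq> 0" "MK S" "det S \<noteq> 0" "h' = mat c ** (h ** S)" by (auto simp: eqv_def)
  then show ?thesis unfolding eqv_def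
    by (intro exI[of _ "c ^ (CHAR('a) ^ i)"] exI[of _ "frm i S"]) (simp add: frm_mult MK_frm_iff)
qed

lemma eqv_frm_iff: "eqv (frm i h) (frm i h') \<longleftrightarrow> eqv h h'"
proof
  assume "eqv (frm i h) (frm i h')"
  then obtain c S where *: "c \<noteq> 0" "MK S" "det S \<noteq> 0" "frm i h' = mat c ** (frm i h ** S)"
    by (auto simp: eqv_def)
  obtain d :: 'a where d: "d ^ (CHAR('a) ^ i) = c" using frob_surj by blast
  obtain R where R: "frm i R = S" using frm_surj by blast
  have "frm i h' = frm i (mat d ** (h ** R))" using * d R by (simp add: frm_mult)
  then have "h' = mat d ** (h ** R)" by (simp only: frm_inj)
  then show "eqv h h'" unfolding eqv_def
    using * d R by (intro exI[of _ d] exI[of _ R]) (auto simp: MK_frm_iff)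
qed (rule eqv_frm)

lemma eqv_act_iff: "det A \<noteq> 0 \<Longrightarrow> eqv (A ** frm i h) (A ** frm i h') \<longleftrightarrow> eqv h h'"
  by (simp add: eqv_mult_iff eqv_frm_iff)

section \<open>Stabilizers of sublines and adjacency\<close>

definition stab :: "'a ^ 2 ^ 2 \<Rightarrow> nat \<Rightarrow> 'a ^ 2 ^ 2 \<Rightarrow> bool" where
  "stab A i h \<longleftrightarrow> eqv h (A ** frm i h)"

lemma stab_eqv: "eqv h k \<Longrightarrow> det A \<noteq> 0 \<Longrightarrow> stab A i h \<longleftrightarrow> stab A i k"
  unfolding stab_def by (meson eqv_act_iff eqv_sym eqv_trans)

abbreviation trivial_pair :: "'a ^ 2 ^ 2 \<Rightarrow> nat \<Rightarrow> bool" where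
  "trivial_pair A i \<equiv> (\<exists>c. c \<noteq> 0 \<and> A = mat c) \<and> (\<forall>x::'a. x ^ (CHAR('a) ^ i) = x)"

text \<open>Quantifying over all of P\<Gamma>L instead of \<open>G\<close> lets one adjacency serve
  every \<open>G\<close>: a base for a group is a base for its subgroups.\<close>

definition adj :: "'a ^ 2 ^ 2 \<Rightarrow> 'a ^ 2 ^ 2 \<Rightarrow> bool" where
  "adj h h' \<longleftrightarrow> (\<forall>A i. det A \<noteq> 0 \<and> stab A i h \<and> stab A i h' \<longrightarrow>
     trivial_pair A i)"

lemma adj_eqv: "adj h h' \<Longrightarrow> eqv h k \<Longrightarrow> eqv h' k' \<Longrightarrow> adj k k'"
  unfolding adj_def using stab_eqv[of h k] stab_eqv[of h' k'] by (metis (no_types))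

text \<open>Conjugation by g; since the map is semilinear, the right factor is twisted by the
  Frobenius power.\<close>

lemma stab_mult:
  assumes "det g \<noteq> 0"
  shows "stab A i (g ** h) \<longleftrightarrow> stab (inv2 g ** A ** frm i g) i h"
  unfolding stab_def using eqv_mult_iff[OF det_inv2_nz[OF assms], of "g ** h" "A ** frm i (g ** h)"] assms
  by (simp add: frm_mult matrix_mul_assoc[symmetric])

lemma adj_mult:
  assumes "adj h h'" "det g \<noteq> 0"
  shows "adj (g ** h) (g ** h')"
  unfolding adj_def
proof (intro allI impI, elim conjE)
  fix A i assume *: "det A \<noteq> 0" "stab A i (g ** h)" "stab A i (g ** h')"
  let ?A = "inv2 g ** A ** frm i g"
  have "det ?A \<noteq> 0" "stab ?A i h" "stab ?A i h'"
    using * assms det_inv2_nz by (auto simp: stab_mult det_mul)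
  then obtain c where c: "c \<noteq> 0" "?A = mat c" and i: "\<forall>x::'a. x ^ (CHAR('a) ^ i) = x"
    using assms(1) unfolding adj_def by blast
  have "frm i g = g" using i by (rule_tac M2_cases[of g]) simp
  have "A = g ** ?A ** inv2 (frm i g)" using assms by (simp add: matrix_mul_assoc[symmetric] inv2_right)
  also have "\<dots> = g ** mat c ** inv2 g" using c \<open>frm i g = g\<close> by simp
  also have "\<dots> = mat c" using assms by (simp add: matrix_mul_assoc[symmetric] mat_left_commute inv2_right)
  finally show "trivial_pair A i" using c i by blast
qed

text \<open>The entries of the conjugates of the two elementary matrices and of their product are the
  quotients by \<open>det B\<close> of products of two entries of \<open>B\<close>, up to signs and sums.\<close>

lemma normalizer_K:
  assumes B: "det B \<noteq> 0"
    and conj: "\<And>S. MK S \<Longrightarrow> det S = 1 \<Longrightarrow>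
      \<exists>c R. c \<noteq> 0 \<and> MK R \<and> det R = 1 \<and> B ** S = mat c ** (R ** B)"
  shows "eqv (mat 1) B"
proof -
  have conjK: "MK (B ** S ** inv2 B)" if S: "MK S" "det S = 1" for S
  proof -
    obtain c R where c: "c \<noteq> 0" "MK R" "det R = 1" "B ** S = mat c ** (R ** B)" using conj[OF S] by blast
    \<comment> \<open>Comparing determinants leaves only c = 1 and c = -1, so the conjugate itself,
      not merely a multiple of it, is over \<open>K\<close>.\<close>
    have "det (B ** S) = det (mat c ** (R ** B))" using c(4) by (rule arg_cong)
    then have "c * c = 1" using c(3) B S by (simp add: det_mul)
    then have "c = 1 \<or> c = - 1" by (simp add: square_eq_1_iff)
    then have "c \<in> K" by (elim disjE) (simp_all add: K_uminus)
    moreover have "B ** S ** inv2 B = mat c ** R" unfolding c(4) using B by (simp add: matrix_mul_assoc)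
    ultimately show ?thesis using c(2) by (simp add: MK_mult)
  qed
  obtain a b c d where Bd: "B = M2 a b c d" by (rule M2_cases)
  define D where "D = det B"
  have D: "D \<noteq> 0" "D = a * d - b * c" using B Bd by (auto simp: D_def)
  have iB: "inv2 B = M2 (d / D) (- b / D) (- c / D) (a / D)" by (simp add: inv2_def Bd D(2))
  have U: "MK (M2 (a*d/D - (a+b)*c/D) (- (a*b/D) + (a+b)*a/D) (c*d/D - (c+d)*c/D) (- (c*b/D) + (c+d)*a/D))"
    using conjK[of "M2 1 1 0 1"] unfolding iB by (simp add: Bd)
  have V: "MK (M2 ((a+b)*d/D - b*c/D) (- ((a+b)*b/D) + b*a/D) ((c+d)*d/D - d*c/D) (- ((c+d)*b/D) + d*a/D))"
    using conjK[of "M2 1 0 1 1"] unfolding iB by (simp add: Bd)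
  have UV: "MK (M2 ((a*2+b)*d/D - (a+b)*c/D) (- ((a*2+b)*b/D) + (a+b)*a/D) ((c*2+d)*d/D - (c+d)*c/D) (- ((c*2+d)*b/D) + (c+d)*a/D))"
    using conjK[of "M2 2 1 1 1"] K_add[OF K_one K_one] unfolding iB by (simp add: Bd)
  have one: "a*d/D - b*c/D = 1" using D(1) unfolding diff_divide_distrib[symmetric] D(2)[symmetric] by simp
  have aa: "a * a / D \<in> K"
  proof -
    have "- (a*b/D) + (a+b)*a/D = a*a/D" by (simp add: ring_distribs add_divide_distrib mult.commute)
    then show ?thesis using U unfolding MK_M2 by (elim conjE) (simp only:)
  qed
  have cc: "c * c / D \<in> K"
  proof -
    have "c*d/D - (c+d)*c/D = - (c*c/D)" by (simp add: ring_distribs add_divide_distrib mult.commute)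
    then have "- (c*c/D) \<in> K" using U unfolding MK_M2 by (elim conjE) (simp only:)
    from K_uminus[OF this] show ?thesis by (simp only: minus_minus)
  qed
  have ac: "a * c / D \<in> K"
  proof -
    have "- (c*b/D) + (c+d)*a/D - 1 = a * c / D"
      unfolding one[symmetric] by (simp add: ring_distribs add_divide_distrib mult.commute)
    then show ?thesis using K_diff[OF conjunct2[OF conjunct2[OF conjunct2[OF U[unfolded MK_M2]]]] K_one] by (simp only:)
  qed
  have bb: "b * b / D \<in> K"
  proof -
    have "- ((a+b)*b/D) + b*a/D = - (b*b/D)" by (simp add: ring_distribs add_divide_distrib mult.commute)
    then have "- (b*b/D) \<in> K" using V unfolding MK_M2 by (elim conjE) (simp only:)
    from K_uminus[OF this] show ?thesis by (simp only: minus_minus)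
  qed
  have dd: "d * d / D \<in> K"
  proof -
    have "(c+d)*d/D - d*c/D = d*d/D" by (simp add: ring_distribs add_divide_distrib mult.commute)
    then show ?thesis using V unfolding MK_M2 by (elim conjE) (simp only:)
  qed
  have bd: "b * d / D \<in> K"
  proof -
    have "(a+b)*d/D - b*c/D - 1 = b * d / D"
      unfolding one[symmetric] by (simp add: ring_distribs add_divide_distrib mult.commute)
    then show ?thesis using K_diff[OF conjunct1[OF V[unfolded MK_M2]] K_one] by (simp only:)
  qed
  have ad: "a * d / D \<in> K"
  proof -
    have "(a*2+b)*d/D - (a+b)*c/D - 1 - b * d / D + a * c / D = a * d / D"
      unfolding one[symmetric] by (simp add: ring_distribs add_divide_distrib mult.commute)
    then show ?thesis using K_add[OF K_diff[OF K_diff[OF conjunct1[OF UV[unfolded MK_M2]] K_one] bd] ac] by (simp only:)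
  qed
  have bc: "b * c / D \<in> K" using K_diff[OF ad K_one] unfolding one[symmetric] by simp
  have ab: "a * b / D \<in> K"
  proof -
    have "a * a / D - b * b / D - (- ((a*2+b)*b/D) + (a+b)*a/D) = a * b / D"
      by (simp add: ring_distribs add_divide_distrib mult.commute)
    then show ?thesis using K_diff[OF K_diff[OF aa bb] conjunct1[OF conjunct2[OF UV[unfolded MK_M2]]]] by (simp only:)
  qed
  have cd: "c * d / D \<in> K"
  proof -
    have "((c*2+d)*d/D - (c+d)*c/D) - d * d / D + c * c / D = c * d / D"
      by (simp add: ring_distribs add_divide_distrib mult.commute)
    then show ?thesis using K_add[OF K_diff[OF conjunct1[OF conjunct2[OF conjunct2[OF UV[unfolded MK_M2]]]] dd] cc] by (simp only:)
  qed
  \<comment> \<open>All products of two entries of B lie in D K, so quotients of entries lie in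
    \<open>K\<close>, and dividing B by a nonzero entry of its first column gives a matrix over
    \<open>K\<close>.\<close>
  have quot: "y / x \<in> K" if "x * y / D \<in> K" "x * x / D \<in> K" "x \<noteq> 0" for x y
    using K_divide[OF that(1,2)] that(3) D(1) by simp
  show ?thesis
  proof (cases "a = 0")
    case False
    then have eq: "M2 1 (b/a) (c/a) (d/a) = mat (1 / a) ** B" unfolding Bd mat_M2 M2_mult by simp
    have "MK (M2 1 (b/a) (c/a) (d/a))"
      unfolding MK_M2 by (intro conjI K_one quot[OF ab aa False] quot[OF ac aa False] quot[OF ad aa False])
    then have "MK (mat (1 / a) ** B)" unfolding eq .
    then show ?thesis unfolding eqv_def using False B
      by (intro exI[of _ a] exI[of _ "mat (1/a) ** B"]) (simp add: det_mul mat_mult_mat)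
  next
    case True
    have c: "c \<noteq> 0" using D(1) unfolding D(2) True by auto
    have eq: "M2 (a/c) (b/c) 1 (d/c) = mat (1 / c) ** B" using c unfolding Bd mat_M2 M2_mult by simp
    have "MK (M2 (a/c) (b/c) 1 (d/c))"
      unfolding MK_M2 using ac bc
      by (intro conjI K_one quot[OF _ cc c] quot[OF cd cc c]) (simp_all only: mult.commute)
    then have "MK (mat (1 / c) ** B)" unfolding eq .
    then show ?thesis unfolding eqv_def using c B
      by (intro exI[of _ c] exI[of _ "mat (1/c) ** B"]) (simp add: det_mul mat_mult_mat)
  qed
qed

end

section \<open>Explicit adjacent sublines and normal forms for pairs\<close>

context subfield
begin

text \<open>For x outside \<open>K\<close>: no field automorphism except the identity maps the set x
  K to itself.\<close>

definition generic :: "'a \<Rightarrow> bool" where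
  "generic x \<longleftrightarrow> x \<notin> K \<and> (\<forall>i. x ^ (CHAR('a) ^ i) / x \<in> K \<longrightarrow> (\<forall>y::'a. y ^ (CHAR('a) ^ i) = y))"

text \<open>The sublines K and \<alpha> K + \<beta>, each completed by \<infinity>, meet in
  \<infinity> only.\<close>

definition off_line :: "'a \<Rightarrow> 'a \<Rightarrow> bool" where
  "off_line \<alpha> \<beta> \<longleftrightarrow> (\<forall>s\<in>K. \<forall>t\<in>K. \<beta> \<noteq> s + \<alpha> * t)"

text \<open>The two sublines share only \<infinity>, so a common stabilizing element fixes
  \<infinity> and is upper triangular. Comparing leading coefficients gives a Frobenius power
  preserving \<alpha> K, hence the identity. Of the remaining affine maps, one that is not a
  translation would put \<beta> into K + \<alpha> K, and a nontrivial translation would put \<alpha>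
  into \<open>K\<close>.\<close>

lemma adj_explicit:
  assumes "generic \<alpha>" "off_line \<alpha> \<beta>"
  shows "adj (mat 1) (M2 \<alpha> \<beta> 0 1)"
  unfolding adj_def
proof (intro allI impI, elim conjE)
  fix A :: "'a^2^2" and i
  define fr where "fr = (\<lambda>x::'a. x ^ (CHAR('a) ^ i))"
  assume A: "det A \<noteq> 0" "stab A i (mat 1)" "stab A i (M2 \<alpha> \<beta> 0 1)"
  obtain c S where c: "c \<noteq> 0" "MK S" "det S \<noteq> 0" "A = mat c ** S"
    using A(2) unfolding stab_def eqv_def by auto
  obtain s1 s2 s3 s4 where S: "S = M2 s1 s2 s3 s4" by (rule M2_cases)
  obtain d R where d: "d \<noteq> 0" "MK R" "det R \<noteq> 0"
      "A ** frm i (M2 \<alpha> \<beta> 0 1) = mat d ** (M2 \<alpha> \<beta> 0 1 ** R)"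
    using A(3) unfolding stab_def eqv_def by blast
  obtain r1 r2 r3 r4 where R: "R = M2 r1 r2 r3 r4" by (rule M2_cases)
  have sK: "s1 \<in> K" "s2 \<in> K" "s3 \<in> K" "s4 \<in> K" using c(2) unfolding S by auto
  have rK: "r1 \<in> K" "r2 \<in> K" "r3 \<in> K" "r4 \<in> K" using d(2) unfolding R by auto
  have eqs: "c * s1 * fr \<alpha> = d * (\<alpha> * r1 + \<beta> * r3)" "c * s3 * fr \<alpha> = d * r3"
    "c * s1 * fr \<beta> + c * s2 = d * (\<alpha> * r2 + \<beta> * r4)" "c * s3 * fr \<beta> + c * s4 = d * r4"
    using d(4) unfolding c(4) S R mat_M2 by (simp_all add: fr_def)
  have \<alpha>: "\<alpha> \<notin> K" and good: "fr \<alpha> / \<alpha> \<in> K \<Longrightarrow> \<forall>y. fr y = y"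
    using assms(1) unfolding generic_def fr_def by blast+
  have \<beta>: "\<beta> \<noteq> s + \<alpha> * t" if "s \<in> K" "t \<in> K" for s t
    using assms(2) that unfolding off_line_def by blast
  have \<alpha>0: "\<alpha> \<noteq> 0" using \<alpha> by auto
  then have fr0: "fr \<alpha> \<noteq> 0" by (simp add: fr_def)
  have r3: "r3 = 0"
  proof (rule ccontr)
    assume r3: "r3 \<noteq> 0"
    then have s3: "s3 \<noteq> 0" using eqs(2) d(1) by auto
    have "c * fr \<alpha> * (s1 * r3) = c * fr \<alpha> * (s3 * (\<alpha> * r1 + \<beta> * r3))"
    proof -
      have "c * fr \<alpha> * (s1 * r3) = (c * s1 * fr \<alpha>) * r3" by (simp only: mult_ac)
      also have "\<dots> = (c * s3 * fr \<alpha>) * (\<alpha> * r1 + \<beta> * r3)" unfolding eqs(1,2) by (simp only: mult_ac)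
      finally show ?thesis by (simp only: mult_ac)
    qed
    then have "s1 * r3 = s3 * (\<alpha> * r1 + \<beta> * r3)" using c(1) fr0 by simp
    then have "\<beta> = s1 / s3 + \<alpha> * (- (r1 / r3))" using r3 s3 by (simp add: field_simps)
    then show False using \<beta>[of "s1 / s3" "- (r1 / r3)"] sK rK by (simp add: K_divide K_uminus)
  qed
  then have s3: "s3 = 0" using eqs(2) c(1) fr0 by simp
  have nz: "s1 \<noteq> 0" "s4 \<noteq> 0" "r1 \<noteq> 0" "r4 \<noteq> 0" using c(3) d(3) unfolding S R s3 r3 by auto
  define e where "e = s4 / r4"
  have e: "e \<in> K" "e \<noteq> 0" using nz sK rK by (simp_all add: e_def K_divide)
  have "c * s4 = d * r4" using eqs(4) s3 by simp
  then have de: "d = c * e" using nz by (simp add: e_def field_simps)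
  have "c * (s1 * fr \<alpha>) = c * (e * (\<alpha> * r1))" using eqs(1) unfolding de r3 by (simp add: mult_ac)
  then have "s1 * fr \<alpha> = e * (\<alpha> * r1)" using c(1) by simp
  then have "fr \<alpha> / \<alpha> = e * r1 / s1" using nz \<alpha>0 by (simp add: field_simps)
  then have "fr \<alpha> / \<alpha> \<in> K" using e sK rK by (simp add: K_divide K_mult)
  then have fr: "fr y = y" for y using good by blast
  have "c * (s1 * \<beta> + s2) = c * (e * \<alpha> * r2 + s4 * \<beta>)"
    using eqs(3) nz unfolding de fr by (simp add: e_def field_simps)
  then have *: "s1 * \<beta> + s2 = e * \<alpha> * r2 + s4 * \<beta>" using c(1) by simp
  have s14: "s1 = s4"
  proof (rule ccontr)
    assume ne: "s1 \<noteq> s4"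
    have "(s1 - s4) * \<beta> = e * \<alpha> * r2 - s2" using * by (simp add: algebra_simps)
    then have "\<beta> = (e * \<alpha> * r2 - s2) / (s1 - s4)" using ne by (simp add: eq_divide_eq mult.commute)
    also have "\<dots> = - s2 / (s1 - s4) + \<alpha> * (e * r2 / (s1 - s4))" by (simp add: diff_divide_distrib mult_ac)
    finally have "\<beta> = - s2 / (s1 - s4) + \<alpha> * (e * r2 / (s1 - s4))" .
    then show False
      using \<beta>[of "- s2 / (s1 - s4)" "e * r2 / (s1 - s4)"] sK rK e by (simp add: K_divide K_uminus K_mult K_diff)
  qed
  have "r2 = 0"
  proof (rule ccontr)
    assume r2: "r2 \<noteq> 0"
    then have "\<alpha> = s2 / (e * r2)" using * s14 e by (simp add: field_simps)
    then show False using \<alpha> sK rK e by (simp add: K_divide K_mult)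
  qed
  then have "s2 = 0" using * s14 by simp
  then have "A = mat (c * s1)" unfolding c(4) S s3 s14 by (simp add: mat_M2)
  then show "trivial_pair A i"
    using fr c(1) nz(1) unfolding fr_def by (metis mult_eq_0_iff)
qed

text \<open>The affine map \<open>u\<close>, z \<mapsto> e z - d, carries the first subline (K +
  d)/e to K and the second one, a K + b/e, to e a K + b - d, which reduces the claim to
  \<open>adj_explicit\<close>.\<close>

lemma adj_upper:
  assumes "e \<noteq> 0" "a \<noteq> 0" "generic (e * a)" "off_line (e * a) (b - d)"
  shows "adj (M2 1 d 0 e) (M2 a (b / e) 0 1)"
proof -
  define u where "u = M2 e (- d) 0 1"
  have u: "det u \<noteq> 0" using assms by (simp add: u_def)
  have "adj (inv2 u ** mat 1) (inv2 u ** M2 (e * a) (b - d) 0 1)"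
    by (rule adj_mult[OF adj_explicit det_inv2_nz[OF u]]) (use assms in auto)
  also have "M2 (e * a) (b - d) 0 1 = u ** M2 a (b / e) 0 1" using assms by (simp add: u_def)
  also have "inv2 u ** (u ** M2 a (b / e) 0 1) = M2 a (b / e) 0 1" using u by simp
  finally have "adj (inv2 u) (M2 a (b / e) 0 1)" by simp
  moreover have "eqv (inv2 u) (M2 1 d 0 e)"
  proof -
    have "mat e = u ** M2 1 d 0 e" by (simp add: u_def mat_M2)
    then have "inv2 u ** mat e = M2 1 d 0 e" using u by simp
    then show ?thesis using eqv_smult[OF assms(1), of "inv2 u"] by (simp add: mat_comm)
  qed
  ultimately show ?thesis using adj_eqv eqv_refl by blast
qed

text \<open>The inversion \<open>w\<close>, z \<mapsto> 1/z, reduces this to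
  \<open>adj_upper\<close> with 1/a in place of a; \<open>w\<close> is over \<open>K\<close>, so
  multiplying by it on the right does not change a subline.\<close>

lemma adj_lower:
  assumes "e \<noteq> 0" "a \<noteq> 0" "generic (e / a)" "off_line (e / a) (- d)"
  shows "adj (M2 e 0 d 1) (M2 a 0 0 1)"
proof -
  define w where "w = M2 0 1 (1::'a) 0"
  have w: "det w \<noteq> 0" "MK w" by (simp_all add: w_def)
  have "adj (M2 1 d 0 e) (M2 (1 / a) (0 / e) 0 1)"
    by (rule adj_upper) (use assms in auto)
  then have "adj (w ** M2 1 d 0 e) (w ** M2 (1 / a) (0 / e) 0 1)" using w(1) by (rule adj_mult)
  moreover have "eqv (w ** M2 1 d 0 e) (w ** M2 1 d 0 e ** w)" using eqv_K w by blast
  moreover have "w ** M2 1 d 0 e ** w = M2 e 0 d 1" by (simp add: w_def)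
  moreover have "eqv (w ** M2 (1 / a) (0 / e) 0 1) (mat a ** (w ** M2 (1 / a) (0 / e) 0 1 ** w))"
    using eqv_K[OF w(2,1)] eqv_smult[OF assms(2)] eqv_trans by blast
  moreover have "mat a ** (w ** M2 (1 / a) (0 / e) 0 1 ** w) = M2 a 0 0 1"
    using assms by (simp add: w_def mat_M2)
  ultimately show ?thesis using adj_eqv by metis
qed

text \<open>The point (x : y) does not lie on the subline \<open>h L\<close>.\<close>

definition off :: "'a ^ 2 ^ 2 \<Rightarrow> 'a \<Rightarrow> 'a \<Rightarrow> bool" where
  "off h x y \<longleftrightarrow> (\<forall>s\<in>K. \<forall>t\<in>K. s \<noteq> 0 \<or> t \<noteq> 0 \<longrightarrow>
     x * (s * h$2$1 + t * h$2$2) \<noteq> y * (s * h$1$1 + t * h$1$2))"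

text \<open>A point of the first subline outside the second one is moved to \<open>\<infinity>\<close>, and a point of the
  second subline outside the first one to \<open>0\<close>.\<close>

lemma two_point_form:
  assumes det: "det (M2 a b c d) \<noteq> 0" "det (M2 a' b' c' d') \<noteq> 0"
    and off: "off (M2 a' b' c' d') a c" "off (M2 a b c d) b' d'"
  defines "g \<equiv> M2 a b' c d'"
  shows "\<exists>d1 e1 d2 e2. det g \<noteq> 0 \<and> M2 a b c d = g ** M2 1 d1 0 e1 \<and> M2 a' b' c' d' = g ** M2 e2 0 d2 1 \<and>
    d1 \<notin> K \<and> d2 \<notin> K \<and> e1 = det (M2 a b c d) / det g \<and> e2 = det (M2 a' b' c' d') / det g"
proof -
  have off1: "a * (s * c' + t * d') \<noteq> c * (s * a' + t * b')" if "s \<in> K" "t \<in> K" "s \<noteq> 0 \<or> t \<noteq> 0" for s t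
    using off(1) that unfolding off_def by auto
  have off2: "b' * (s * c + t * d) \<noteq> d' * (s * a + t * b)" if "s \<in> K" "t \<in> K" "s \<noteq> 0 \<or> t \<noteq> 0" for s t
    using off(2) that unfolding off_def by auto
  define D where "D = a * d' - b' * c"
  have D: "D \<noteq> 0" using off1[of 0 1] by (simp add: D_def mult.commute)
  have dg: "det g = D" by (simp add: g_def D_def)
  \<comment> \<open>Cramer's rule: coordinates of the remaining column of each matrix in the basis
    formed by the columns of \<open>g\<close>.\<close>
  define d1 where "d1 = (d' * b - b' * d) / D"
  define d2 where "d2 = (a * c' - c * a') / D"
  have "d1 \<notin> K"
  proof
    assume k: "d1 \<in> K"
    have "d1 * D = d' * b - b' * d" using D by (simp add: d1_def)
    then have "b' * ((- d1) * c + 1 * d) = d' * ((- d1) * a + 1 * b)" by (simp add: D_def algebra_simps)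
    then show False using off2[of "- d1" 1] k by (simp add: K_uminus)
  qed
  moreover have "d2 \<notin> K"
  proof
    assume k: "d2 \<in> K"
    have "d2 * D = a * c' - c * a'" using D by (simp add: d2_def)
    then have "a * (1 * c' + (- d2) * d') = c * (1 * a' + (- d2) * b')" by (simp add: D_def algebra_simps)
    then show False using off1[of 1 "- d2"] k by (simp add: K_uminus)
  qed
  moreover have "M2 a b c d = g ** M2 1 d1 0 (det (M2 a b c d) / D)"
  proof -
    have "a * (d' * b - b' * d) + b' * (a * d - b * c) = D * b" "c * (d' * b - b' * d) + d' * (a * d - b * c) = D * d"
      by (simp_all add: D_def algebra_simps)
    then show ?thesis using D by (simp add: g_def d1_def add_divide_distrib[symmetric])
  qed
  moreover have "M2 a' b' c' d' = g ** M2 (det (M2 a' b' c' d') / D) 0 d2 1"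
  proof -
    have "a * (a' * d' - b' * c') + b' * (a * c' - c * a') = D * a'" "c * (a' * d' - b' * c') + d' * (a * c' - c * a') = D * c'"
      by (simp_all add: D_def algebra_simps)
    then show ?thesis using D by (simp add: g_def d2_def add_divide_distrib[symmetric])
  qed
  ultimately show ?thesis unfolding dg using D
    by (intro exI[of _ d1] exI[of _ "det (M2 a b c d) / D"] exI[of _ d2] exI[of _ "det (M2 a' b' c' d') / D"] conjI) (rule refl | assumption)+
qed

lemma K_multiple:
  assumes "x * t = y * s" "s \<noteq> 0 \<or> t \<noteq> (0::'a)"
  obtains l where "x = l * s" "y = l * t"
proof (cases "s = 0")
  case True
  then show ?thesis using assms by (intro that[of "y / t"]) auto
next
  case False
  then show ?thesis using assms by (intro that[of "x / s"]) (auto simp: field_simps)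
qed

text \<open>A subline is determined by three of its points. The columns are multiples, by l and n,
  of vectors over \<open>K\<close>; that their sum is proportional to a vector over \<open>K\<close>
  as well forces l/n into \<open>K\<close>.\<close>

lemma K_points_eqv:
  assumes "det (M2 a b c d) \<noteq> 0"
    and 1: "s1 \<in> K" "t1 \<in> K" "s1 \<noteq> 0 \<or> t1 \<noteq> 0" "a * t1 = c * s1"
    and 2: "s2 \<in> K" "t2 \<in> K" "s2 \<noteq> 0 \<or> t2 \<noteq> 0" "b * t2 = d * s2"
    and 3: "s3 \<in> K" "t3 \<in> K" "s3 \<noteq> 0 \<or> t3 \<noteq> 0" "(a + b) * t3 = (c + d) * s3"
  shows "eqv (mat 1) (M2 a b c d)"
proof -
  obtain l where l: "a = l * s1" "c = l * t1" using K_multiple[OF 1(4,3)] by blast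
  obtain n where n: "b = n * s2" "d = n * t2" using K_multiple[OF 2(4,3)] by blast
  have det: "l * n * (s1 * t2 - s2 * t1) \<noteq> 0" using assms(1) by (simp add: l n algebra_simps)
  have *: "l * (s1 * t3 - t1 * s3) = n * (t2 * s3 - s2 * t3)"
    using 3(4) unfolding l n by (simp add: algebra_simps)
  \<comment> \<open>If the third point were the first, it would also be the second by the preceding
    equation, and the matrix would be singular.\<close>
  have "s1 * t3 - t1 * s3 \<noteq> 0"
  proof
    assume e: "s1 * t3 - t1 * s3 = 0"
    with * det have "s2 * t3 = t2 * s3" by auto
    with e have e2: "s2 * t3 = t2 * s3" "s1 * t3 = t1 * s3" by auto
    have "t3 * (s1 * t2 - s2 * t1) = (s1 * t3) * t2 - (s2 * t3) * t1" by (simp only: right_diff_distrib mult_ac)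
    also have "\<dots> = 0" unfolding e2 by (simp add: mult_ac)
    finally have z: "t3 * (s1 * t2 - s2 * t1) = 0" .
    have "s3 * (s1 * t2 - s2 * t1) = s1 * (t2 * s3) - s2 * (t1 * s3)" by (simp only: right_diff_distrib mult_ac)
    also have "\<dots> = 0" unfolding e2[symmetric] by (simp add: mult_ac)
    finally have "s3 * (s1 * t2 - s2 * t1) = 0" .
    with z det 3(3) show False by auto
  qed
  define k where "k = (t2 * s3 - s2 * t3) / (s1 * t3 - t1 * s3)"
  have "k \<in> K" using 1 2 3 by (simp add: k_def K_diff K_mult K_divide)
  have lk: "l = n * k" using * \<open>s1 * t3 - t1 * s3 \<noteq> 0\<close> by (simp add: k_def nonzero_eq_divide_eq)
  define S where "S = M2 (k * s1) s2 (k * t1) t2"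
  have "M2 a b c d = mat n ** (mat 1 ** S)" by (simp add: S_def mat_M2 l n lk)
  moreover have "MK S" using 1 2 \<open>k \<in> K\<close> by (simp add: S_def K_mult)
  moreover have "det S \<noteq> 0" "n \<noteq> 0" using det unfolding lk by (auto simp: S_def algebra_simps)
  ultimately show ?thesis unfolding eqv_def by blast
qed

text \<open>Distinct sublines have at most two common points, so one of the images of \<infinity>, 0
  and 1 is off the second subline. The matrix S moves the chosen one into the first column.\<close>

lemma exists_off:
  assumes h: "det h1 \<noteq> 0" "det h2 \<noteq> 0" "\<not> eqv h1 h2"
  obtains S where "MK S" "det S \<noteq> 0" "off h2 ((h1 ** S)$1$1) ((h1 ** S)$2$1)"
proof (rule ccontr)
  note off_imp = that
  assume no: "\<not> thesis"
  define B where "B = inv2 h2 ** h1"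
  obtain a b c d where Bd: "B = M2 a b c d" by (rule M2_cases)
  have h1B: "h1 = h2 ** B" using h by (simp add: B_def)
  have pt: "\<exists>s\<in>K. \<exists>t\<in>K. (s \<noteq> 0 \<or> t \<noteq> 0) \<and> (B ** S)$1$1 * t = (B ** S)$2$1 * s" if S: "MK S" "det S \<noteq> 0" for S
  proof -
    have "\<not> off h2 ((h1 ** S)$1$1) ((h1 ** S)$2$1)" using no off_imp S by blast
    then obtain s t where st: "s \<in> K" "t \<in> K" "s \<noteq> 0 \<or> t \<noteq> 0"
      "(h2 ** (B ** S))$1$1 * (s * h2$2$1 + t * h2$2$2) = (h2 ** (B ** S))$2$1 * (s * h2$1$1 + t * h2$1$2)"
      unfolding off_def h1B matrix_mul_assoc[symmetric] by blast
    obtain x y z w where h2: "h2 = M2 x y z w" by (rule M2_cases)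
    obtain x' y' z' w' where BS: "B ** S = M2 x' y' z' w'" by (rule M2_cases)
    have "(x * w - y * z) * (x' * t) = (x * w - y * z) * (z' * s)"
      using st(4) unfolding BS h2 M2_mult M2_nth by (simp add: algebra_simps)
    moreover have "x * w - y * z \<noteq> 0" using h(2) unfolding h2 det_M2 .
    ultimately have "x' * t = z' * s" by (simp only: mult_cancel_left) blast
    then have "(B ** S)$1$1 * t = (B ** S)$2$1 * s" unfolding BS M2_nth .
    then show ?thesis using st(1-3) by blast
  qed
  obtain s1 t1 where 1: "s1 \<in> K" "t1 \<in> K" "s1 \<noteq> 0 \<or> t1 \<noteq> 0" "a * t1 = c * s1"
    using pt[of "M2 1 0 0 1"] unfolding Bd by auto
  obtain s2 t2 where 2: "s2 \<in> K" "t2 \<in> K" "s2 \<noteq> 0 \<or> t2 \<noteq> 0" "b * t2 = d * s2"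
    using pt[of "M2 0 1 1 0"] unfolding Bd by auto
  obtain s3 t3 where 3: "s3 \<in> K" "t3 \<in> K" "s3 \<noteq> 0 \<or> t3 \<noteq> 0" "(a + b) * t3 = (c + d) * s3"
    using pt[of "M2 1 0 1 1"] unfolding Bd by auto
  have "det B \<noteq> 0" using h det_inv2_nz by (auto simp: B_def det_mul)
  then have "eqv (mat 1) B" unfolding Bd by (rule K_points_eqv[OF _ 1 2 3])
  then have "eqv (h2 ** mat 1) (h2 ** B)" by (rule eqv_mult)
  then show False using h(3) h1B eqv_sym by auto
qed

end

section \<open>Counting the excluded field elements\<close>

context subfield
begin

definition bad :: "'a set" where "bad = {x. x \<noteq> 0 \<and> \<not> generic x}"

text \<open>For j > 0 these are the x for which x K is preserved by the j-th Frobenius power,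
  written as the roots of one equation so that they can be counted.\<close>

definition Zset :: "nat \<Rightarrow> 'a set" where
  "Zset j = {x. x ^ ((CHAR('a) ^ j - 1) * (Q - 1)) = 1}"

lemma CHAR_ge_2: "CHAR('a) \<ge> 2"
  using CHAR_prime[where 'a='a] by (rule prime_ge_2_nat)

lemma mem_Zset: "x \<noteq> 0 \<Longrightarrow> x \<in> Zset j \<longleftrightarrow> x ^ (CHAR('a) ^ j) / x \<in> K"
proof -
  assume x: "x \<noteq> 0"
  have "CHAR('a) ^ j = Suc (CHAR('a) ^ j - 1)" using CHAR_ge_2 by simp
  then have "x ^ (CHAR('a) ^ j) = x * x ^ (CHAR('a) ^ j - 1)" by (metis power_Suc)
  then have "x ^ (CHAR('a) ^ j) / x = x ^ (CHAR('a) ^ j - 1)" using x by simp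
  then show ?thesis using x K_nz_iff[of "x ^ (CHAR('a) ^ j - 1)"] by (simp add: Zset_def power_mult)
qed

lemma Zset_nz: "j > 0 \<Longrightarrow> x \<in> Zset j \<Longrightarrow> x \<noteq> 0"
proof
  assume "j > 0" "x \<in> Zset j" "x = 0"
  moreover have "CHAR('a) ^ j > 1" using CHAR_ge_2 \<open>j > 0\<close> by (intro one_less_power) auto
  ultimately show False using Q_gt_1 by (simp add: Zset_def zero_power)
qed

lemma card_Zset: "j > 0 \<Longrightarrow> card (Zset j) \<le> (CHAR('a) ^ j - 1) * (Q - 1)"
proof -
  assume "j > 0"
  then have "CHAR('a) ^ j > 1" using CHAR_ge_2 by (intro one_less_power) auto
  then show ?thesis unfolding Zset_def using Q_gt_1 by (intro card_power_eq) simp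
qed

lemma K_subset_Zset: "K - {0} \<subseteq> Zset j"
proof
  fix x assume x: "x \<in> K - {0}"
  then have "x ^ (Q - 1) = 1" using K_nz_iff by blast
  then have "(x ^ (Q - 1)) ^ (CHAR('a) ^ j - 1) = 1" by (simp only: power_one)
  then show "x \<in> Zset j" unfolding Zset_def by (simp only: mem_Collect_eq power_mult[symmetric] mult.commute)
qed

lemma frob_multiple: "x ^ (CHAR('a) ^ (m * r * v)) = (x::'a)"
proof -
  have "CHAR('a) ^ (m * r * v) = CARD('a) ^ v" unfolding card_field by (rule power_mult)
  then show ?thesis by (rule finite_field_power_card_power_eq_same)
qed

lemma frob_iterate:
  assumes "x ^ (CHAR('a) ^ i) = k * x" "k \<in> K"
  shows "\<exists>l\<in>K. x ^ (CHAR('a) ^ (i * u)) = l * x"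
proof (induction u)
  case 0
  then show ?case by (intro bexI[of _ 1]) auto
next
  case (Suc u)
  then obtain l where l: "l \<in> K" "x ^ (CHAR('a) ^ (i * u)) = l * x" by blast
  have "x ^ (CHAR('a) ^ (i * Suc u)) = (x ^ (CHAR('a) ^ (i * u))) ^ (CHAR('a) ^ i)"
    by (simp only: power_mult[symmetric] power_add[symmetric] mult_Suc_right add.commute)
  also have "\<dots> = (l ^ (CHAR('a) ^ i) * k) * x" by (simp add: l power_mult_distrib assms(1) mult.assoc)
  finally show ?case using l assms(2) by (intro bexI[of _ "l ^ (CHAR('a) ^ i) * k"]) (auto intro: K_mult K_power)
qed

text \<open>If the i-th Frobenius power preserves x K, then so do its iterates, and by Bezout the
  power with exponent gcd(i, n), where n = m r. This gcd is a proper divisor of n because the i-th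
  power is not the identity. Elements of \<open>K\<close> lie in every \<open>Zset\<close> and are
  put into that of 1.\<close>

lemma bad_subset:
  assumes "m * r > 1"
  shows "bad \<subseteq> (\<Union>j\<in>{j. 0 < j \<and> j dvd m * r \<and> j < m * r}. Zset j)"
proof
  fix x assume "x \<in> bad"
  then have x: "x \<noteq> 0" "\<not> generic x" by (auto simp: bad_def)
  show "x \<in> (\<Union>j\<in>{j. 0 < j \<and> j dvd m * r \<and> j < m * r}. Zset j)"
  proof (cases "x \<in> K")
    case True
    then have "x \<in> Zset 1" using subsetD[OF K_subset_Zset[of 1]] x by simp
    then show ?thesis using assms by (intro UN_I[of 1]) auto
  next
    case False
    then obtain i and y :: 'a where i: "x ^ (CHAR('a) ^ i) / x \<in> K" "y ^ (CHAR('a) ^ i) \<noteq> y"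
      using x(2) unfolding generic_def by blast
    define k where "k = x ^ (CHAR('a) ^ i) / x"
    have k: "k \<in> K" "x ^ (CHAR('a) ^ i) = k * x" using i x by (simp_all add: k_def)
    define g where "g = gcd i (m * r)"
    have i0: "i \<noteq> 0" using i(2) by (intro notI) simp
    then obtain u v where uv: "i * u = m * r * v + g" using bezout_nat[of i "m * r"] unfolding g_def by blast
    obtain l where l: "l \<in> K" "x ^ (CHAR('a) ^ (i * u)) = l * x" using frob_iterate[OF k(2,1)] by blast
    have "x ^ (CHAR('a) ^ (i * u)) = (x ^ (CHAR('a) ^ (m * r * v))) ^ (CHAR('a) ^ g)"
      unfolding uv by (simp only: power_add power_mult)
    also have "\<dots> = x ^ (CHAR('a) ^ g)" unfolding frob_multiple ..
    finally have "x ^ (CHAR('a) ^ g) = l * x" using l(2) by (rule trans[OF sym])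
    then have "x ^ (CHAR('a) ^ g) / x \<in> K" using l(1) x(1) by simp
    then have "x \<in> Zset g" using x mem_Zset by blast
    moreover have "g \<noteq> m * r"
    proof
      assume "g = m * r"
      then have "m * r dvd i" unfolding g_def using gcd_dvd1[of i "m * r"] by simp
      then obtain v where v: "i = m * r * v" by (rule dvdE)
      show False using i(2) unfolding v frob_multiple by simp
    qed
    moreover have "g dvd m * r" unfolding g_def by (rule gcd_dvd2)
    moreover have "0 < g" using i0 unfolding g_def by (metis gcd_eq_0_iff gr0I)
    moreover have "g \<le> m * r" using \<open>g dvd m * r\<close> m_pos r_pos by (intro dvd_imp_le) auto
    ultimately have "g \<in> {j. 0 < j \<and> j dvd m * r \<and> j < m * r}" "x \<in> Zset g" by simp_all
    then show ?thesis by (rule UN_I)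
  qed
qed

lemma sum_frob: "k \<ge> 1 \<Longrightarrow> (\<Sum>j\<in>{1..<k}. CHAR('a) ^ j - 1) + 2 \<le> CHAR('a) ^ k"
proof (induction k rule: nat_induct_at_least)
  case base
  show ?case using CHAR_ge_2 by (simp only: atLeastLessThan_empty le_refl sum.empty add_0 power_one_right)
next
  case (Suc k)
  have arith: "t + 2 \<le> c" if "t = s + (b - 1)" "s + 2 \<le> b" "2 * b \<le> c" for s t b c :: nat
    using that by linarith
  show ?case
    by (rule arith[OF sum.atLeastLessThan_Suc[OF Suc(1)] Suc(2)])
       (simp only: power_Suc mult_le_mono1[OF CHAR_ge_2])
qed

lemma card_UN_Zset:
  "card (\<Union>j\<in>{1..<k}. Zset j) \<le> (\<Sum>j\<in>{1..<k}. CHAR('a) ^ j - 1) * (Q - 1)"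
proof -
  have "card (\<Union>j\<in>{1..<k}. Zset j) \<le> (\<Sum>j\<in>{1..<k}. card (Zset j))" by (rule card_UN_le) simp
  also have "\<dots> \<le> (\<Sum>j\<in>{1..<k}. (CHAR('a) ^ j - 1) * (Q - 1))" by (rule sum_mono) (rule card_Zset, simp)
  finally show ?thesis by (simp add: sum_distrib_right)
qed

lemma power_mult_reduce:
  fixes x :: 'a
  assumes "x ^ b = 1" "a = b * t + c"
  shows "x ^ a = x ^ c"
  using assms by (simp add: power_add power_mult)

lemma power_CARD_1: "x \<noteq> 0 \<Longrightarrow> x ^ ((Q - 1) * norm_exp) = (1::'a)"
  using power_CARD_minus_1 norm_exp_mult by metis

lemma norm_exp_3: "r = 3 \<Longrightarrow> norm_exp = 1 + Q + Q * Q"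
  unfolding norm_exp_def by (simp add: numeral_3_eq_3)

text \<open>Besides the defining equation x satisfies x^((Q-1)(1+Q+Q^2)) = 1, and 1 + Q + Q^2 = (Q -
  1)(Q + 2) + 3 leaves the exponent 3(Q - 1).\<close>

lemma card_Zset_m:
  assumes "r = 3"
  shows "card (Zset m) \<le> 3 * (Q - 1)"
proof -
  have N: "norm_exp = (Q - 1) * (Q + 2) + 3"
  proof -
    have "int norm_exp = 1 + int Q + int Q * int Q" by (simp add: norm_exp_3[OF assms])
    also have "\<dots> = int ((Q - 1) * (Q + 2) + 3)" using Q_gt_1 by (simp add: of_nat_diff algebra_simps)
    finally show ?thesis by (simp only: of_nat_eq_iff)
  qed
  have "Zset m \<subseteq> {x. x ^ (3 * (Q - 1)) = 1}"
  proof
    fix x assume x: "x \<in> Zset m"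
    then have "x \<noteq> 0" using Zset_nz m_pos by blast
    have "x ^ ((Q - 1) * (Q - 1)) = 1" using x by (simp add: Zset_def Q_def)
    then have "x ^ ((Q - 1) * norm_exp) = x ^ (3 * (Q - 1))"
      by (rule power_mult_reduce[where t = "Q + 2"]) (simp only: N distrib_left distrib_right mult_ac)
    then show "x \<in> {x. x ^ (3 * (Q - 1)) = 1}" using power_CARD_1[OF \<open>x \<noteq> 0\<close>] by simp
  qed
  then have "card (Zset m) \<le> card {x::'a. x ^ (3 * (Q - 1)) = 1}" by (rule card_mono[rotated]) simp
  also have "\<dots> \<le> 3 * (Q - 1)" using Q_gt_1 by (intro card_power_eq) simp
  finally show ?thesis .
qed

text \<open>With Q = y^2 the norm exponent is 1 + y^2 + y^4 = (y^3 - 1) y + (y^2 + y + 1), so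
  division with remainder lowers the exponent y^3 - 1 to y^2 + y + 1.\<close>

lemma card_Zset_half:
  assumes "r = 3" "m = 2 * k"
  defines "y \<equiv> CHAR('a) ^ k"
  shows "card (Zset (3 * k)) \<le> (y * y + y + 1) * (Q - 1)"
proof -
  have k: "k > 0" using m_pos assms by simp
  have y: "y \<ge> 1" unfolding y_def using CHAR_ge_2 by simp
  have y3': "y * y * y \<ge> 1" using y by simp
  have Qy: "Q = y * y" unfolding Q_def y_def unfolding assms(2) by (simp add: mult_2 power_add)
  have y3: "CHAR('a) ^ (3 * k) = y * y * y" unfolding y_def by (simp add: numeral_3_eq_3 power_add)
  have N: "norm_exp = (y * y * y - 1) * y + (y * y + y + 1)"
  proof -
    have "(y * y * y - 1) * y + y = y * y * y * y" using y3' by (metis add_mult_distrib le_add_diff_inverse2 mult_1)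
    then have "(y * y * y - 1) * y + (y * y + y + 1) = 1 + y * y + y * y * y * y" by linarith
    then show ?thesis unfolding norm_exp_3[OF assms(1)] Qy by (simp only: mult.assoc)
  qed
  have "Zset (3 * k) \<subseteq> {x. x ^ ((y * y + y + 1) * (Q - 1)) = 1}"
  proof
    fix x assume x: "x \<in> Zset (3 * k)"
    then have "x \<noteq> 0" using Zset_nz[of "3 * k"] k by auto
    have "x ^ ((y * y * y - 1) * (Q - 1)) = 1" using x by (simp add: Zset_def y3)
    then have "x ^ ((Q - 1) * norm_exp) = x ^ ((y * y + y + 1) * (Q - 1))"
      by (rule power_mult_reduce[where t = y]) (simp only: N distrib_left distrib_right mult_ac)
    then show "x \<in> {x. x ^ ((y * y + y + 1) * (Q - 1)) = 1}" using power_CARD_1[OF \<open>x \<noteq> 0\<close>] by simp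
  qed
  then have "card (Zset (3 * k)) \<le> card {x::'a. x ^ ((y * y + y + 1) * (Q - 1)) = 1}"
    by (rule card_mono[rotated]) simp
  also have "\<dots> \<le> (y * y + y + 1) * (Q - 1)" using Q_gt_1 by (intro card_power_eq) simp
  finally show ?thesis .
qed

text \<open>Proper divisors of n are at most n/2, so a geometric sum bounds \<open>bad\<close> by 2
  P (Q - 1) with P^2 \<le> q. After division by Q - 1, the two top terms of the norm exponent
  suffice: 4 P \<le> Q^(r-1) and 2 Q < Q^(r-2).\<close>

lemma card_bad_large:
  assumes "r \<ge> 5" "Q > 2"
  shows "2 * card bad + 2 * Q * (Q - 1) < (Q - 1) * norm_exp"
proof -
  define k where "k = m * r div 2"
  define P where "P = CHAR('a) ^ k"
  have "1 * 5 \<le> m * r" using m_pos assms by (intro mult_le_mono) auto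
  then have mr: "m * r > 1" by simp
  have k: "k \<ge> 1" using mr by (simp add: k_def)
  have "bad \<subseteq> (\<Union>j\<in>{1..<Suc k}. Zset j)"
  proof
    fix x assume "x \<in> bad"
    then obtain j where j: "0 < j" "j dvd m * r" "j < m * r" "x \<in> Zset j" using bad_subset[OF mr] by blast
    then obtain t where t: "m * r = j * t" by blast
    with j have "t \<noteq> 0" "t \<noteq> 1" by auto
    then have "t \<ge> 2" by simp
    then have "j * 2 \<le> m * r" unfolding t by simp
    then have "j \<le> k" by (simp add: k_def)
    then show "x \<in> (\<Union>j\<in>{1..<Suc k}. Zset j)" using j by (intro UN_I[of j]) auto
  qed
  then have "card bad \<le> card (\<Union>j\<in>{1..<Suc k}. Zset j)" by (rule card_mono[rotated]) simp
  also note card_UN_Zset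
  finally have b: "card bad \<le> (\<Sum>j\<in>{1..<Suc k}. CHAR('a) ^ j - 1) * (Q - 1)" .
  have "(\<Sum>j\<in>{1..<Suc k}. CHAR('a) ^ j - 1) = (\<Sum>j\<in>{1..<k}. CHAR('a) ^ j - 1) + (P - 1)"
    using k by (simp add: P_def)
  also have "\<dots> \<le> P + P" using add_leD1[OF sum_frob[OF k]] unfolding P_def by (intro add_mono) simp_all
  also have "\<dots> = 2 * P" by simp
  finally have "card bad \<le> 2 * P * (Q - 1)" using b by (meson le_trans mult_le_mono1)
  then have "2 * card bad + 2 * Q * (Q - 1) \<le> (4 * P + 2 * Q) * (Q - 1)" by (simp add: algebra_simps)
  moreover have "4 * P + 2 * Q < norm_exp"
  proof -
    have "P ^ 2 = CHAR('a) ^ (2 * k)" by (simp add: P_def power_mult[symmetric] mult.commute)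
    also have "\<dots> \<le> CHAR('a) ^ (m * r)" using CHAR_ge_2 by (intro power_increasing) (auto simp: k_def)
    also have "\<dots> = Q ^ r" by (simp add: Q_def power_mult)
    finally have P2: "P ^ 2 \<le> Q ^ r" .
    obtain t where r: "r = t + 5" using assms(1) by (metis add.commute le_Suc_ex)
    have "3 ^ 3 \<le> Q ^ 3" using assms(2) by (intro power_mono) auto
    also have Q3: "Q ^ 3 \<le> Q ^ (t + 3)" using Q_gt_1 by (intro power_increasing) auto
    finally have "16 \<le> Q ^ (t + 3)" by simp
    have "(4 * P) ^ 2 = 16 * P ^ 2" by (simp add: power_mult_distrib)
    also have "\<dots> \<le> Q ^ (t + 3) * Q ^ r" using P2 \<open>16 \<le> Q ^ (t + 3)\<close> by (intro mult_mono) auto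
    also have "\<dots> = (Q ^ (t + 4)) ^ 2" by (simp add: r power_add[symmetric] power_mult[symmetric] mult.commute)
    finally have 1: "4 * P \<le> Q ^ (t + 4)" by (rule power2_le_imp_le) simp
    have "2 * Q < 3 * 3 * Q" using Q_gt_1 by simp
    also have "\<dots> \<le> Q * Q * Q" using assms(2) by (intro mult_mono) auto
    also have "\<dots> = Q ^ 3" by (simp add: numeral_3_eq_3)
    also note Q3
    finally have 2: "2 * Q < Q ^ (t + 3)" .
    have "{t + 3, t + 4} \<subseteq> {..<r}" by (auto simp: r)
    then have "(\<Sum>i\<in>{t + 3, t + 4}. Q ^ i) \<le> norm_exp" unfolding norm_exp_def by (intro sum_mono2) auto
    with 1 2 show ?thesis by simp
  qed
  then have "(4 * P + 2 * Q) * (Q - 1) < norm_exp * (Q - 1)" using Q_gt_1 by (intro mult_strict_right_mono) auto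
  ultimately show ?thesis unfolding mult.commute[of "Q - 1" norm_exp] by (rule order.strict_trans1)
qed

text \<open>A proper divisor j of 3 m has cofactor 2, giving j = 3 m/2, or 3, giving j = m, or at
  least 4, giving j < m.\<close>

lemma bad_cubic:
  assumes "r = 3"
  shows "bad \<subseteq> (\<Union>j\<in>{1..<m}. Zset j) \<union> Zset m \<union> (if even m then Zset (3 * (m div 2)) else {})"
proof
  fix x assume "x \<in> bad"
  moreover have "m * r > 1" using m_pos assms by simp
  ultimately obtain j where j: "0 < j" "j dvd m * r" "j < m * r" "x \<in> Zset j" using bad_subset by blast
  then obtain t where t: "m * 3 = j * t" using assms by auto
  have "t \<noteq> 0" using t m_pos by (intro notI) simp
  moreover have "t \<noteq> 1" using j t assms by auto
  ultimately consider "t = 2" | "t = 3" | "t \<ge> 4" by linarith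
  then show "x \<in> (\<Union>j\<in>{1..<m}. Zset j) \<union> Zset m \<union> (if even m then Zset (3 * (m div 2)) else {})"
  proof cases
    case 1
    then have "even m" using t by presburger
    moreover have "j = 3 * (m div 2)" using t 1 \<open>even m\<close> by auto
    ultimately show ?thesis using j by auto
  next
    case 2
    then show ?thesis using j t by auto
  next
    case 3
    have "j * 4 \<le> m * 3" unfolding t using 3 by simp
    then have "j < m" using m_pos by linarith
    then show ?thesis using j by auto
  qed
qed

lemma card_bad_cubic:
  assumes "r = 3"
  shows "card bad \<le> ((\<Sum>j\<in>{1..<m}. CHAR('a) ^ j - 1) + 3 +
    (if even m then CHAR('a) ^ (m div 2) * CHAR('a) ^ (m div 2) + CHAR('a) ^ (m div 2) + 1 else 0)) * (Q - 1)"
proof -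
  let ?U = "\<Union>j\<in>{1..<m}. Zset j" and ?H = "if even m then Zset (3 * (m div 2)) else {}"
  have "card bad \<le> card (?U \<union> Zset m \<union> ?H)" using bad_cubic[OF assms] by (rule card_mono[rotated]) simp
  also have "\<dots> \<le> card ?U + card (Zset m) + card ?H"
    by (meson add_le_mono card_Un_le le_refl le_trans)
  also have "\<dots> \<le> (\<Sum>j\<in>{1..<m}. CHAR('a) ^ j - 1) * (Q - 1) + 3 * (Q - 1) +
    (if even m then CHAR('a) ^ (m div 2) * CHAR('a) ^ (m div 2) + CHAR('a) ^ (m div 2) + 1 else 0) * (Q - 1)"
    using card_UN_Zset[of m] card_Zset_m[OF assms] card_Zset_half[OF assms, of "m div 2"]
    by (intro add_mono) auto
  finally show ?thesis by (simp only: add_mult_distrib)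
qed

text \<open>The factors 2 account for the two sublines to be avoided. For r = 3, division by Q - 1
  leaves 2 B + 2 Q to be compared with 1 + Q + Q^2. For Q = 4 one has B = 11, and 30 is not below
  21; this is why that case is set apart.\<close>

lemma card_bad:
  assumes "odd r" "r > 1" "Q > 2" "\<not> (Q = 4 \<and> r = 3)"
  shows "2 * card bad + 2 * Q * (Q - 1) < CARD('a) - 1"
proof (cases "r = 3")
  case False
  have "r \<noteq> 2" "r \<noteq> 4" using assms(1) by auto
  then have "r \<ge> 5" using False assms(2) by linarith
  then show ?thesis using card_bad_large assms norm_exp_mult by simp
next
  case r: True
  define S where "S = (\<Sum>j\<in>{1..<m}. CHAR('a) ^ j - 1)"
  define B where "B = S + 3 +
    (if even m then CHAR('a) ^ (m div 2) * CHAR('a) ^ (m div 2) + CHAR('a) ^ (m div 2) + 1 else 0)"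
  have N: "norm_exp = 1 + Q + Q * Q" by (rule norm_exp_3[OF r])
  have sum: "S + 2 \<le> Q" unfolding Q_def S_def by (rule sum_frob) (use m_pos in simp)
  have "2 * B + 2 * Q < norm_exp"
  proof (cases "even m")
    \<comment> \<open>Here Q is a square y^2, and y \<ge> 3 since Q = 4 is ruled out; this makes Q^2
      at least 9 Q.\<close>
    case True
    define y where "y = CHAR('a) ^ (m div 2)"
    have Qy: "Q = y * y" unfolding Q_def y_def using True by (metis even_two_times_div_two mult_2 power_add)
    have "y \<noteq> 0" "y \<noteq> 1" using assms(3) unfolding Qy by (intro notI, simp)+
    moreover have "y \<noteq> 2" using assms(4) r Qy by auto
    ultimately have y: "y \<ge> 3" by linarith
    have "2 * B + 2 * Q \<le> 2 * (Q + 1 + (Q + y + 1)) + 2 * Q"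
      using sum True unfolding B_def by (simp add: Qy y_def)
    also have "\<dots> < 1 + Q + Q * Q"
    proof -
      have "9 * Q \<le> Q * Q" using y unfolding Qy using mult_mono[of 3 y 3 y] by simp
      moreover have "3 * y \<le> Q" "9 \<le> Q" using y mult_mono[of 3 y 3 y] unfolding Qy by auto
      moreover have "2 * a + 2 * b + 4 + 2 * b + 2 * b < 1 + b + c" if "9 * b \<le> c" "3 * a \<le> b" "9 \<le> b" for a b c :: nat
        using that by linarith
      ultimately have "2 * y + 2 * Q + 4 + 2 * Q + 2 * Q < 1 + Q + Q * Q" by blast
      then show ?thesis by (simp only: distrib_left)
    qed
    finally show ?thesis by (simp add: N)
  next
    case False
    show ?thesis
    proof (cases "m = 1")
      case True
      then have "B = 3" by (simp add: B_def S_def)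
      moreover have "3 * Q \<le> Q * Q" using assms by simp
      ultimately show ?thesis using assms unfolding N by linarith
    next
      case m: False
      have "m \<ge> 2" using m m_pos by simp
      then have "CHAR('a) ^ 2 \<le> Q" unfolding Q_def using CHAR_ge_2 by (intro power_increasing) auto
      moreover have "2 ^ 2 \<le> CHAR('a) ^ 2" using CHAR_ge_2 by (rule power_mono) simp
      ultimately have "4 \<le> Q" by simp
      then have "4 * Q \<le> Q * Q" by simp
      moreover have "B \<le> Q + 1" using sum False by (simp add: B_def)
      ultimately show ?thesis using \<open>4 \<le> Q\<close> unfolding N by linarith
    qed
  qed
  then have "(2 * B + 2 * Q) * (Q - 1) < norm_exp * (Q - 1)" using Q_gt_1 by (intro mult_strict_right_mono) auto
  moreover have "card bad \<le> B * (Q - 1)" unfolding B_def S_def by (rule card_bad_cubic[OF r])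
  ultimately show ?thesis unfolding norm_exp_mult[symmetric] by (simp add: algebra_simps)
qed

end

section \<open>Common neighbours of two sublines\<close>

context subfield
begin

text \<open>An excluded a is determined by the s and t of a second common point, and t = 0 is
  impossible because d lies outside \<open>K\<close>.\<close>

lemma card_not_off_line:
  assumes "d \<notin> K" "e \<noteq> 0"
  shows "card {a. a \<noteq> 0 \<and> \<not> off_line (e * a) (- d)} \<le> Q * (Q - 1)"
proof -
  have "{a. a \<noteq> 0 \<and> \<not> off_line (e * a) (- d)} \<subseteq> (\<lambda>(s, t). - (d + s) / (e * t)) ` (K \<times> (K - {0}))"
  proof
    fix a assume "a \<in> {a. a \<noteq> 0 \<and> \<not> off_line (e * a) (- d)}"
    then obtain s t where st: "s \<in> K" "t \<in> K" "- d = s + e * a * t" unfolding off_line_def by blast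
    have "t \<noteq> 0"
    proof
      assume "t = 0"
      then have "- d = s" using st(3) by simp
      then have "d = - s" by (simp only: minus_equation_iff[of d])
      then show False using assms(1) st(1) K_uminus by simp
    qed
    moreover have "e * t * a = - (d + s)" using st(3) by (simp add: algebra_simps)
    ultimately have "a = - (d + s) / (e * t)" using assms(2) by (metis mult_eq_0_iff nonzero_mult_div_cancel_left)
    then show "a \<in> (\<lambda>(s, t). - (d + s) / (e * t)) ` (K \<times> (K - {0}))"
      using st \<open>t \<noteq> 0\<close> assms(2) by (intro image_eqI[of _ _ "(s, t)"]) simp_all
  qed
  then have "card {a. a \<noteq> 0 \<and> \<not> off_line (e * a) (- d)} \<le> card (K \<times> (K - {0}))"
    by (rule surj_card_le[rotated]) simp
  then show ?thesis by (simp add: card_cartesian_product card_K card_Diff_singleton)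
qed

lemma card_inverse_image:
  fixes P :: "'a \<Rightarrow> bool"
  assumes "e \<noteq> 0"
  shows "card {a. a \<noteq> 0 \<and> P (e / a)} \<le> card {a. a \<noteq> 0 \<and> P (e * a)}"
proof (rule card_inj_on_le[where f = inverse])
  show "inverse ` {a. a \<noteq> 0 \<and> P (e / a)} \<subseteq> {a. a \<noteq> 0 \<and> P (e * a)}" by (auto simp: divide_inverse)
qed (auto simp: inj_on_def)

lemma card_not_generic:
  assumes "e \<noteq> 0"
  shows "card {a. a \<noteq> 0 \<and> \<not> generic (e * a)} \<le> card bad"
  by (rule card_inj_on_le[where f = "(*) e"]) (use assms in \<open>auto simp: bad_def inj_on_def\<close>)

abbreviation excluded :: "'a \<Rightarrow> 'a \<Rightarrow> 'a set" where
  "excluded e1 e2 \<equiv> {a. a \<noteq> 0 \<and> (\<not> generic (e1 * a) \<or> \<not> generic (e2 / a))}"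

text \<open>The neighbour is a K with \<infinity>, moved by \<open>g\<close>. It contains
  \<infinity> and 0, so \<open>adj_upper\<close> applies to the first subline and
  \<open>adj_lower\<close> to the second; that d1 and d2 lie outside \<open>K\<close> keeps both
  meeting conditions cheap.\<close>

lemma two_point_neighbour:
  assumes g: "det g \<noteq> 0" and d: "d1 \<notin> K" "d2 \<notin> K" and e: "e1 \<noteq> 0" "e2 \<noteq> 0"
    and card: "card (excluded e1 e2) + 2 * Q * (Q - 1) < CARD('a) - 1"
  obtains h where "det h \<noteq> 0" "adj (g ** M2 1 d1 0 e1) h" "adj (g ** M2 e2 0 d2 1) h"
proof -
  define A where "A = excluded e1 e2"
  define B where "B = {a. a \<noteq> 0 \<and> \<not> off_line (e1 * a) (- d1)}"
  define C where "C = {a. a \<noteq> 0 \<and> \<not> off_line (e2 / a) (- d2)}"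
  have "card C \<le> Q * (Q - 1)" unfolding C_def
    using card_inverse_image[OF e(2), of "\<lambda>x. \<not> off_line x (- d2)"] card_not_off_line[OF d(2) e(2)] by (rule le_trans)
  moreover have "card B \<le> Q * (Q - 1)" unfolding B_def using card_not_off_line[OF d(1) e(1)] .
  moreover have "card (A \<union> (B \<union> C)) \<le> card A + (card B + card C)"
    by (meson add_left_mono card_Un_le le_trans)
  moreover have "card (UNIV - {0::'a}) = CARD('a) - 1" by (rule card_Diff_singleton) simp
  ultimately have "card (A \<union> (B \<union> C)) < card (UNIV - {0::'a})"
    using card[folded A_def] by simp
  then have "\<not> UNIV - {0} \<subseteq> A \<union> (B \<union> C)" by (metis card_mono finite not_le)
  then obtain a where a0: "a \<noteq> 0" "a \<notin> A" "a \<notin> B" "a \<notin> C" by blast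
  have a: "a \<noteq> 0" "generic (e1 * a)" "generic (e2 / a)" using a0(1,2) unfolding A_def by simp_all
  have o1: "off_line (e1 * a) (0 - d1)" using a0(1,3) unfolding B_def by simp
  have o2: "off_line (e2 / a) (- d2)" using a0(1,4) unfolding C_def by simp
  define h where "h = M2 a 0 0 1"
  have "adj (M2 1 d1 0 e1) h" using adj_upper[OF e(1) a(1,2) o1] by (simp add: h_def)
  moreover have "adj (M2 e2 0 d2 1) h" using adj_lower[OF e(2) a(1,3) o2] by (simp add: h_def)
  moreover have "det h \<noteq> 0" using a by (simp add: h_def)
  ultimately show ?thesis using that[of "g ** h"] adj_mult g by (simp add: det_mul)
qed

text \<open>With \<infinity> on both sublines the conditions separate: a is chosen generic for both
  sublines, and only then the translation part b, which has to avoid two sets of at most Q^2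
  elements.\<close>

lemma common_point_neighbour:
  assumes g: "det g \<noteq> 0" and e: "e \<noteq> 0"
    and card: "2 * card bad < CARD('a) - 1" and Q: "2 * Q * Q < CARD('a)"
  obtains h where "det h \<noteq> 0" "adj g h" "adj (g ** M2 1 d 0 e) h"
proof -
  define A B where "A = {a. a \<noteq> 0 \<and> \<not> generic (1 * a)}" and "B = {a. a \<noteq> 0 \<and> \<not> generic (e * a)}"
  have "card A \<le> card bad" unfolding A_def by (rule card_not_generic) simp
  moreover have "card B \<le> card bad" unfolding B_def by (rule card_not_generic[OF e])
  moreover have "card (UNIV - {0::'a}) = CARD('a) - 1" by (rule card_Diff_singleton) simp
  ultimately have "card (A \<union> B) < card (UNIV - {0::'a})"
    using card card_Un_le[of A B] by linarith
  then have "\<not> UNIV - {0} \<subseteq> A \<union> B" by (metis card_mono finite not_le)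
  then obtain a where a0: "a \<noteq> 0" "a \<notin> A" "a \<notin> B" by blast
  then have a: "a \<noteq> 0" "generic a" "generic (e * a)" unfolding A_def B_def by simp_all
  define C D where "C = {b. \<not> off_line a b}" and "D = {b. \<not> off_line (e * a) (e * b - d)}"
  have "C \<subseteq> (\<lambda>(s, t). s + a * t) ` (K \<times> K)"
  proof
    fix b assume "b \<in> C"
    then obtain s t where st: "s \<in> K" "t \<in> K" "b = s + a * t" unfolding C_def off_line_def by blast
    then show "b \<in> (\<lambda>(s, t). s + a * t) ` (K \<times> K)" by (intro image_eqI[of _ _ "(s, t)"]) simp_all
  qed
  then have C: "card C \<le> card (K \<times> K)" by (rule surj_card_le[rotated]) simp
  have "D \<subseteq> (\<lambda>(s, t). (s + e * a * t + d) / e) ` (K \<times> K)"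
  proof
    fix b assume "b \<in> D"
    then obtain s t where st: "s \<in> K" "t \<in> K" "e * b - d = s + e * a * t" unfolding D_def off_line_def by blast
    then have "b = (s + e * a * t + d) / e" using e by (simp add: field_simps)
    then show "b \<in> (\<lambda>(s, t). (s + e * a * t + d) / e) ` (K \<times> K)" using st by (intro image_eqI[of _ _ "(s, t)"]) simp_all
  qed
  then have "card D \<le> card (K \<times> K)" by (rule surj_card_le[rotated]) simp
  with C have "card (C \<union> D) < card (UNIV :: 'a set)"
    using card_Un_le[of C D] Q by (simp add: card_cartesian_product card_K)
  then have "\<not> UNIV \<subseteq> C \<union> D" by (metis card_mono finite not_le)
  then obtain b where b: "off_line a b" "off_line (e * a) (e * b - d)" unfolding C_def D_def by blast
  define h where "h = M2 a b 0 1"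
  have "adj (mat 1) h" unfolding h_def by (rule adj_explicit) (use a b in auto)
  then have "adj g (g ** h)" using adj_mult[OF _ g] by force
  moreover have "adj (M2 1 d 0 e) h" using adj_upper[OF e a(1,3) b(2)] e by (simp add: h_def)
  ultimately show ?thesis using that[of "g ** h"] adj_mult g a by (simp add: det_mul h_def)
qed

lemma off_K:
  assumes "off h x y" "MK S" "det S \<noteq> 0"
  shows "off (h ** S) x y"
  unfolding off_def
proof (intro ballI impI)
  fix s t assume st: "s \<in> K" "t \<in> K" "s \<noteq> 0 \<or> t \<noteq> 0"
  obtain a b c d where S: "S = M2 a b c d" by (rule M2_cases)
  obtain a' b' c' d' where h: "h = M2 a' b' c' d'" by (rule M2_cases)
  let ?s = "a * s + b * t" and ?t = "c * s + d * t"
  have K: "?s \<in> K" "?t \<in> K" using st assms(2) unfolding S by (simp_all add: K_add K_mult)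
  have "?s \<noteq> 0 \<or> ?t \<noteq> 0"
  proof (rule ccontr)
    assume "\<not> ?thesis"
    then have "d * ?s - b * ?t = 0" "a * ?t - c * ?s = 0" by simp_all
    then have "(a * d - b * c) * s = 0" "(a * d - b * c) * t = 0" by (simp_all add: algebra_simps)
    then show False using st(3) assms(3) unfolding S by simp
  qed
  then have "x * (?s * c' + ?t * d') \<noteq> y * (?s * a' + ?t * b')"
    using assms(1) K unfolding off_def h M2_nth by blast
  then show "x * (s * (h ** S)$2$1 + t * (h ** S)$2$2) \<noteq> y * (s * (h ** S)$1$1 + t * (h ** S)$1$2)"
  proof -
    have "s * (c' * a + d' * c) + t * (c' * b + d' * d) = ?s * c' + ?t * d'"
      "s * (a' * a + b' * c) + t * (a' * b + b' * d) = ?s * a' + ?t * b'" by (simp_all add: algebra_simps)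
    then show ?thesis using \<open>x * (?s * c' + ?t * d') \<noteq> y * (?s * a' + ?t * b')\<close> unfolding S h M2_mult M2_nth by simp
  qed
qed

lemma K_column:
  assumes "x \<in> K" "y \<in> K" "x \<noteq> 0 \<or> y \<noteq> 0"
  obtains b d where "b \<in> K" "d \<in> K" "x * d - b * y \<noteq> 0"
proof (cases "x = 0")
  case True
  then show ?thesis using assms that[of 1 0] by simp
next
  case False
  then show ?thesis using that[of 0 1] by simp
qed

lemma adj_K: "adj (h ** S) k \<Longrightarrow> MK S \<Longrightarrow> det S \<noteq> 0 \<Longrightarrow> adj h k"
  by (erule adj_eqv[OF _ eqv_sym[OF eqv_K] eqv_refl])

text \<open>S1 and S2 choose the points sent to \<infinity> and 0. The counting hypothesis speaks of
  the resulting e1 and e2 because for 64 over 4 it is derived only after a special choice of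
  points.\<close>

lemma two_points_neighbour:
  assumes h: "det h1 \<noteq> 0" "det h2 \<noteq> 0"
    and S: "MK S1" "det S1 \<noteq> 0" "MK S2" "det S2 \<noteq> 0"
    and off: "off h2 ((h1 ** S1)$1$1) ((h1 ** S1)$2$1)" "off h1 ((h2 ** S2)$1$2) ((h2 ** S2)$2$2)"
    and card: "\<And>e1 e2 D. D = (h1 ** S1)$1$1 * (h2 ** S2)$2$2 - (h2 ** S2)$1$2 * (h1 ** S1)$2$1 \<Longrightarrow>
      D \<noteq> 0 \<Longrightarrow> e1 = det h1 * det S1 / D \<Longrightarrow> e2 = det h2 * det S2 / D \<Longrightarrow>
      card (excluded e1 e2) + 2 * Q * (Q - 1) < CARD('a) - 1"
  obtains h where "det h \<noteq> 0" "adj h1 h" "adj h2 h"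
proof -
  obtain a b c d where 1: "h1 ** S1 = M2 a b c d" by (rule M2_cases)
  obtain a' b' c' d' where 2: "h2 ** S2 = M2 a' b' c' d'" by (rule M2_cases)
  have det1: "det (M2 a b c d) = det h1 * det S1" unfolding 1[symmetric] by (rule det_mul)
  have det2: "det (M2 a' b' c' d') = det h2 * det S2" unfolding 2[symmetric] by (rule det_mul)
  have off1: "off (M2 a' b' c' d') a c" using off_K[OF off(1) S(3,4)] unfolding 1 2 by simp
  have off2: "off (M2 a b c d) b' d'" using off_K[OF off(2) S(1,2)] unfolding 1 2 by simp
  define g where "g = M2 a b' c d'"
  have D1: "det (M2 a b c d) \<noteq> 0" using h S unfolding det1 by simp
  have D2: "det (M2 a' b' c' d') \<noteq> 0" using h S unfolding det2 by simp
  obtain d1 e1 d2 e2 where f: "det g \<noteq> 0" "M2 a b c d = g ** M2 1 d1 0 e1" "M2 a' b' c' d' = g ** M2 e2 0 d2 1"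
    "d1 \<notin> K" "d2 \<notin> K" "e1 = det (M2 a b c d) / det g" "e2 = det (M2 a' b' c' d') / det g"
    using two_point_form[OF D1 D2 off1 off2] unfolding g_def[symmetric] by (elim exE conjE) (rule that)
  have e: "e1 \<noteq> 0" "e2 \<noteq> 0" using f(1,6,7) h S unfolding det1 det2 by simp_all
  have "det g = a * d' - b' * c" by (simp add: g_def)
  then have "card (excluded e1 e2) + 2 * Q * (Q - 1) < CARD('a) - 1"
    using card[of "det g" e1 e2] f(1,6,7) unfolding det1 det2 1 2 M2_nth by simp
  then obtain k where k: "det k \<noteq> 0" "adj (g ** M2 1 d1 0 e1) k" "adj (g ** M2 e2 0 d2 1) k"
    by (rule two_point_neighbour[OF f(1,4,5) e])
  have "adj (h1 ** S1) k" "adj (h2 ** S2) k" using k(2,3) unfolding 1 2 f(2,3)[symmetric] by simp_all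
  then show ?thesis using that[OF k(1)] adj_K S by simp
qed

text \<open>Put a common point into the first column of both matrices. The first columns are then
  proportional, so up to a scalar the two matrices differ by an upper triangular factor on the
  right.\<close>

lemma meeting_neighbour:
  fixes p q u v p' q' u' v' :: 'a
  defines "h1 \<equiv> M2 p q u v" and "h2 \<equiv> M2 p' q' u' v'"
  assumes h: "det h1 \<noteq> 0" "det h2 \<noteq> 0"
    and 1: "x \<in> K" "y \<in> K" "x \<noteq> 0 \<or> y \<noteq> 0" and 2: "s \<in> K" "t \<in> K" "s \<noteq> 0 \<or> t \<noteq> 0"
    and eq: "(p * x + q * y) * (u' * s + v' * t) = (u * x + v * y) * (p' * s + q' * t)"
    and card: "2 * card bad < CARD('a) - 1" "2 * Q * Q < CARD('a)"
  obtains h where "det h \<noteq> 0" "adj h1 h" "adj h2 h"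
proof -
  obtain b1 d1 where bd1: "b1 \<in> K" "d1 \<in> K" "x * d1 - b1 * y \<noteq> 0" by (rule K_column[OF 1])
  obtain b2 d2 where bd2: "b2 \<in> K" "d2 \<in> K" "s * d2 - b2 * t \<noteq> 0" by (rule K_column[OF 2])
  define S1 where "S1 = M2 x b1 y d1"
  define S2 where "S2 = M2 s b2 t d2"
  have S: "MK S1" "det S1 \<noteq> 0" "MK S2" "det S2 \<noteq> 0" using 1 2 bd1 bd2 by (simp_all add: S1_def S2_def)
  obtain a b c d where g: "h1 ** S1 = M2 a b c d" by (rule M2_cases)
  obtain a' b' c' d' where g': "h2 ** S2 = M2 a' b' c' d'" by (rule M2_cases)
  have detg: "a * d - b * c \<noteq> 0" using det_mul[of h1 S1] h S unfolding g by simp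
  have detg': "a' * d' - b' * c' \<noteq> 0" using det_mul[of h2 S2] h S unfolding g' by simp
  have "a' * c = c' * a"
  proof -
    have "a = p * x + q * y" "c = u * x + v * y" using g by (simp_all add: h1_def S1_def)
    moreover have "a' = p' * s + q' * t" "c' = u' * s + v' * t" using g' by (simp_all add: h2_def S2_def)
    ultimately have "a * c' = c * a'" using eq by simp
    then show ?thesis by (simp add: mult.commute)
  qed
  moreover have "a \<noteq> 0 \<or> c \<noteq> 0" using detg by auto
  ultimately obtain l where l: "a' = l * a" "c' = l * c" by (rule K_multiple)
  have l0: "l \<noteq> 0" using detg' unfolding l by auto
  define D where "D = a * d - b * c"
  define f e where "f = (d * (b' / l) - b * (d' / l)) / D" and "e = (a * (d' / l) - c * (b' / l)) / D"
  have eqn: "mat (1 / l) ** (h2 ** S2) = (h1 ** S1) ** M2 1 f 0 e"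
  proof -
    have "a * (d * (b' / l) - b * (d' / l)) + b * (a * (d' / l) - c * (b' / l)) = D * (b' / l)"
      "c * (d * (b' / l) - b * (d' / l)) + d * (a * (d' / l) - c * (b' / l)) = D * (d' / l)"
      by (simp_all add: D_def algebra_simps)
    then have "a * f + b * e = b' / l" "c * f + d * e = d' / l"
      using detg unfolding f_def e_def by (simp_all add: D_def add_divide_distrib[symmetric])
    then show ?thesis unfolding g g' l mat_M2 M2_mult using l0 by simp
  qed
  have "det (h1 ** S1) * e = det (mat (1 / l) ** (h2 ** S2))" unfolding eqn by (simp add: det_mul)
  then have e0: "e \<noteq> 0" using h S l0 by (auto simp: det_mul)
  have g0: "det (h1 ** S1) \<noteq> 0" using h S by (simp add: det_mul)
  obtain k where k: "det k \<noteq> 0" "adj (h1 ** S1) k" "adj (h1 ** S1 ** M2 1 f 0 e) k"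
    by (rule common_point_neighbour[OF g0 e0 card])
  have "adj h1 k" using adj_K[OF k(2) S(1,2)] .
  moreover have "eqv h2 (mat (1 / l) ** (h2 ** S2))"
    using eqv_trans[OF eqv_K[OF S(3,4)] eqv_smult] l0 by simp
  then have "adj h2 k" using adj_eqv[OF k(3)[folded eqn] eqv_sym eqv_refl] by simp
  ultimately show ?thesis using that[OF k(1)] by simp
qed

text \<open>Multiplication by an element c of \<open>K\<close> other than 0 and 1 permutes
  \<open>K\<close>, so the sum equals c times itself.\<close>

lemma sum_K_zero:
  assumes "Q > 2"
  shows "(\<Sum>x\<in>K. x) = 0"
proof -
  have "\<not> K \<subseteq> {0, 1}" using card_mono[of "{0, 1}" K] card_K assms by auto
  then obtain c where c: "c \<in> K" "c \<noteq> 0" "c \<noteq> 1" by auto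
  have "bij_betw ((*) c) K K"
    by (rule bij_betwI[where g = "\<lambda>x. x / c"]) (use c in \<open>auto simp: K_mult K_divide\<close>)
  then have "(\<Sum>x\<in>K. c * x) = (\<Sum>x\<in>K. x)" by (rule sum.reindex_bij_betw)
  then have "(c - 1) * (\<Sum>x\<in>K. x) = 0" by (simp add: sum_distrib_left left_diff_distrib sum_subtractf)
  then show ?thesis using c by simp
qed

text \<open>In characteristic \<open>2\<close> the function \<open>1 + z + z\<^sup>2\<close> is the indicator of \<open>z = 1\<close> on cube roots of
  unity; summing it over a plane shows that every norm is attained an odd number of times.\<close>

lemma norm_attained:
  assumes Q: "Q = 4" "r = 3" and \<nu>: "\<nu> ^ 3 = 1"
    and nz: "\<And>x y. x \<in> K \<Longrightarrow> y \<in> K \<Longrightarrow> x \<noteq> 0 \<or> y \<noteq> 0 \<Longrightarrow> x * P + y * R \<noteq> 0"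
  obtains x y where "x \<in> K" "y \<in> K" "x \<noteq> 0 \<or> y \<noteq> 0" "(x * P + y * R) ^ 21 = \<nu>"
proof (rule ccontr)
  note attained = that
  assume no: "\<not> thesis"
  have "CHAR('a) dvd 2 ^ 2" using Q(1) m_pos unfolding Q_def by (metis dvd_power numeral_Bit0 power2_eq_square mult_2_right numeral_One one_add_one Num.numeral_times_numeral num_double)
  then have char: "CHAR('a) = 2"
    using CHAR_prime[where 'a='a] prime_dvd_power primes_dvd_imp_eq two_is_prime_nat by blast
  have two: "(2 :: 'a) = 0" using of_nat_CHAR[where 'a='a] unfolding char by simp
  have four: "(4 :: 'a) = 0" using two by (metis mult_2 numeral_Bit0 mult_zero_left)
  define f where "f = (\<lambda>(x, y). (x * P + y * R) ^ 21 / \<nu>)"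
  have \<nu>0: "\<nu> \<noteq> 0" using \<nu> by auto
  have CARD: "CARD('a) = 64" unfolding CARD_Q Q by simp
  \<comment> \<open>At the origin f is 0, which gives 1. Elsewhere f is a cube root of unity, and
    not 1 because the norm \<nu> is assumed not to be attained.\<close>
  have f0: "1 + f z + (f z)\<^sup>2 = (if z = (0, 0) then 1 else 0)" if z: "z \<in> K \<times> K" for z
  proof (cases "z = (0, 0)")
    case True
    then show ?thesis by (simp add: f_def zero_power)
  next
    case False
    obtain x y where xy: "z = (x, y)" "x \<in> K" "y \<in> K" "x \<noteq> 0 \<or> y \<noteq> 0" using False z by auto
    let ?w = "x * P + y * R"
    have w: "?w ^ 63 = 1" using power_CARD_minus_1[OF nz[OF xy(2-4)]] by (simp add: CARD)
    have "f z ^ 3 = 1" using w \<nu> by (simp add: f_def xy(1) power_divide power_mult[symmetric])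
    then have "(f z - 1) * (1 + f z + (f z)\<^sup>2) = 0" by (simp add: algebra_simps power2_eq_square power3_eq_cube)
    moreover have "f z \<noteq> 1"
    proof
      assume "f z = 1"
      then have "?w ^ 21 = \<nu>" using \<nu>0 by (simp add: f_def xy(1))
      then show False using no attained[OF xy(2-4)] by blast
    qed
    ultimately show ?thesis using False by simp
  qed
  have K3: "x ^ 4 = x" if "x \<in> K" for x using that by (simp add: K_iff Q)
  have K4: "(x * a + y * b) ^ 4 = x * a ^ 4 + y * b ^ 4" if "x \<in> K" "y \<in> K" for x y a b
    using fr_add[of "x * a" "y * b" 2] K3 that by (simp add: char power_mult_distrib)
  \<comment> \<open>Since 21 = 1 + 4 + 16, the norm is the product of three conjugates; as x^4 = x
    on \<open>K\<close>, it is a cubic form in x and y.\<close>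
  have expand: "(x * P + y * R) ^ 21 = x * x * x * (P * P ^ 4 * P ^ 16) +
      x * x * y * (P * P ^ 4 * R ^ 16 + P * R ^ 4 * P ^ 16 + R * P ^ 4 * P ^ 16) +
      x * y * y * (P * R ^ 4 * R ^ 16 + R * P ^ 4 * R ^ 16 + R * R ^ 4 * P ^ 16) +
      y * y * y * (R * R ^ 4 * R ^ 16)" if "x \<in> K" "y \<in> K" for x y
  proof -
    let ?w = "x * P + y * R"
    have 4: "?w ^ 4 = x * P ^ 4 + y * R ^ 4" using K4[OF that] .
    have "?w ^ 16 = (?w ^ 4) ^ 4" by (simp flip: power_mult)
    also have "\<dots> = x * (P ^ 4) ^ 4 + y * (R ^ 4) ^ 4" unfolding 4 using K4[OF that] .
    finally have 16: "?w ^ 16 = x * P ^ 16 + y * R ^ 16" by (simp flip: power_mult)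
    have "?w ^ 21 = ?w * ?w ^ 4 * ?w ^ 16" by (simp flip: power_add power_Suc)
    also have "\<dots> = (x * P + y * R) * (x * P ^ 4 + y * R ^ 4) * (x * P ^ 16 + y * R ^ 16)" unfolding 4 16 ..
    finally show ?thesis by (simp add: distrib_left distrib_right mult_ac add_ac)
  qed
  have sumK: "(\<Sum>x\<in>K. x) = 0" using sum_K_zero Q by simp
  have cK: "of_nat (card K) = (0 :: 'a)" using four by (simp add: card_K Q)
  define A B C E where "A = P * P ^ 4 * P ^ 16" and "B = P * P ^ 4 * R ^ 16 + P * R ^ 4 * P ^ 16 + R * P ^ 4 * P ^ 16"
    and "C = P * R ^ 4 * R ^ 16 + R * P ^ 4 * R ^ 16 + R * R ^ 4 * P ^ 16" and "E = R * R ^ 4 * R ^ 16"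
  have sq: "(\<Sum>y\<in>K. y * y) = 0"
    using freshmans_dream_sum[OF CHAR_prime, of 2 "\<lambda>x::'a. x" K] sumK by (simp add: char power2_eq_square)
  \<comment> \<open>The number of elements of \<open>K\<close> is 0 in the field, and so are the
    sums of y and of y^2. What is left does not depend on x, so summing over x will multiply it by 0
    as well.\<close>
  have inner: "(\<Sum>y\<in>K. (x * P + y * R) ^ 21) = E * (\<Sum>y\<in>K. y * y * y)" if x: "x \<in> K" for x
  proof -
    have "(\<Sum>y\<in>K. (x * P + y * R) ^ 21) = (\<Sum>y\<in>K. x * x * x * A + (x * x * B) * y + (x * C) * (y * y) + E * (y * y * y))"
      by (rule sum.cong[OF refl]) (simp only: expand[OF x] A_def[symmetric] B_def[symmetric] C_def[symmetric] E_def[symmetric], simp only: mult_ac)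
    also have "\<dots> = of_nat (card K) * (x * x * x * A) + (x * x * B) * (\<Sum>y\<in>K. y) + (x * C) * (\<Sum>y\<in>K. y * y) + E * (\<Sum>y\<in>K. y * y * y)"
      by (simp only: sum.distrib sum_distrib_left sum_constant)
    also have "\<dots> = E * (\<Sum>y\<in>K. y * y * y)" unfolding cK sumK sq by simp
    finally show ?thesis .
  qed
  have "(\<Sum>x\<in>K. \<Sum>y\<in>K. (x * P + y * R) ^ 21) = (\<Sum>x\<in>K. E * (\<Sum>y\<in>K. y * y * y))"
    by (rule sum.cong[OF refl inner])
  also have "\<dots> = of_nat (card K) * (E * (\<Sum>y\<in>K. y * y * y))" by (rule sum_constant)
  finally have "(\<Sum>x\<in>K. \<Sum>y\<in>K. (x * P + y * R) ^ 21) = 0" unfolding cK by simp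
  then have "(\<Sum>x\<in>K. \<Sum>y\<in>K. (x * P + y * R) ^ 21 / \<nu>) = 0" by (simp only: sum_divide_distrib[symmetric]) simp
  then have sumf: "(\<Sum>z\<in>K\<times>K. f z) = 0" unfolding f_def by (simp only: sum.cartesian_product)
  \<comment> \<open>In characteristic 2 the squares of f sum to the square of the sum of f, so the
    left side of \<open>f0\<close> sums to 0, whereas its right side sums to 1.\<close>
  have "(\<Sum>z\<in>K\<times>K. (f z)\<^sup>2) = (\<Sum>z\<in>K\<times>K. f z)\<^sup>2"
    using freshmans_dream_sum[OF CHAR_prime, of 2 f "K\<times>K"] by (simp add: char)
  then have "(\<Sum>z\<in>K\<times>K. 1 + f z + (f z)\<^sup>2) = of_nat (card (K \<times> K))" by (simp add: sum.distrib sumf)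
  also have "\<dots> = 0" by (simp only: card_cartesian_product of_nat_mult cK mult_zero_left)
  finally have "(\<Sum>z\<in>K\<times>K. 1 + f z + (f z)\<^sup>2) = 0" .
  moreover have "(\<Sum>z\<in>K\<times>K. 1 + f z + (f z)\<^sup>2) = (\<Sum>z\<in>K\<times>K. if z = (0, 0) then 1 else 0)"
    by (rule sum.cong[OF refl f0])
  moreover have "\<dots> = 1" by (simp add: sum.delta)
  ultimately show False by simp
qed

lemma common_neighbour:
  assumes r: "odd r" "r > 1" and Q: "Q > 2"
    and h: "det h1 \<noteq> 0" "det h2 \<noteq> 0" "\<not> eqv h1 h2"
  obtains h where "det h \<noteq> 0" "adj h1 h" "adj h2 h"
proof (cases "Q = 4 \<and> r = 3")
  case False
  have card: "2 * card bad + 2 * Q * (Q - 1) < CARD('a) - 1" using card_bad[OF r Q] False by blast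
  obtain S1 where S1: "MK S1" "det S1 \<noteq> 0" "off h2 ((h1 ** S1)$1$1) ((h1 ** S1)$2$1)"
    using h by (rule exists_off)
  have "\<not> eqv h2 h1" using h(3) eqv_sym by blast
  then obtain S where S: "MK S" "det S \<noteq> 0" "off h1 ((h2 ** S)$1$1) ((h2 ** S)$2$1)"
    using exists_off[OF h(2,1)] by blast
  \<comment> \<open>The columns are exchanged because the point of the second subline, which goes to
    0, is read from the second column.\<close>
  define S2 where "S2 = S ** M2 0 1 1 0"
  have S2: "MK S2" "det S2 \<noteq> 0" using S by (simp_all add: S2_def MK_mult det_mul)
  have "(h2 ** S2)$1$2 = (h2 ** S)$1$1" "(h2 ** S2)$2$2 = (h2 ** S)$2$1"
    unfolding S2_def matrix_mul_assoc by (rule M2_cases[of "h2 ** S"], simp)+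
  then have off: "off h1 ((h2 ** S2)$1$2) ((h2 ** S2)$2$2)" using S(3) by simp
  show thesis
  proof (rule two_points_neighbour[OF h(1,2) S1(1,2) S2 S1(3) off])
    fix e1 e2 D assume D: "D \<noteq> 0" "e1 = det h1 * det S1 / D" "e2 = det h2 * det S2 / D"
    have e: "e1 \<noteq> 0" "e2 \<noteq> 0" using D h S1 S2 by simp_all
    have "excluded e1 e2 =
        {a. a \<noteq> 0 \<and> \<not> generic (e1 * a)} \<union> {a. a \<noteq> 0 \<and> \<not> generic (e2 / a)}" by blast
    then have "card (excluded e1 e2) \<le>
        card {a. a \<noteq> 0 \<and> \<not> generic (e1 * a)} + card {a. a \<noteq> 0 \<and> \<not> generic (e2 / a)}"
      by (simp only: card_Un_le)
    also have "\<dots> \<le> card bad + card bad"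
      using card_not_generic[OF e(1)] le_trans[OF card_inverse_image[OF e(2), of "\<lambda>x. \<not> generic x"] card_not_generic[OF e(2)]]
      by (rule add_mono)
    finally show "card (excluded e1 e2) + 2 * Q * (Q - 1) < CARD('a) - 1"
      using card by linarith
  qed (rule that)
next
  case True
  then have Q4: "Q = 4" and r3: "r = 3" by auto
  txt \<open>Counting alone fails here. The point of the first subline is chosen such that
    \<open>(e\<^sub>1 e\<^sub>2)\<^sup>2\<^sup>1 = 1\<close>; then the two sets of values excluded by norm one coincide.\<close>
  have CARD: "CARD('a) = 64" unfolding CARD_Q Q4 r3 by simp
  have "CHAR('a) dvd Q" unfolding Q_def using m_pos by (simp add: dvd_power)
  then have "CHAR('a) dvd 2 ^ 2" unfolding Q4 by simp
  then have char: "CHAR('a) = 2"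
    using prime_dvd_power[OF CHAR_prime] primes_dvd_imp_eq[OF CHAR_prime two_is_prime_nat] by blast
  have "2 ^ m = (2 ^ 2 :: nat)" using Q4 unfolding Q_def char by simp
  then have m2: "m = 2" by (rule power_inject_exp[THEN iffD1, rotated]) simp
  have Z12: "Zset 1 \<subseteq> Zset 2"
  proof
    fix x :: 'a assume "x \<in> Zset 1"
    then have "x ^ 3 = 1" by (simp add: Zset_def char Q4)
    then have "(x ^ 3) ^ 3 = 1" by simp
    then show "x \<in> Zset 2" by (simp add: Zset_def char Q4 flip: power_mult)
  qed
  have bad: "bad \<subseteq> Zset 2 \<union> Zset 3"
  proof -
    have "{1..<m} = {1}" unfolding m2 by auto
    then show ?thesis using bad_cubic[OF r3] Z12 unfolding m2 by auto
  qed
  have Z2: "card (Zset 2) \<le> 9" using card_Zset[of 2] by (simp add: char Q4)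
  have Z3: "card (Zset 3) \<le> 21" using card_Zset[of 3] by (simp add: char Q4)
  \<comment> \<open>Both sets contain the three nonzero elements of \<open>K\<close>, hence 9 + 21 -
    3 = 27.\<close>
  have "card (K - {0}) \<le> card (Zset 2 \<inter> Zset 3)"
    using K_subset_Zset by (intro card_mono) auto
  then have "3 \<le> card (Zset 2 \<inter> Zset 3)" by (simp add: card_K Q4 card_Diff_singleton)
  then have Z23: "card (Zset 2 \<union> Zset 3) \<le> 27"
    using card_Un_Int[of "Zset 2" "Zset 3"] Z2 Z3 by simp
  obtain p q u v where h1: "h1 = M2 p q u v" by (rule M2_cases)
  obtain p' q' u' v' where h2: "h2 = M2 p' q' u' v'" by (rule M2_cases)
  show thesis
  proof (cases "\<exists>x\<in>K. \<exists>y\<in>K. \<exists>s\<in>K. \<exists>t\<in>K. (x \<noteq> 0 \<or> y \<noteq> 0) \<and> (s \<noteq> 0 \<or> t \<noteq> 0) \<and>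
      (p * x + q * y) * (u' * s + v' * t) = (u * x + v * y) * (p' * s + q' * t)")
    case True
    have c1: "2 * card bad < CARD('a) - 1" using card_mono[OF _ bad] Z23 by (simp add: CARD)
    have c2: "2 * Q * Q < CARD('a)" by (simp add: Q4 CARD)
    obtain x y s t where xyst: "x \<in> K" "y \<in> K" "x \<noteq> 0 \<or> y \<noteq> 0" "s \<in> K" "t \<in> K" "s \<noteq> 0 \<or> t \<noteq> 0"
      "(p * x + q * y) * (u' * s + v' * t) = (u * x + v * y) * (p' * s + q' * t)"
      using True by auto
    show thesis
      by (rule meeting_neighbour[OF h(1,2)[unfolded h1 h2] xyst c1 c2]) (rule that[unfolded h1 h2])
  next
    case disj: False
    define S2 :: "'a^2^2" where "S2 = mat 1"
    have S2: "MK S2" "det S2 = 1" by (simp_all add: S2_def)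
    \<comment> \<open>Here e1 e2 = det h1 det h2 det S1 / D^2 and det S1^21 = 1, so (e1 e2)^21 = 1
      asks for D^42 = (det h1 det h2)^21. As 63rd powers are 1, the norm D^21 = \<nu> achieves this,
      and \<nu>^3 = 1 is what \<open>norm_attained\<close> requires.\<close>
    define \<nu> where "\<nu> = (det h1 * det h2) ^ 42"
    have d63: "(det h1 * det h2) ^ 63 = 1" using power_CARD_minus_1[of "det h1 * det h2"] h by (simp add: CARD)
    have "\<nu> ^ 3 = ((det h1 * det h2) ^ 63) ^ 2" unfolding \<nu>_def by (simp flip: power_mult)
    then have "\<nu> ^ 3 = 1" unfolding d63 by simp
    have \<nu>2: "\<nu> ^ 2 = (det h1 * det h2) ^ 21"
    proof -
      have "\<nu> ^ 2 = (det h1 * det h2) ^ 63 * (det h1 * det h2) ^ 21" unfolding \<nu>_def by (simp flip: power_mult power_add)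
      then show ?thesis unfolding d63 by simp
    qed
    \<comment> \<open>The determinant D as a linear form in the point (x : y) of the first subline,
      with the point (q' : v') of the second one fixed. It has no zero because the sublines are
      disjoint.\<close>
    define P R where "P = p * v' - q' * u" and "R = q * v' - q' * v"
    have nz: "x * P + y * R \<noteq> 0" if "x \<in> K" "y \<in> K" "x \<noteq> 0 \<or> y \<noteq> 0" for x y
    proof
      assume "x * P + y * R = 0"
      then have "(p * x + q * y) * (u' * 0 + v' * 1) = (u * x + v * y) * (p' * 0 + q' * 1)"
        by (simp add: P_def R_def algebra_simps)
      moreover have "(1::'a) \<noteq> 0" by simp
      ultimately show False using disj that K_zero K_one by blast
    qed
    obtain x y where xy: "x \<in> K" "y \<in> K" "x \<noteq> 0 \<or> y \<noteq> 0" "(x * P + y * R) ^ 21 = \<nu>"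
      by (rule norm_attained[OF Q4 r3 \<open>\<nu> ^ 3 = 1\<close> nz])
    obtain b d where bd: "b \<in> K" "d \<in> K" "x * d - b * y \<noteq> 0" using xy(1-3) by (rule K_column)
    define S1 where "S1 = M2 x b y d"
    have S1: "MK S1" "det S1 \<noteq> 0" using xy bd by (simp_all add: S1_def)
    have c1: "(h1 ** S1)$1$1 = p * x + q * y" "(h1 ** S1)$2$1 = u * x + v * y" by (simp_all add: h1 S1_def)
    have c2: "(h2 ** S2)$1$2 = q'" "(h2 ** S2)$2$2 = v'" by (simp_all add: h2 S2_def)
    have off1: "off h2 ((h1 ** S1)$1$1) ((h1 ** S1)$2$1)" unfolding c1 h2 off_def M2_nth
    proof (intro ballI impI notI)
      fix s t assume st: "s \<in> K" "t \<in> K" "s \<noteq> 0 \<or> t \<noteq> 0"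
        "(p * x + q * y) * (s * u' + t * v') = (u * x + v * y) * (s * p' + t * q')"
      have "(p * x + q * y) * (u' * s + v' * t) = (u * x + v * y) * (p' * s + q' * t)"
        using st(4) by (simp only: mult.commute)
      then show False using disj xy(1-3) st(1-3) by blast
    qed
    have off2: "off h1 ((h2 ** S2)$1$2) ((h2 ** S2)$2$2)" unfolding c2 h1 off_def M2_nth
    proof (intro ballI impI notI)
      fix s t assume st: "s \<in> K" "t \<in> K" "s \<noteq> 0 \<or> t \<noteq> 0"
        "q' * (s * u + t * v) = v' * (s * p + t * q)"
      then have "s * P + t * R = 0" by (simp add: P_def R_def algebra_simps)
      then show False using nz st(1-3) by blast
    qed
    show thesis
    proof (rule two_points_neighbour[OF h(1,2) S1 S2(1) _ off1 off2])
      show "det S2 \<noteq> 0" using S2 by simp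
      fix e1 e2 D assume D: "D = (h1 ** S1)$1$1 * (h2 ** S2)$2$2 - (h2 ** S2)$1$2 * (h1 ** S1)$2$1" "D \<noteq> 0"
        "e1 = det h1 * det S1 / D" "e2 = det h2 * det S2 / D"
      have e: "e1 \<noteq> 0" "e2 \<noteq> 0" using D(2-4) h S1 S2 by simp_all
      have "D = x * P + y * R" unfolding D(1) c1 c2 by (simp add: P_def R_def algebra_simps)
      then have D21: "D ^ 21 = \<nu>" using xy(4) by simp
      have "det S1 ^ 3 = 1" using K_nz_iff[of "det S1"] MK_det[OF S1(1)] S1(2) by (simp add: Q4)
      then have "(det S1 ^ 3) ^ 7 = 1" by simp
      then have s21: "det S1 ^ 21 = 1" by (simp flip: power_mult)
      have "(D ^ 2) ^ 21 = \<nu> ^ 2" unfolding D21[symmetric] by (simp flip: power_mult)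
      moreover have "e1 * e2 = (det h1 * det h2) * det S1 / D ^ 2" unfolding D(3,4) S2(2) by (simp add: power2_eq_square)
      ultimately have "(e1 * e2) ^ 21 = (det h1 * det h2) ^ 21 * det S1 ^ 21 / \<nu> ^ 2"
        by (simp only: power_divide power_mult_distrib)
      also have "\<dots> = 1" unfolding \<nu>2 s21 using h by simp
      finally have \<kappa>: "(e1 * e2) ^ 21 = 1" .
      \<comment> \<open>If e2/a has 21st power 1, so has e1 a, because their product e1 e2 has.
        \<open>Zset 3\<close> is therefore counted once, and 27 + 9 = 36 values together with 24
        stay below 63.\<close>
      have "excluded e1 e2 \<subseteq>
        (\<lambda>z. z / e1) ` (Zset 2 \<union> Zset 3) \<union> (\<lambda>z. e2 / z) ` Zset 2"
      proof
        fix a assume "a \<in> excluded e1 e2"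
        then have a: "a \<noteq> 0" "\<not> generic (e1 * a) \<or> \<not> generic (e2 / a)" by simp_all
        have a1: "a \<in> (\<lambda>z. z / e1) ` X" if "e1 * a \<in> X" for X
          using imageI[OF that, of "\<lambda>z. z / e1"] e by simp
        have a2: "a \<in> (\<lambda>z. e2 / z) ` X" if "e2 / a \<in> X" for X
          using imageI[OF that, of "\<lambda>z. e2 / z"] a(1) e by simp
        have "e1 * a \<in> Zset 2 \<union> Zset 3 \<or> e2 / a \<in> Zset 2"
        proof (cases "generic (e1 * a)")
          case False
          then have "e1 * a \<in> bad" using a e by (simp add: bad_def)
          then show ?thesis using bad by blast
        next
          case True
          then have "e2 / a \<in> bad" using a e by (simp add: bad_def)
          then have "e2 / a \<in> Zset 2 \<or> e2 / a \<in> Zset 3" using bad by blast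
          moreover have "e1 * a \<in> Zset 3" if "e2 / a \<in> Zset 3"
          proof -
            have "(e2 / a) ^ 21 = 1" using that by (simp add: Zset_def char Q4)
            moreover have "(e1 * a) ^ 21 * (e2 / a) ^ 21 = (e1 * e2) ^ 21"
              unfolding power_mult_distrib[symmetric] using a by simp
            ultimately have "(e1 * a) ^ 21 = 1" using \<kappa> by simp
            then show ?thesis by (simp add: Zset_def char Q4)
          qed
          ultimately show ?thesis by blast
        qed
        then show "a \<in> (\<lambda>z. z / e1) ` (Zset 2 \<union> Zset 3) \<union> (\<lambda>z. e2 / z) ` Zset 2"
        proof
          assume "e1 * a \<in> Zset 2 \<union> Zset 3"
          then show ?thesis by (rule UnI1[OF a1])
        next
          assume "e2 / a \<in> Zset 2"
          then show ?thesis by (rule UnI2[OF a2])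
        qed
      qed
      then have "card (excluded e1 e2) \<le>
          card ((\<lambda>z. z / e1) ` (Zset 2 \<union> Zset 3) \<union> (\<lambda>z. e2 / z) ` Zset 2)"
        by (rule card_mono[rotated]) simp
      also have "\<dots> \<le> card ((\<lambda>z. z / e1) ` (Zset 2 \<union> Zset 3)) + card ((\<lambda>z. e2 / z) ` Zset 2)" by (rule card_Un_le)
      also have "\<dots> \<le> card (Zset 2 \<union> Zset 3) + card (Zset 2)" by (intro add_mono card_image_le) simp_all
      also have "\<dots> \<le> 36" using Z23 Z2 by linarith
      finally show "card (excluded e1 e2) + 2 * Q * (Q - 1) < CARD('a) - 1"
        by (simp add: Q4 CARD)
    qed (rule that)
  qed
qed

end

section \<open>Embeddings of \<open>PSL(2,q\<^sub>0)\<close> in the defining characteristic\<close>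

definition prp :: "'a::field ^ 2 ^ 2 \<Rightarrow> 'a ^ 2 ^ 2 \<Rightarrow> bool" where
  "prp A B \<longleftrightarrow> (\<exists>c. c \<noteq> 0 \<and> B = mat c ** A)"

lemma prp_M2: "prp (M2 a b c d) (M2 a' b' c' d') \<longleftrightarrow> (\<exists>k. k \<noteq> 0 \<and> a' = k * a \<and> b' = k * b \<and> c' = k * c \<and> d' = k * d)"
  by (simp add: prp_def mat_M2)

lemma prp_refl [simp]: "prp A A"
  unfolding prp_def by (rule exI[of _ 1]) simp

lemma prp_sym: "prp A B \<Longrightarrow> prp B A"
proof -
  assume "prp A B"
  then obtain c where c: "c \<noteq> 0" "B = mat c ** A" by (auto simp: prp_def)
  then have "A = mat (1 / c) ** B" by (simp add: mat_mult_mat)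
  then show ?thesis using c(1) unfolding prp_def by (intro exI[of _ "1 / c"]) simp
qed

lemma prp_trans [trans]: "prp A B \<Longrightarrow> prp B C \<Longrightarrow> prp A C"
proof -
  assume "prp A B" "prp B C"
  then obtain c d where "c \<noteq> 0" "B = mat c ** A" "d \<noteq> 0" "C = mat d ** B" by (auto simp: prp_def)
  then show ?thesis unfolding prp_def by (intro exI[of _ "d * c"]) (simp add: mat_mult_mat)
qed

lemma prp_mult: "prp A B \<Longrightarrow> prp C D \<Longrightarrow> prp (A ** C) (B ** D)"
proof -
  assume "prp A B" "prp C D"
  then obtain c d where cd: "c \<noteq> 0" "B = mat c ** A" "d \<noteq> 0" "D = mat d ** C" by (auto simp: prp_def)
  have "B ** D = mat c ** (A ** (mat d ** C))" unfolding cd(2,4) by (simp add: matrix_mul_assoc)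
  also have "\<dots> = mat (c * d) ** (A ** C)" unfolding mat_left_commute[of A] by (rule mat_mult_mat)
  finally show ?thesis using cd unfolding prp_def by (intro exI[of _ "c * d"]) simp
qed

lemma prp_smult: "c \<noteq> 0 \<Longrightarrow> prp A (mat c ** A)"
  by (auto simp: prp_def)

lemma prp_cos2: "cos2 A = cos2 B \<longleftrightarrow> prp A B"
  by (simp add: cos2_eq_iff prp_def)

lemma prp_one: "prp (mat 1) A \<longleftrightarrow> (\<exists>c. c \<noteq> 0 \<and> A = mat c)"
  by (simp add: prp_def)

primrec mpow :: "'a::field ^ 2 ^ 2 \<Rightarrow> nat \<Rightarrow> 'a ^ 2 ^ 2" where
  "mpow A 0 = mat 1"
| "mpow A (Suc k) = A ** mpow A k"

text \<open>Powers of \<open>X\<close> are reduced modulo its characteristic polynomial \<open>f\<close>, so if the power \<open>X\<^sup>p\<close> is the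
  scalar \<open>d\<^sup>p\<close> then \<open>f\<close> divides \<open>x\<^sup>p - d\<^sup>p = (x - d)\<^sup>p\<close>.\<close>

lemma scalar_p_power:
  fixes x y z w :: "'a::finite_field"
  assumes det: "x * w - y * z = 1" and nonscalar: "\<not> (y = 0 \<and> z = 0 \<and> x = w)"
    and pow: "mpow (M2 x y z w) CHAR('a) = mat c"
  obtains d where "d * d = 1" "x + w = 2 * d"
proof -
  define t where "t = x + w"
  define f where "f = [:1, - t, 1:]"
  have "\<exists>u v q. mpow (M2 x y z w) k = M2 (u * x + v) (u * y) (u * z) (u * w + v) \<and> [:0, 1:] ^ k = q * f + [:v, u:]" for k
  proof (induction k)
    case 0
    show ?case by (rule exI[of _ 0], rule exI[of _ 1], rule exI[of _ 0]) (simp add: mat_M2 one_pCons)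
  next
    case (Suc k)
    then obtain u v q where IH: "mpow (M2 x y z w) k = M2 (u * x + v) (u * y) (u * z) (u * w + v)"
      "[:0, 1:] ^ k = q * f + [:v, u:]" by blast
    have yz: "y * z = x * w - 1" using det by (simp add: algebra_simps)
    have "x * (u * x + v) + y * (u * z) = (u * t + v) * x - u" "z * (u * y) + w * (u * w + v) = (u * t + v) * w - u"
      using arg_cong[OF yz, of "\<lambda>s. u * s"] by (simp_all add: t_def algebra_simps)
    moreover have "x * (u * y) + y * (u * w + v) = (u * t + v) * y" "z * (u * x + v) + w * (u * z) = (u * t + v) * z"
      by (simp_all add: t_def algebra_simps)
    ultimately have "mpow (M2 x y z w) (Suc k) = M2 ((u * t + v) * x + - u) ((u * t + v) * y) ((u * t + v) * z) ((u * t + v) * w + - u)"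
      unfolding mpow.simps IH(1) M2_mult by simp
    moreover have "[:0, 1:] ^ Suc k = ([:0, 1:] * q + [:u:]) * f + [:- u, u * t + v:]"
      unfolding power_Suc IH(2) by (simp add: f_def algebra_simps)
    ultimately show ?case by blast
  qed
  then obtain u v q where uv: "mpow (M2 x y z w) CHAR('a) = M2 (u * x + v) (u * y) (u * z) (u * w + v)"
    "[:0, 1:] ^ CHAR('a) = q * f + [:v, u:]" by blast
  have "u * y = 0" "u * z = 0" "u * x = u * w" "u * x + v = c" using uv(1) unfolding pow mat_M2 M2_eq_iff by auto
  then have u: "u = 0" and v: "v = c" using nonscalar by auto
  have "surj (\<lambda>x::'a. x ^ (CHAR('a) ^ 1))"
    by (rule finite_UNIV_inj_surj[OF finite]) (simp only: inj_def fr_inj, blast)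
  then obtain d where d: "c = d ^ (CHAR('a) ^ 1)" by (rule surjE)
  have "([:0, 1:] :: 'a poly) = [:- d, 1:] + [:d:]" by simp
  then have "[:0, 1:] ^ CHAR('a) = [:- d, 1:] ^ CHAR('a) + [:d:] ^ CHAR('a)"
    by (metis freshmans_dream semiring_char_poly CHAR_prime)
  also have "[:d:] ^ CHAR('a) = [:c:]" unfolding d by (simp add: poly_const_pow)
  finally have q: "q * f = [:- d, 1:] ^ CHAR('a)" unfolding uv(2) u v by simp
  have root: "s = d" if "poly f s = 0" for s
  proof -
    have "poly (q * f) s = 0" using that by simp
    then have "(s - d) ^ CHAR('a) = 0" unfolding q by simp
    then show ?thesis by simp
  qed
  have "poly f d = 0"
  proof (rule ccontr)
    assume nr: "poly f d \<noteq> 0"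
    \<comment> \<open>If d is not a root of f, every factor x - d can be cancelled from q, until f
      divides 1.\<close>
    have "q * f = [:- d, 1:] ^ k \<Longrightarrow> degree f = 0" for k q
    proof (induction k arbitrary: q)
      case 0
      then have "f dvd 1" by (metis dvd_triv_right power_0)
      then show ?case using dvd_imp_degree_le[of f 1] by simp
    next
      case (Suc k)
      then have "poly (q * f) d = 0" by simp
      then have "poly q d = 0" using nr by simp
      then obtain q' where q': "q = [:- d, 1:] * q'" by (auto simp: poly_eq_0_iff_dvd)
      have "[:- d, 1:] * (q' * f) = [:- d, 1:] * [:- d, 1:] ^ k" using Suc(2) unfolding q' power_Suc by (simp only: mult.assoc)
      then have "q' * f = [:- d, 1:] ^ k" by (subst (asm) mult_cancel_left) simp
      then show ?case by (rule Suc(1))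
    qed
    from this[OF q] show False by (simp add: f_def)
  qed
  then have *: "1 + d * d - t * d = 0" by (simp add: f_def algebra_simps)
  then have "poly f (t - d) = 0" by (simp add: f_def algebra_simps)
  then have td: "t = 2 * d" using root[of "t - d"] by (simp add: algebra_simps)
  then have "d * d = 1" using * by (simp add: algebra_simps)
  then show thesis using that td by (simp add: t_def)
qed

abbreviation upper :: "'a::field \<Rightarrow> 'a ^ 2 ^ 2" where "upper a \<equiv> M2 1 a 0 1"
abbreviation weyl :: "'a::field ^ 2 ^ 2" where "weyl \<equiv> M2 0 (- 1) 1 0"

text \<open>F picks a matrix of determinant 1 for each value of an embedding of PSL(2), so it is
  multiplicative only up to scalars; \<open>F_one\<close> is the injectivity of the
  embedding.\<close>

locale proj_rep =
  fixes F :: "'b::finite_field ^ 2 ^ 2 \<Rightarrow> 'a::finite_field ^ 2 ^ 2"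
  assumes char: "CHAR('a) = CHAR('b)"
    and det_F: "det S = 1 \<Longrightarrow> det (F S) = 1"
    and F_mult: "det S = 1 \<Longrightarrow> det R = 1 \<Longrightarrow> prp (F S ** F R) (F (S ** R))"
    and F_one: "det S = 1 \<Longrightarrow> prp (mat 1) (F S) \<longleftrightarrow> prp (mat 1) S"
begin

lemma conj_rep:
  assumes g: "det g \<noteq> 0"
  shows "proj_rep (\<lambda>S. inv2 g ** F S ** g)"
proof
  show "CHAR('a) = CHAR('b)" by (rule char)
next
  fix S :: "'b^2^2" assume S: "det S = 1"
  show "det (inv2 g ** F S ** g) = 1" using det_F[OF S] det_inv2[OF g] by (simp add: det_mul)
  show "prp (mat 1) (inv2 g ** F S ** g) \<longleftrightarrow> prp (mat 1) S"
  proof -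
    have "inv2 g ** F S ** g = mat c \<longleftrightarrow> F S = mat c" for c
    proof
      assume "inv2 g ** F S ** g = mat c"
      then have "g ** (inv2 g ** F S ** g) ** inv2 g = g ** mat c ** inv2 g" by simp
      also have "\<dots> = mat c" unfolding mat_comm[symmetric] using g by (simp add: matrix_mul_assoc[symmetric] inv2_right)
      finally show "F S = mat c" using g by (simp add: matrix_mul_assoc[symmetric] inv2_right)
    next
      assume "F S = mat c"
      then show "inv2 g ** F S ** g = mat c"
        by (simp only: mat_comm[of c "inv2 g", symmetric] matrix_mul_assoc[symmetric] inv2_left[OF g] matrix_mul_rid)
    qed
    then have "prp (mat 1) (inv2 g ** F S ** g) \<longleftrightarrow> prp (mat 1) (F S)" unfolding prp_one by simp
    then show ?thesis using F_one[OF S] by simp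
  qed
next
  fix S R :: "'b^2^2" assume SR: "det S = 1" "det R = 1"
  have "prp (inv2 g ** (F S ** F R) ** g) (inv2 g ** F (S ** R) ** g)"
    by (intro prp_mult prp_refl F_mult SR)
  moreover have "inv2 g ** F S ** g ** (inv2 g ** F R ** g) = inv2 g ** (F S ** F R) ** g"
    using g by (simp add: matrix_mul_assoc[symmetric])
  ultimately show "prp (inv2 g ** F S ** g ** (inv2 g ** F R ** g)) (inv2 g ** F (S ** R) ** g)" by simp
qed

lemma F_mpow: "det S = 1 \<Longrightarrow> prp (mpow (F S) k) (F (mpow S k)) \<and> det (mpow S k) = 1"
proof (induction k)
  case 0
  show ?case using F_one[of "mat 1"] by (simp add: mat_M2)
next
  case (Suc k)
  then have "prp (F S ** mpow (F S) k) (F S ** F (mpow S k))" by (intro prp_mult) auto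
  also have "prp (F S ** F (mpow S k)) (F (S ** mpow S k))" using Suc by (intro F_mult) auto
  finally show ?case using Suc by (simp add: det_mul)
qed

lemma mpow_upper: "mpow (upper (a::'b)) k = upper (of_nat k * a)"
  by (induction k) (simp_all add: mat_M2 algebra_simps)

text \<open>\<open>upper a\<close> has order p, so its image is a nonscalar matrix with scalar p-th
  power, and \<open>scalar_p_power\<close> gives it a double eigenvalue d, with d = 1 or d =
  -1.\<close>

lemma unipotent:
  assumes "a \<noteq> 0" "F (upper a) = M2 x y z w"
  obtains d where "d * d = 1" "x + w = 2 * d"
proof -
  have "prp (mpow (F (upper a)) CHAR('b)) (F (mpow (upper a) CHAR('b)))" using F_mpow by simp
  also have "mpow (upper a) CHAR('b) = mat 1" unfolding mpow_upper by (simp add: mat_M2)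
  finally have "prp (F (mat 1)) (mpow (F (upper a)) CHAR('b))" by (rule prp_sym)
  moreover have "prp (mat 1) (F (mat 1))" using F_one[of "mat 1"] by simp
  ultimately have "prp (mat 1) (mpow (F (upper a)) CHAR('b))" using prp_trans by blast
  then obtain c where c: "mpow (M2 x y z w) CHAR('a) = mat c" unfolding prp_one assms(2) char by blast
  have "\<not> prp (mat 1) (F (upper a))"
    using F_one[of "upper a"] assms(1) unfolding prp_one by (simp add: mat_M2)
  then have ns: "\<not> prp (mat 1) (M2 x y z w)" unfolding assms(2) .
  have det: "x * w - y * z = 1" using det_F[of "upper a"] assms(2) by simp
  have "\<not> (y = 0 \<and> z = 0 \<and> x = w)"
  proof
    assume e: "y = 0 \<and> z = 0 \<and> x = w"
    then have "x \<noteq> 0" using det by auto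
    then show False using ns e unfolding prp_one by (simp add: mat_M2)
  qed
  then show thesis using scalar_p_power[OF det _ c] that by blast
qed

text \<open>If z is not 0, then (x - d, z) is an eigenvector for the double eigenvalue; as first
  column of \<open>g\<close> it moves the fixed point to \<infinity>.\<close>

lemma unipotent_eigenvector:
  assumes "a \<noteq> 0"
  obtains g where "det g \<noteq> 0" "(inv2 g ** F (upper a) ** g)$2$1 = 0"
proof -
  obtain x y z w where X: "F (upper a) = M2 x y z w" by (rule M2_cases)
  obtain d where d: "d * d = 1" "x + w = 2 * d" by (rule unipotent[OF assms X])
  have det: "x * w - y * z = 1" using det_F[of "upper a"] X by simp
  have *: "z * y = - ((x - d) * (x - d))"
  proof -
    have w: "w = 2 * d - x" using d(2) by (simp add: algebra_simps)
    show ?thesis using det d(1) unfolding w by (simp add: algebra_simps)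
  qed
  show thesis
  proof (cases "z = 0")
    case True
    then show ?thesis using that[of "mat 1"] X by (simp add: inv2_def mat_M2)
  next
    case False
    define g where "g = M2 (x - d) 1 z 0"
    have "det g \<noteq> 0" using False by (simp add: g_def)
    moreover have "(inv2 g ** F (upper a) ** g)$2$1 = 0"
    proof -
      have w: "w = 2 * d - x" using d(2) by (simp add: algebra_simps)
      have "x * (x - d) + y * z = d * (x - d)" using * by (simp add: algebra_simps)
      moreover have "z * (x - d) + w * z = d * z" unfolding w by (simp add: algebra_simps)
      ultimately have "F (upper a) ** g = M2 (d * (x - d)) x (d * z) z" unfolding X g_def by simp
      then show ?thesis unfolding matrix_mul_assoc[symmetric] by (simp add: inv2_def g_def)
    qed
    ultimately show ?thesis by (rule that)
  qed
qed

end

lemma inv2_mult: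
  fixes A B :: "'a::field^2^2"
  assumes "det A \<noteq> 0" "det B \<noteq> 0"
  shows "inv2 (A ** B) = inv2 B ** inv2 A"
proof -
  have "inv2 (A ** B) ** (A ** B) ** (inv2 B ** inv2 A) = inv2 B ** inv2 A"
    using assms by (simp add: inv2_left det_mul)
  moreover have "inv2 (A ** B) ** (A ** B) ** (inv2 B ** inv2 A) = inv2 (A ** B)"
    using assms by (simp add: matrix_mul_assoc[symmetric] inv2_right)
  ultimately show ?thesis by simp
qed

lemma prp_M2E:
  assumes "prp (M2 a b c d) (M2 a' b' c' d')"
  obtains k where "k \<noteq> 0" "a' = k * a" "b' = k * b" "c' = k * c" "d' = k * d"
proof -
  have "\<exists>k. k \<noteq> 0 \<and> a' = k * a \<and> b' = k * b \<and> c' = k * c \<and> d' = k * d"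
    using assms by (simp only: prp_M2)
  then show thesis by (elim exE conjE) (rule that)
qed

context proj_rep
begin

lemma F_neg_one: "prp (mat 1) (F (mat (- 1)))"
proof -
  have "prp (mat 1) (mat (- 1) :: 'b^2^2)" unfolding prp_one by (rule exI[of _ "- 1"]) simp
  then show ?thesis using F_one[of "mat (- 1)"] by simp
qed

lemma upper_unipotent:
  assumes "F (upper a) = M2 x y 0 z"
  shows "x = z" "x \<noteq> 0" "a \<noteq> 0 \<Longrightarrow> y \<noteq> 0"
proof -
  have det: "x * z = 1" using det_F[of "upper a"] assms by simp
  then show "x \<noteq> 0" by auto
  show xz: "x = z"
  proof (cases "a = 0")
    case True
    then have "prp (mat 1) (F (upper a))" using F_one[of "upper a"] by (simp add: mat_M2)
    then show ?thesis unfolding assms prp_one by (auto simp: mat_M2)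
  next
    case False
    obtain d where d: "d * d = 1" "x + z = 2 * d" by (rule unipotent[OF False assms])
    have "(x - z) * (x - z) = (x + z) * (x + z) - 4 * (x * z)" by (simp add: algebra_simps)
    also have "(x + z) * (x + z) = 4 * (d * d)" unfolding d(2) by simp
    finally have "(x - z) * (x - z) = 0" unfolding d(1) det by simp
    then show ?thesis by simp
  qed
  assume "a \<noteq> 0"
  show "y \<noteq> 0"
  proof
    assume "y = 0"
    then have "prp (mat 1) (F (upper a))" unfolding assms prp_one using xz \<open>x \<noteq> 0\<close> by (auto simp: mat_M2)
    then show False using F_one[of "upper a"] \<open>a \<noteq> 0\<close> unfolding prp_one by (auto simp: mat_M2)
  qed
qed

text \<open>The image commutes up to a scalar k with that of \<open>upper 1\<close>, whose only
  fixed point is \<infinity>. A nonzero lower left entry would give k = 1 and then contradict the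
  upper left entries.\<close>

lemma upper_all:
  assumes "(F (upper 1))$2$1 = 0"
  obtains \<alpha> where "prp (upper \<alpha>) (F (upper a))"
proof -
  obtain d e d' where 1: "F (upper 1) = M2 d e 0 d'" using assms M2_collapse by metis
  have d: "d = d'" "d \<noteq> 0" "e \<noteq> 0" using upper_unipotent[OF 1] by auto
  obtain x y z w where a: "F (upper a) = M2 x y z w" by (rule M2_cases)
  have "prp (F (upper a) ** F (upper 1)) (F (upper a ** upper 1))" by (intro F_mult) simp_all
  also have "upper a ** upper 1 = upper 1 ** upper a" by (simp add: add.commute)
  also have "prp (F (upper 1 ** upper a)) (F (upper 1) ** F (upper a))" by (rule prp_sym, intro F_mult) simp_all
  finally have "prp (M2 (x * d) (x * e + y * d) (z * d) (z * e + w * d)) (M2 (d * x + e * z) (d * y + e * w) (d * z) (d * w))"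
    unfolding 1 a d(1)[symmetric] by simp
  then obtain k where k: "k \<noteq> 0" "d * x + e * z = k * (x * d)" "d * z = k * (z * d)" by (rule prp_M2E)
  have "z = 0"
  proof (rule ccontr)
    assume z: "z \<noteq> 0"
    then have "k = 1" using k(3) d(2) by simp
    then show False using k(2) z d(3) by (simp add: mult.commute)
  qed
  then have a': "F (upper a) = M2 x y 0 w" using a by simp
  have "F (upper a) = mat x ** upper (y / x)" using upper_unipotent(1,2)[OF a'] unfolding a' by (simp add: mat_M2)
  then show thesis using that[of "y / x"] prp_smult[OF upper_unipotent(2)[OF a'], of "upper (y / x)"] by simp
qed

text \<open>Suppose the image of \<open>weyl\<close> fixed \<infinity>. The relations W^2 = (W U)^3
  = 1 give x^2 = z^2 and x^3 = z^3, so x = z, and then 2 y = 0 and 3 (x \<alpha> + y) = 0. In odd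
  characteristic y = 0 and W becomes trivial; in characteristic 2 the images of W and U coincide.
  Both contradict injectivity.\<close>

lemma weyl_not_upper:
  assumes "(F (upper 1))$2$1 = 0"
  shows "(F weyl)$2$1 \<noteq> 0"
proof
  assume "(F weyl)$2$1 = 0"
  then obtain x y z where W: "F weyl = M2 x y 0 z" using M2_collapse by metis
  have nz: "x \<noteq> 0" "z \<noteq> 0" using det_F[of weyl] W by auto
  obtain \<alpha> where \<alpha>: "prp (upper \<alpha>) (F (upper 1))" by (rule upper_all[OF assms])
  have "prp (F weyl ** F weyl) (F (weyl ** weyl))" by (intro F_mult) simp_all
  also have "weyl ** weyl = mat (- 1)" by (simp add: mat_M2)
  also have "prp (F (mat (- 1))) (mat 1)" by (rule prp_sym[OF F_neg_one])
  finally have "prp (M2 (x * x) (x * y + y * z) 0 (z * z)) (M2 1 0 0 1)" unfolding W by (simp add: mat_M2)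
  then obtain k0 where k0: "k0 \<noteq> 0" "1 = k0 * (x * x)" "0 = k0 * (x * y + y * z)" "1 = k0 * (z * z)" by (rule prp_M2E)
  have "k0 * (x * x) = k0 * (z * z)" using k0(2,4) by (rule trans[OF sym])
  then have sq: "x * x = z * z" "x * y + y * z = 0" using k0(1,3) by simp_all
  have "prp (mpow (F (weyl ** upper 1)) 3) (F (mpow (weyl ** upper 1) 3))" using F_mpow[of "weyl ** upper 1"] by simp
  also have "mpow (weyl ** upper 1) 3 = mat (- 1 :: 'b)" by (simp add: numeral_3_eq_3 mat_M2)
  also have "prp (F (mat (- 1))) (mat 1)" by (rule prp_sym[OF F_neg_one])
  finally have cub: "prp (mpow (F (weyl ** upper 1)) 3) (mat 1)" .
  have "prp (M2 x y 0 z ** upper \<alpha>) (F weyl ** F (upper 1))" unfolding W[symmetric] by (intro prp_mult prp_refl \<alpha>)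
  also have "prp (F weyl ** F (upper 1)) (F (weyl ** upper 1))" by (intro F_mult) simp_all
  finally obtain k where k: "k \<noteq> 0" "F (weyl ** upper 1) = mat k ** M2 x (x * \<alpha> + y) 0 z" by (auto simp: prp_def)
  have prpk: "prp (M2 (k*x*(k*x*(k*x))) ((k*x)*((k*x)*(k*(x*\<alpha>+y)) + k*(x*\<alpha>+y)*(k*z)) + k*(x*\<alpha>+y)*(k*z*(k*z))) 0 (k*z*(k*z*(k*z)))) (mat 1)"
    using cub unfolding k(2) by (simp add: numeral_3_eq_3 mat_M2)
  have cb: "k*x*(k*x*(k*x)) = k*z*(k*z*(k*z))"
    and cb2: "(k*x)*((k*x)*(k*(x*\<alpha>+y)) + k*(x*\<alpha>+y)*(k*z)) + k*(x*\<alpha>+y)*(k*z*(k*z)) = 0"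
  proof -
    obtain l where l: "l \<noteq> 0" "1 = l * (k*x*(k*x*(k*x)))" "1 = l * (k*z*(k*z*(k*z)))"
      "0 = l * ((k*x)*((k*x)*(k*(x*\<alpha>+y)) + k*(x*\<alpha>+y)*(k*z)) + k*(x*\<alpha>+y)*(k*z*(k*z)))"
      using prpk unfolding mat_M2 by (rule prp_M2E)
    have "l * (k*x*(k*x*(k*x))) = l * (k*z*(k*z*(k*z)))" using l(2,3) by (rule trans[OF sym])
    then show "k*x*(k*x*(k*x)) = k*z*(k*z*(k*z))" using l(1) by (simp only: mult_cancel_left) blast
    show "(k*x)*((k*x)*(k*(x*\<alpha>+y)) + k*(x*\<alpha>+y)*(k*z)) + k*(x*\<alpha>+y)*(k*z*(k*z)) = 0"
      using l(1,4) by (metis mult_eq_0_iff)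
  qed
  have "(k*k*k) * (x * (x * x)) = (k*k*k) * (z * (z * z))" using cb by (simp only: mult_ac)
  then have "x * (x * x) = z * (z * z)" using k(1) by simp
  then have "x = z" unfolding sq(1)[symmetric] using nz by simp
  then have y2: "2 * y = 0" using sq(2) nz by (simp add: algebra_simps)
  have "(k*k*k*x*x) * (3 * (x * \<alpha> + y)) = 0" using cb2 unfolding \<open>x = z\<close> by (simp add: algebra_simps)
  then have y3: "3 * (x * \<alpha> + y) = 0" using k(1) nz(1) by simp
  show False
  proof (cases "(2::'a) = 0")
    case True
    then have "(3::'a) = 1" by (metis add_0 numeral_Bit1 numeral_One one_add_one)
    then have "y = - x * \<alpha>" using y3 by (simp add: eq_neg_iff_add_eq_0 add.commute)
    moreover have "(- 1 :: 'a) = 1" using True by (metis add_eq_0_iff one_add_one)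
    ultimately have "y = x * \<alpha>" by (metis mult_minus1 mult_1 mult.assoc)
    then have "F weyl = mat x ** upper \<alpha>" unfolding W \<open>x = z\<close> by (simp add: mat_M2)
    then have "prp (upper \<alpha>) (F weyl)" using nz prp_smult by simp
    then have "prp (F (upper 1)) (F weyl)" using \<alpha> prp_sym prp_trans by blast
    then have "prp (F (upper 1) ** F (upper (- 1))) (F weyl ** F (upper (- 1)))" by (rule prp_mult[OF _ prp_refl])
    also have "prp (F weyl ** F (upper (- 1))) (F (weyl ** upper (- 1)))" by (intro F_mult) simp_all
    finally have "prp (F (upper 1) ** F (upper (- 1))) (F (weyl ** upper (- 1)))" .
    moreover have "prp (F (upper 1) ** F (upper (- 1))) (F (upper 1 ** upper (- 1)))" by (intro F_mult) simp_all
    moreover have "prp (F (upper 1 ** upper (- 1))) (mat 1)"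
      by (rule prp_sym) (use F_one[of "mat 1"] in \<open>simp add: mat_M2\<close>)
    ultimately have "prp (mat 1) (F (weyl ** upper (- 1)))" using prp_sym prp_trans by meson
    then show False using F_one[of "weyl ** upper (- 1)"] unfolding prp_one by (auto simp: mat_M2)
  next
    case False
    then have "y = 0" using y2 by simp
    then have "prp (mat 1) (F weyl)" unfolding W \<open>x = z\<close> prp_one using nz by (auto simp: mat_M2)
    then show False using F_one[of weyl] unfolding prp_one by (auto simp: mat_M2)
  qed
qed

text \<open>Three conjugations: g1 moves the fixed point of U to \<infinity>; g2 keeps \<infinity>
  and moves its image (x : z) under W to 0, which turns W into \<open>weyl\<close>; the diagonal g3
  removes the sign left in U.\<close>

lemma normal_form:
  obtains g \<alpha> where "det g \<noteq> 0" "\<And>a. prp (upper (\<alpha> a)) (inv2 g ** F (upper a) ** g)"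
    "prp weyl (inv2 g ** F weyl ** g)" "\<alpha> 1 = 1"
proof -
  obtain g1 where g1: "det g1 \<noteq> 0" "(inv2 g1 ** F (upper 1) ** g1)$2$1 = 0"
    using unipotent_eigenvector[of 1] by auto
  define F1 where "F1 = (\<lambda>S. inv2 g1 ** F S ** g1)"
  interpret F1: proj_rep F1 unfolding F1_def by (rule conj_rep[OF g1(1)])
  have u1: "(F1 (upper 1))$2$1 = 0" using g1(2) by (simp add: F1_def)
  obtain x y z w where W: "F1 weyl = M2 x y z w" by (rule M2_cases)
  have z: "z \<noteq> 0" using F1.weyl_not_upper[OF u1] W by simp
  have det: "x * w - y * z = 1" using F1.det_F[of weyl] W by simp
  have "prp (F1 weyl ** F1 weyl) (F1 (weyl ** weyl))" by (intro F1.F_mult) simp_all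
  also have "weyl ** weyl = mat (- 1)" by (simp add: mat_M2)
  also have "prp (F1 (mat (- 1))) (mat 1)" by (rule prp_sym[OF F1.F_neg_one])
  finally have "z * x + w * z = 0" unfolding W by (auto simp: mat_M2 prp_M2)
  then have "z * (x + w) = 0" by (simp add: algebra_simps)
  then have w: "w = - x" using z by (simp add: eq_neg_iff_add_eq_0 add.commute)
  define g2 where "g2 = M2 1 x 0 z"
  have g2: "det g2 \<noteq> 0" using z by (simp add: g2_def)
  define F2 where "F2 = (\<lambda>S. inv2 g2 ** F1 S ** g2)"
  interpret F2: proj_rep F2 unfolding F2_def by (rule F1.conj_rep[OF g2])
  have W2: "F2 weyl = weyl"
  proof -
    have "- (x * x + y * z) = 1" using det unfolding w by (simp only: mult_minus_right minus_add_distrib) simp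
    then have "x * x + y * z = - 1" by (metis minus_minus)
    then have "F1 weyl ** g2 = g2 ** weyl" unfolding W w g2_def by (simp add: mult.commute)
    then have "inv2 g2 ** (F1 weyl ** g2) = inv2 g2 ** (g2 ** weyl)" by simp
    then show ?thesis unfolding F2_def using g2 by (simp add: matrix_mul_assoc[symmetric])
  qed
  have u2: "(F2 (upper 1))$2$1 = 0"
  proof -
    obtain p q s where "F1 (upper 1) = M2 p q 0 s" using u1 M2_collapse by metis
    then show ?thesis by (simp add: F2_def g2_def inv2_def)
  qed
  define \<beta> where "\<beta> = (\<lambda>a. SOME b. prp (upper b) (F2 (upper a)))"
  have \<beta>: "prp (upper (\<beta> a)) (F2 (upper a))" for a
    unfolding \<beta>_def by (rule F2.upper_all[OF u2, of a]) (rule someI)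
  have "prp (mpow (F2 (weyl ** upper 1)) 3) (F2 (mpow (weyl ** upper 1) 3))" using F2.F_mpow[of "weyl ** upper 1"] by simp
  also have "mpow (weyl ** upper 1) 3 = mat (- 1 :: 'b)" by (simp add: numeral_3_eq_3 mat_M2)
  also have "prp (F2 (mat (- 1))) (mat 1)" by (rule prp_sym[OF F2.F_neg_one])
  finally have cub: "prp (mpow (F2 (weyl ** upper 1)) 3) (mat 1)" .
  have "prp (weyl ** upper (\<beta> 1)) (F2 weyl ** F2 (upper 1))" unfolding W2 by (intro prp_mult prp_refl \<beta>)
  also have "prp (F2 weyl ** F2 (upper 1)) (F2 (weyl ** upper 1))" by (intro F2.F_mult) simp_all
  finally have p: "prp (weyl ** upper (\<beta> 1)) (F2 (weyl ** upper 1))" .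
  have "prp (mpow (weyl ** upper (\<beta> 1)) 3) (mpow (F2 (weyl ** upper 1)) 3)"
    unfolding numeral_3_eq_3 mpow.simps by (intro prp_mult p prp_refl)
  then have "prp (mpow (weyl ** upper (\<beta> 1)) 3) (mat 1)" using cub by (rule prp_trans)
  \<comment> \<open>The cube of \<open>weyl\<close> times \<open>upper b\<close> is scalar only for
    b^2 = 1.\<close>
  then have "\<beta> 1 * \<beta> 1 = 1" by (auto simp: numeral_3_eq_3 mat_M2 prp_M2)
  then have b1: "\<beta> 1 = 1 \<or> \<beta> 1 = - 1" by (simp add: square_eq_1_iff)
  define g3 where "g3 = M2 1 0 0 (\<beta> 1)"
  have g3: "det g3 \<noteq> 0" using b1 by (auto simp: g3_def)
  define g where "g = g1 ** g2 ** g3"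
  have g: "det g \<noteq> 0" using g1(1) g2 g3 by (simp add: g_def det_mul)
  have conj: "inv2 g ** F S ** g = inv2 g3 ** F2 S ** g3" for S
    unfolding g_def F2_def F1_def using g1(1) g2 g3 by (simp add: inv2_mult det_mul matrix_mul_assoc)
  show thesis
  proof (rule that[OF g, of "\<lambda>a. \<beta> 1 * \<beta> a"])
    show "\<beta> 1 * \<beta> 1 = 1" by fact
    fix a
    have "inv2 g3 ** upper (\<beta> a) ** g3 = upper (\<beta> 1 * \<beta> a)" using b1 by (auto simp: g3_def inv2_def)
    then show "prp (upper (\<beta> 1 * \<beta> a)) (inv2 g ** F (upper a) ** g)"
      using prp_mult[OF prp_mult[OF prp_refl \<beta>[of a]] prp_refl, of "inv2 g3" g3] unfolding conj by simp
  next
    have "inv2 g3 ** weyl ** g3 = mat (\<beta> 1) ** weyl" using b1 by (auto simp: g3_def inv2_def mat_M2)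
    then show "prp weyl (inv2 g ** F weyl ** g)" unfolding conj W2 using b1 prp_smult[of "\<beta> 1" weyl] by auto
  qed
qed

end

locale normal_rep = proj_rep F for F :: "'b::finite_field ^ 2 ^ 2 \<Rightarrow> 'a::finite_field ^ 2 ^ 2" +
  fixes \<alpha> :: "'b \<Rightarrow> 'a"
  assumes F_upper: "prp (upper (\<alpha> a)) (F (upper a))"
    and F_weyl: "prp weyl (F weyl)"
    and \<alpha>_1: "\<alpha> 1 = 1"
begin

lemma \<alpha>_add: "\<alpha> (a + b) = \<alpha> a + \<alpha> b"
proof -
  have "prp (upper (\<alpha> b) ** upper (\<alpha> a)) (F (upper b) ** F (upper a))" by (intro prp_mult F_upper)
  also have "prp (F (upper b) ** F (upper a)) (F (upper b ** upper a))" by (intro F_mult) simp_all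
  also have "upper b ** upper a = upper (a + b)" by simp
  also have "prp (F (upper (a + b))) (upper (\<alpha> (a + b)))" by (rule prp_sym[OF F_upper])
  finally show ?thesis by (auto simp: prp_M2)
qed

lemma \<alpha>_0: "\<alpha> 0 = 0"
proof -
  have "\<alpha> 0 + \<alpha> 0 = \<alpha> 0 + 0" using \<alpha>_add[of 0 0] by (simp only: add_0_right)
  then show ?thesis by (simp only: add_left_cancel)
qed

lemma \<alpha>_uminus: "\<alpha> (- a) = - \<alpha> a"
  using \<alpha>_add[of a "- a"] by (simp add: \<alpha>_0 eq_neg_iff_add_eq_0 add.commute)

lemma \<alpha>_diff: "\<alpha> (a - b) = \<alpha> a - \<alpha> b"
  using \<alpha>_add[of a "- b"] by (simp add: \<alpha>_uminus)

text \<open>The diagonal matrix with entries \<open>c\<close> and \<open>1/c\<close> conjugates \<open>upper a\<close> to \<open>upper (c\<^sup>2a)\<close>.\<close>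

lemma \<alpha>_square_mult: "\<alpha> (c * c * a) = \<alpha> (c * c) * \<alpha> a"
proof (cases "c = 0")
  case False
  define D where "D = M2 c 0 0 (1 / c)"
  have D: "det D = 1" using False by (simp add: D_def)
  obtain y1 y2 y3 y4 where Y: "F D = M2 y1 y2 y3 y4" by (rule M2_cases)
  have detY: "y1 * y4 - y2 * y3 = 1" using det_F[OF D] Y by simp
  have rel: "prp (F D ** upper (\<alpha> a)) (upper (\<alpha> (c * c * a)) ** F D)" for a
  proof -
    have "prp (F D ** upper (\<alpha> a)) (F D ** F (upper a))" by (intro prp_mult F_upper prp_refl)
    also have "prp (F D ** F (upper a)) (F (D ** upper a))" by (intro F_mult D) simp
    also have "D ** upper a = upper (c * c * a) ** D" using False by (simp add: D_def)
    also have "prp (F (upper (c * c * a) ** D)) (F (upper (c * c * a)) ** F D)" by (rule prp_sym, intro F_mult D) simp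
    also have "prp (F (upper (c * c * a)) ** F D) (upper (\<alpha> (c * c * a)) ** F D)"
      by (intro prp_mult prp_refl prp_sym[OF F_upper])
    finally show ?thesis .
  qed
  have ent: "\<exists>k. k \<noteq> 0 \<and> y1 + \<alpha> (c * c * a) * y3 = k * y1 \<and> y2 + \<alpha> (c * c * a) * y4 = k * (y1 * \<alpha> a + y2) \<and>
      y3 = k * y3 \<and> y4 = k * (y3 * \<alpha> a + y4)" for a
    using rel[of a] unfolding Y by (auto simp: prp_M2)
  have y3: "y3 = 0"
  proof (rule ccontr)
    assume "y3 \<noteq> 0"
    then show False using ent[of 1] \<alpha>_1 by auto
  qed
  then have y: "y1 \<noteq> 0" "y4 \<noteq> 0" using detY by auto
  have eq: "\<alpha> (c * c * a) * y4 = y1 * \<alpha> a" for a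
  proof -
    obtain k where k: "y2 + \<alpha> (c * c * a) * y4 = k * (y1 * \<alpha> a + y2)" "y4 = k * (y3 * \<alpha> a + y4)"
      using ent[of a] by blast
    have "k = 1" using k(2) y y3 by simp
    then show ?thesis using k(1) by simp
  qed
  have "\<alpha> (c * c) * y4 = y1" using eq[of 1] by (simp add: \<alpha>_1)
  then have "\<alpha> (c * c * a) * y4 = \<alpha> (c * c) * \<alpha> a * y4" using eq[of a] by (simp add: mult_ac)
  then show ?thesis using y(2) by simp
qed (simp add: \<alpha>_0)

text \<open>Multiplicativity is known for square factors and \<alpha> is additive. In characteristic
  2 every s is a square; otherwise s = ((s+1)/2)^2 - ((s-1)/2)^2.\<close>

lemma \<alpha>_mult: "\<alpha> (s * a) = \<alpha> s * \<alpha> a"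
proof (cases "CHAR('b) = 2")
  case True
  have "surj (\<lambda>x::'b. x ^ (CHAR('b) ^ 1))"
    by (rule finite_UNIV_inj_surj[OF finite]) (simp only: inj_def fr_inj, blast)
  then obtain c where "s = c ^ (CHAR('b) ^ 1)" by (rule surjE)
  then have "s = c * c" unfolding True by (simp add: power2_eq_square)
  then show ?thesis using \<alpha>_square_mult by simp
next
  case False
  have two: "(2::'b) \<noteq> 0"
  proof
    assume "(2::'b) = 0"
    then have "of_nat 2 = (0::'b)" by simp
    then have "CHAR('b) dvd 2" by (simp only: of_nat_eq_0_iff_char_dvd)
    then show False using False primes_dvd_imp_eq[OF CHAR_prime two_is_prime_nat] by blast
  qed
  define x y where "x = (s + 1) / 2" and "y = (s - 1) / 2"
  have "x + y = s" "x - y = 1" using two by (simp_all add: x_def y_def add_divide_distrib[symmetric] diff_divide_distrib[symmetric])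
  moreover have "x * x - y * y = (x + y) * (x - y)" by (simp add: algebra_simps)
  ultimately have s: "s = x * x - y * y" by simp
  have "\<alpha> (s * a) = \<alpha> (x * x * a) - \<alpha> (y * y * a)" unfolding s left_diff_distrib \<alpha>_diff ..
  also have "\<dots> = \<alpha> s * \<alpha> a" unfolding \<alpha>_square_mult s \<alpha>_diff left_diff_distrib ..
  finally show ?thesis .
qed

lemma map_\<alpha>_mult: "map_matrix \<alpha> (A ** B) = map_matrix \<alpha> A ** map_matrix \<alpha> B" for A B :: "'b^2^2"
  by (rule M2_cases[of A]; rule M2_cases[of B]) (simp add: \<alpha>_add \<alpha>_mult)

lemma F_product:
  assumes "det S = 1" "det R = 1" "prp (map_matrix \<alpha> S) (F S)" "prp (map_matrix \<alpha> R) (F R)"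
  shows "prp (map_matrix \<alpha> (S ** R)) (F (S ** R))"
  unfolding map_\<alpha>_mult using prp_trans[OF prp_mult[OF assms(3,4)] F_mult[OF assms(1,2)]] .

text \<open>SL(2) is generated by \<open>weyl\<close> and the matrices \<open>upper a\<close>: a
  matrix with c \<noteq> 0 is a product upper, lower, upper, and for c = 0 one first multiplies by
  \<open>weyl\<close>.\<close>

lemma F_eq_map:
  assumes "det S = 1"
  shows "prp (map_matrix \<alpha> S) (F S)"
proof -
  have up: "prp (map_matrix \<alpha> (upper a)) (F (upper a))" for a using F_upper[of a] by (simp add: \<alpha>_0 \<alpha>_1)
  have we: "prp (map_matrix \<alpha> weyl) (F weyl)" using F_weyl by (simp add: \<alpha>_0 \<alpha>_1 \<alpha>_uminus)
  \<comment> \<open>The inverse of \<open>weyl\<close>, written as its cube so that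
    \<open>F_product\<close> applies.\<close>
  define wi where "wi = weyl ** (weyl ** (weyl :: 'b^2^2))"
  have wi: "det wi = 1" "prp (map_matrix \<alpha> wi) (F wi)"
    unfolding wi_def by (simp, intro F_product we) simp_all
  have low: "prp (map_matrix \<alpha> (M2 1 0 c 1)) (F (M2 1 0 c 1))" for c
  proof -
    have "prp (map_matrix \<alpha> ((weyl ** upper (- c)) ** wi)) (F ((weyl ** upper (- c)) ** wi))"
      by (intro F_product we up wi) simp_all
    then show ?thesis by (simp add: wi_def)
  qed
  have gen: "prp (map_matrix \<alpha> S) (F S)" if S: "S = M2 a b c d" "c \<noteq> 0" "a * d - b * c = 1" for S a b c d
  proof -
    have "S = (upper ((a - 1) / c) ** M2 1 0 c 1) ** upper ((d - 1) / c)"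
    proof -
      define x y where "x = (a - 1) / c" and "y = (d - 1) / c"
      have xc: "x * c = a - 1" and cy: "c * y = d - 1" using S(2) by (simp_all add: x_def y_def)
      have "b * c = (a * y + x) * c"
      proof -
        have "(a * y + x) * c = a * (c * y) + x * c" by (simp add: algebra_simps)
        also have "\<dots> = a * d - 1" unfolding xc cy by (simp add: algebra_simps)
        finally show ?thesis using S(3) by (simp add: algebra_simps)
      qed
      then have b: "b = a * y + x" using S(2) by simp
      show ?thesis unfolding x_def[symmetric] y_def[symmetric] S(1) M2_mult using xc cy b by simp
    qed
    moreover have "prp (map_matrix \<alpha> ((upper ((a - 1) / c) ** M2 1 0 c 1) ** upper ((d - 1) / c)))
        (F ((upper ((a - 1) / c) ** M2 1 0 c 1) ** upper ((d - 1) / c)))"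
      by (intro F_product up low) simp_all
    ultimately show ?thesis by simp
  qed
  obtain a b c d where S: "S = M2 a b c d" by (rule M2_cases)
  have det: "a * d - b * c = 1" using assms S by simp
  show ?thesis
  proof (cases "c = 0")
    case False
    then show ?thesis using gen[OF S _ det] by simp
  next
    case True
    then have "a \<noteq> 0" using det by auto
    have wS: "weyl ** S = M2 (- c) (- d) a b" unfolding S by simp
    have "prp (map_matrix \<alpha> (weyl ** S)) (F (weyl ** S))"
      by (rule gen[OF wS \<open>a \<noteq> 0\<close>]) (use det in \<open>simp add: algebra_simps\<close>)
    then have "prp (map_matrix \<alpha> (wi ** (weyl ** S))) (F (wi ** (weyl ** S)))"
      using assms by (intro F_product[OF wi(1) _ wi(2)]) (simp_all add: det_mul)
    moreover have "wi ** (weyl ** S) = S" by (simp add: wi_def S)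
    ultimately show ?thesis by simp
  qed
qed

end

theorem (in proj_rep) standard_form:
  obtains h \<alpha> where "det h \<noteq> 0" "\<And>x y. \<alpha> (x + y) = \<alpha> x + \<alpha> y" "\<And>x y. \<alpha> (x * y) = \<alpha> x * \<alpha> y" "\<alpha> 1 = 1"
    "\<And>S. det S = 1 \<Longrightarrow> prp (h ** map_matrix \<alpha> S ** inv2 h) (F S)"
proof -
  obtain g \<alpha> where g: "det g \<noteq> 0" "\<And>a. prp (upper (\<alpha> a)) (inv2 g ** F (upper a) ** g)"
    "prp weyl (inv2 g ** F weyl ** g)" "\<alpha> 1 = 1" by (rule normal_form) blast
  interpret R: proj_rep "\<lambda>S. inv2 g ** F S ** g" by (rule conj_rep[OF g(1)])
  interpret R: normal_rep "\<lambda>S. inv2 g ** F S ** g" \<alpha>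
    by unfold_locales (use g in auto)
  show thesis
  proof (rule that[OF g(1)])
    fix S :: "'b^2^2" assume "det S = 1"
    then have "prp (g ** map_matrix \<alpha> S ** inv2 g) (g ** (inv2 g ** F S ** g) ** inv2 g)"
      by (intro prp_mult prp_refl R.F_eq_map)
    also have "g ** (inv2 g ** F S ** g) ** inv2 g = F S" using g(1) by (simp add: matrix_mul_assoc[symmetric] inv2_right)
    finally show "prp (g ** map_matrix \<alpha> S ** inv2 g) (F S)" .
  qed (use R.\<alpha>_add R.\<alpha>_mult g in auto)
qed

section \<open>Translates, faithfulness, quadratic extensions and transitivity\<close>

context subfield
begin

lemma not_K_exists:
  assumes "r > 1"
  obtains b where "b \<notin> K"
proof -
  have "Q ^ 1 < Q ^ r" using Q_gt_1 assms by (rule power_strict_increasing[rotated])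
  then have "card K < CARD('a)" by (simp add: card_K CARD_Q)
  then have "K \<noteq> UNIV" by auto
  then show thesis using that by blast
qed

lemma upper_not_eqv:
  assumes "b \<notin> K"
  shows "\<not> eqv (mat 1) (M2 1 b 0 1)"
proof
  assume "eqv (mat 1) (M2 1 b 0 1)"
  then obtain c S where c: "c \<noteq> 0" "MK S" "det S \<noteq> 0" "M2 1 b 0 1 = mat c ** (mat 1 ** S)" unfolding eqv_def by blast
  obtain s1 s2 s3 s4 where S: "S = M2 s1 s2 s3 s4" by (rule M2_cases)
  have "1 = c * s4" "b = c * s2" using c(4) unfolding S by (simp_all add: mat_M2)
  then have "b = s2 / s4" by (metis mult_eq_0_iff nonzero_divide_eq_eq mult.commute mult.left_commute mult_1 zero_neq_one)
  then show False using assms c(2) by (simp add: S K_divide)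
qed

text \<open>Translations commute, so the conjugate by h of z \<mapsto> z + 1 stabilizes the image
  under h of every K + b.\<close>

lemma upper_stab:
  assumes "det h \<noteq> 0"
  shows "stab (h ** M2 1 1 0 1 ** inv2 h) 0 (h ** M2 1 b 0 1)"
proof -
  have K: "MK (M2 1 1 0 1)" "det (M2 1 1 0 (1::'a)) \<noteq> 0" by simp_all
  have "M2 1 1 0 1 ** M2 1 b 0 1 = M2 1 b 0 1 ** M2 1 1 0 1" by (simp add: add.commute)
  then have "(h ** M2 1 1 0 1 ** inv2 h) ** (h ** M2 1 b 0 1) = (h ** M2 1 b 0 1) ** M2 1 1 0 1"
    using assms by (simp add: matrix_mul_assoc[symmetric] add.commute)
  then show ?thesis unfolding stab_def frm_0 using eqv_K[OF K] by simp
qed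

text \<open>Faithfulness on sublines, which ensures that some base exists. It is enough to test K, K
  + b and a K with a and b outside \<open>K\<close>.\<close>

lemma stab_all_trivial:
  assumes r: "r > 1" and A: "det A \<noteq> 0" and stab: "\<And>h. det h \<noteq> 0 \<Longrightarrow> stab A i h"
  shows "trivial_pair A i"
proof -
  define fr where "fr = (\<lambda>x::'a. x ^ (CHAR('a) ^ i))"
  have fr_simps: "fr 0 = 0" "fr 1 = 1" "fr (x + y) = fr x + fr y" for x y by (simp_all add: fr_def fr_add)
  have "stab A i (mat 1)" by (rule stab) simp
  then obtain c S where c: "c \<noteq> 0" "MK S" "det S \<noteq> 0" "A = mat c ** S"
    unfolding stab_def eqv_def by auto
  obtain s1 s2 s3 s4 where S: "S = M2 s1 s2 s3 s4" by (rule M2_cases)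
  have sK: "s1 \<in> K" "s2 \<in> K" "s3 \<in> K" "s4 \<in> K" using c(2) unfolding S by auto
  \<comment> \<open>K and K + b meet only in \<infinity>, so \<infinity> is fixed.\<close>
  have s3_eq: "s3 = 0 \<and> (\<exists>k\<in>K. s1 * fr b + s2 = s4 * b + k)" if b: "b \<notin> K" for b
  proof -
    have "stab A i (M2 1 b 0 1)" by (rule stab) simp
    then obtain d R where d: "d \<noteq> 0" "MK R" "det R \<noteq> 0" "A ** frm i (M2 1 b 0 1) = mat d ** (M2 1 b 0 1 ** R)"
      unfolding stab_def eqv_def by blast
    obtain r1 r2 r3 r4 where R: "R = M2 r1 r2 r3 r4" by (rule M2_cases)
    have rK: "r1 \<in> K" "r2 \<in> K" "r3 \<in> K" "r4 \<in> K" using d(2) unfolding R by auto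
    have eqs: "c * s1 = d * (r1 + b * r3)" "c * s3 = d * r3"
      "c * s1 * fr b + c * s2 = d * (r2 + b * r4)" "c * s3 * fr b + c * s4 = d * r4"
      using d(4) unfolding c(4) S R mat_M2 frm_M2 M2_mult M2_eq_iff fr_def fr_zero mult_zero_left mult_zero_right
        add_0 add_0_right mult_1 mult_1_right power_one by blast+
    have r3: "r3 = 0"
    proof (rule ccontr)
      assume r3: "r3 \<noteq> 0"
      then have s3: "s3 \<noteq> 0" using eqs(2) d(1) by auto
      have "c * (s1 * r3) = (c * s1) * r3" by (simp only: mult.assoc)
      also have "\<dots> = (c * s3) * (r1 + b * r3)" unfolding eqs(1,2) by (simp only: mult_ac)
      finally have "s1 * r3 = s3 * (r1 + b * r3)" using c(1) by (simp add: mult.assoc)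
      then have "b = s1 / s3 - r1 / r3" using r3 s3 by (simp add: field_simps)
      then show False using b sK rK by (simp add: K_divide K_diff)
    qed
    then have s3: "s3 = 0" using eqs(2) c(1) by simp
    have nz: "s4 \<noteq> 0" "r4 \<noteq> 0" using c(3) d(3) unfolding S R s3 r3 by auto
    define e where "e = s4 / r4"
    have "c * s4 = d * r4" using eqs(4) s3 by simp
    then have de: "d = c * e" using nz by (simp add: e_def field_simps)
    have "c * (s1 * fr b + s2) = c * (s4 * b + e * r2)"
      using eqs(3) nz unfolding de by (simp add: e_def field_simps)
    then have "s1 * fr b + s2 = s4 * b + e * r2" using c(1) by simp
    moreover have "e * r2 \<in> K" using sK rK by (simp add: e_def K_divide K_mult)
    ultimately show ?thesis using s3 by blast
  qed
  obtain b0 where b0: "b0 \<notin> K" using not_K_exists[OF r] by blast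
  then have s3: "s3 = 0" using s3_eq by blast
  have nz: "s1 \<noteq> 0" "s4 \<noteq> 0" using c(3) unfolding S s3 by auto
  \<comment> \<open>K and a K meet only in 0 and \<infinity>, so 0 is fixed too.\<close>
  have s2_eq: "s2 = 0 \<and> (\<exists>k\<in>K. s1 * fr a = k * a)" if a: "a \<notin> K" for a
  proof -
    have a0: "a \<noteq> 0" using a by auto
    have "stab A i (M2 a 0 0 1)" by (rule stab) (use a0 in simp)
    then obtain d R where d: "d \<noteq> 0" "MK R" "det R \<noteq> 0" "A ** frm i (M2 a 0 0 1) = mat d ** (M2 a 0 0 1 ** R)"
      unfolding stab_def eqv_def by blast
    obtain r1 r2 r3 r4 where R: "R = M2 r1 r2 r3 r4" by (rule M2_cases)
    have rK: "r1 \<in> K" "r2 \<in> K" "r3 \<in> K" "r4 \<in> K" using d(2) unfolding R by auto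
    have eqs: "c * s1 * fr a = d * (a * r1)" "c * s2 = d * (a * r2)" "c * s4 = d * r4"
      using d(4) unfolding c(4) S R s3 mat_M2 by (simp_all add: fr_def)
    have r4: "r4 \<noteq> 0" using eqs(3) c(1) nz by auto
    define e where "e = s4 / r4"
    have e: "e \<in> K" "e \<noteq> 0" using sK rK nz r4 by (simp_all add: e_def K_divide)
    have de: "d = c * e" using eqs(3) r4 by (simp add: e_def field_simps)
    have "c * s2 = c * (e * (a * r2))" using eqs(2) unfolding de by (simp only: mult.assoc)
    then have s2: "s2 = e * (a * r2)" using c(1) by simp
    have "r2 = 0"
    proof (rule ccontr)
      assume "r2 \<noteq> 0"
      then have "a = s2 / (e * r2)" using s2 e by (simp add: field_simps)
      then show False using a sK rK e by (simp add: K_divide K_mult)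
    qed
    then have "s2 = 0" using s2 by simp
    moreover have "c * (s1 * fr a) = c * (e * r1 * a)" using eqs(1) unfolding de by (simp only: mult_ac)
    then have "s1 * fr a = (e * r1) * a" using c(1) by simp
    moreover have "e * r1 \<in> K" using e rK by (simp add: K_mult)
    ultimately show ?thesis by blast
  qed
  have s2: "s2 = 0" using s2_eq[OF b0] by blast
  \<comment> \<open>The subline K + b gives the image of b up to an element of \<open>K\<close>, the
    subline b K gives it up to a factor from \<open>K\<close>; as b is outside \<open>K\<close>, the
    factor must be s4.\<close>
  have semi: "s1 * fr b = s4 * b" if b: "b \<notin> K" for b
  proof -
    obtain k where k: "k \<in> K" "s1 * fr b = k * b" using s2_eq[OF b] by blast
    obtain l where l: "l \<in> K" "s1 * fr b = s4 * b + l" using s3_eq[OF b] s2 by auto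
    have "(k - s4) * b = l" using k(2) l(2) by (simp add: algebra_simps)
    have "k = s4"
    proof (rule ccontr)
      assume "k \<noteq> s4"
      then have "b = l / (k - s4)" using \<open>(k - s4) * b = l\<close> by (simp add: field_simps)
      then show False using b k l sK by (simp add: K_divide K_diff)
    qed
    then show ?thesis using k by simp
  qed
  \<comment> \<open>An element of \<open>K\<close> is a difference of two elements outside
    \<open>K\<close>.\<close>
  have semiK: "s1 * fr x = s4 * x" if x: "x \<in> K" for x
  proof -
    have "x + b0 \<notin> K" using K_diff[of "x + b0" x] x b0 by auto
    then have "s1 * fr (x + b0) = s4 * (x + b0)" by (rule semi)
    then show ?thesis using semi[OF b0] unfolding fr_simps by (simp add: distrib_left)
  qed
  have s14: "s1 = s4" using semiK[OF K_one] by (simp add: fr_simps)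
  have fr: "fr x = x" for x
  proof -
    have "s1 * fr x = s1 * x" using semi[of x] semiK[of x] s14 by blast
    then show ?thesis using nz by simp
  qed
  have "A = mat (c * s1)" unfolding c(4) S s2 s3 s14 by (simp add: mat_M2)
  then show ?thesis using c(1) nz(1) fr unfolding fr_def by (metis mult_eq_0_iff)
qed

text \<open>For a quadratic extension with conjugation \<open>x \<mapsto> x\<^sup>Q\<close>, the matrix \<open>h = g\<^sup>Q g\<^sup>-\<^sup>1\<close> satisfies
  \<open>h h\<^sup>Q = 1\<close>, and a matrix over \<open>K\<close> that commutes with \<open>h\<close> stays over \<open>K\<close> when conjugated by \<open>g\<close>.
  Such matrices are \<open>\<omega> h + (\<omega> h)\<^sup>Q + x\<close>.\<close>

lemma quadratic_commuting:
  assumes r: "r = 2" and Q: "Q > 2" and h: "h ** frm m h = mat 1"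
  obtains S where "MK S" "det S \<noteq> 0" "\<nexists>c. S = mat c" "S ** h = h ** S"
proof (cases "\<exists>c. h = mat c")
  case True
  then obtain c where "h = mat c" by blast
  then have "M2 1 1 0 1 ** h = h ** M2 1 1 0 1" by (simp only: mat_comm)
  moreover have "\<nexists>c. M2 1 1 0 1 = (mat c :: 'a^2^2)" by (simp add: mat_M2)
  ultimately show thesis using that[of "M2 1 1 0 1"] by simp
next
  case False
  have QQ: "(x ^ Q) ^ Q = x" for x :: 'a
    using finite_field_power_card_eq_same[of x] unfolding CARD_Q r by (simp add: power_mult power2_eq_square)
  have bar_add: "(x + y) ^ Q = x ^ Q + y ^ Q" for x y :: 'a unfolding Q_def by (rule fr_add)
  obtain a b c e where hd: "h = M2 a b c e" by (rule M2_cases)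
  have hbar: "frm m h = M2 (a ^ Q) (b ^ Q) (c ^ Q) (e ^ Q)" by (simp add: hd Q_def)
  have "det h * det (frm m h) = 1" using arg_cong[OF h, of det] by (simp add: det_mul)
  then have d: "det h \<noteq> 0" by auto
  define D where "D = det h"
  have D0: "D \<noteq> 0" using d by (simp add: D_def)
  have bar: "frm m h = inv2 h" using arg_cong[OF h, of "\<lambda>x. inv2 h ** x"] d by simp
  then have bars: "a ^ Q = e / D" "b ^ Q = - b / D" "c ^ Q = - c / D" "e ^ Q = a / D"
    unfolding hbar by (simp_all add: inv2_def hd D_def)
  \<comment> \<open>\<omega> - \<omega>^Q / D will be the coefficient of h in S and must not vanish:
    1 works unless D = 1, and then any element outside \<open>K\<close> does.\<close>
  obtain \<omega> where \<omega>: "\<omega> - \<omega> ^ Q / D \<noteq> 0"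
  proof (cases "D = 1")
    case False
    then have "1 - 1 ^ Q / D \<noteq> 0" by (simp add: field_simps)
    then show thesis by (rule that)
  next
    case True
    obtain w where "w \<notin> K" using not_K_exists r by auto
    then have "w - w ^ Q / D \<noteq> 0" using True by (simp add: K_iff)
    then show thesis by (rule that)
  qed
  define \<kappa> where "\<kappa> = \<omega> - \<omega> ^ Q / D"
  \<comment> \<open>As h^Q is the inverse of h, that is (tr h - h) / D, the matrix \<omega> h +
    (\<omega> h)^Q is \<kappa> h plus a scalar. It therefore commutes with h, and it is fixed by x
    \<mapsto> x^Q.\<close>
  define p q s t where "p = \<omega> * a + \<omega> ^ Q * a ^ Q" and "q = \<omega> * b + \<omega> ^ Q * b ^ Q"
    and "s = \<omega> * c + \<omega> ^ Q * c ^ Q" and "t = \<omega> * e + \<omega> ^ Q * e ^ Q"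
  have pK: "p \<in> K" "q \<in> K" "s \<in> K" "t \<in> K"
    unfolding p_def q_def s_def t_def K_iff bar_add power_mult_distrib QQ by (simp_all only: add.commute)
  have off: "q = \<kappa> * b" "s = \<kappa> * c" "p - t = \<kappa> * (a - e)"
    unfolding p_def q_def s_def t_def bars \<kappa>_def by (simp_all add: algebra_simps diff_divide_distrib add_divide_distrib)
  \<comment> \<open>Adding a scalar x from \<open>K\<close> keeps both properties; the determinant
    vanishes for at most two x, and \<open>K\<close> has more than two elements.\<close>
  have "card {x. poly [:p * t - q * s, p + t, 1:] x = 0} \<le> degree [:p * t - q * s, p + t, 1:]"
    by (rule card_poly_roots_bound) simp
  then have "card {x. poly [:p * t - q * s, p + t, 1:] x = 0} < card K" using Q by (simp add: card_K)
  then have "\<not> K \<subseteq> {x. poly [:p * t - q * s, p + t, 1:] x = 0}" by (metis card_mono finite not_le)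
  then obtain x where x: "x \<in> K" "poly [:p * t - q * s, p + t, 1:] x \<noteq> 0" by blast
  define S where "S = M2 (p + x) q s (t + x)"
  have "MK S" using pK x by (simp add: S_def K_add)
  moreover have "det S \<noteq> 0" using x(2) by (simp add: S_def algebra_simps)
  moreover have "\<nexists>k. S = mat k"
  proof
    assume "\<exists>k. S = mat k"
    then have "q = 0" "s = 0" "p - t = 0" by (auto simp: S_def mat_M2)
    then have "b = 0" "c = 0" "a = e" using off \<omega> unfolding \<kappa>_def[symmetric] by simp_all
    then show False using False hd by (simp add: mat_M2)
  qed
  moreover have "S ** h = h ** S"
  proof -
    have 1: "p * b + q * e = a * q + b * t"
    proof -
      have "p * b + q * e - (a * q + b * t) = b * (p - t) + q * (e - a)" by (simp add: algebra_simps)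
      also have "\<dots> = 0" unfolding off by (simp add: algebra_simps)
      finally show ?thesis by simp
    qed
    have 2: "s * a + t * c = c * p + e * s"
    proof -
      have "s * a + t * c - (c * p + e * s) = s * (a - e) - c * (p - t)" by (simp add: algebra_simps)
      also have "\<dots> = 0" unfolding off by (simp add: algebra_simps)
      finally show ?thesis by simp
    qed
    have 3: "q * c = b * s" unfolding off by (simp add: algebra_simps)
    show ?thesis unfolding S_def hd M2_mult M2_eq_iff using 1 2 3 by (simp add: algebra_simps)
  qed
  ultimately show thesis by (rule that)
qed

text \<open>For S over \<open>K\<close>, the conjugate of S by h1 stabilizes \<open>h1 L\<close>,
  and also \<open>h2 L\<close> as soon as the conjugate R of S in the other frame is over
  \<open>K\<close>. Commuting with g^Q g^-1 says exactly that R is fixed by x \<mapsto> x^Q.\<close>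

lemma quadratic_common_stabilizer:
  assumes r: "r = 2" and Q: "Q > 2" and h: "det h1 \<noteq> 0" "det h2 \<noteq> 0"
  obtains A where "det A \<noteq> 0" "\<nexists>c. A = mat c" "stab A 0 h1" "stab A 0 h2"
proof -
  define g where "g = inv2 h1 ** h2"
  have g: "det g \<noteq> 0" using h det_inv2_nz by (simp add: g_def det_mul)
  have bar2: "frm m (frm m X) = X" for X :: "'a^2^2"
  proof -
    have "x ^ CHAR('a) ^ (m + m) = x" for x :: 'a
      using finite_field_power_card_eq_same[of x] unfolding card_field r by (simp add: mult_2_right)
    then show ?thesis unfolding frm_frm by (rule_tac M2_cases[of X]) simp
  qed
  define h where "h = frm m g ** inv2 g"
  have "h ** frm m h = frm m g ** (inv2 g ** g) ** frm m (inv2 g)"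
    unfolding h_def frm_mult bar2 by (simp only: matrix_mul_assoc)
  also have "\<dots> = frm m (g ** inv2 g)" using g by (simp add: inv2_left frm_mult)
  also have "\<dots> = mat 1" using g by (simp add: inv2_right)
  finally obtain S where S: "MK S" "det S \<noteq> 0" "\<nexists>c. S = mat c" "S ** h = h ** S"
    by (rule quadratic_commuting[OF r Q])
  define R where "R = inv2 g ** S ** g"
  have barS: "frm m S = S"
    using S(1) by (rule_tac M2_cases[of S]) (simp add: K_iff Q_def)
  have "frm m g ** frm m R = frm m (S ** g)" using g by (simp add: R_def frm_mult[symmetric] matrix_mul_assoc[symmetric])
  also have "\<dots> = S ** h ** g" using g by (simp add: frm_mult barS h_def matrix_mul_assoc[symmetric] inv2_left)
  also have "\<dots> = frm m g ** R" unfolding S(4) by (simp add: h_def R_def matrix_mul_assoc)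
  finally have "inv2 (frm m g) ** (frm m g ** frm m R) = inv2 (frm m g) ** (frm m g ** R)" by simp
  then have "frm m R = R" using g by simp
  then have RK: "MK R" by (rule_tac M2_cases[of R]) (simp add: K_iff Q_def)
  have detR: "det R \<noteq> 0" using S(2) g det_inv2_nz by (simp add: R_def det_mul)
  define A where "A = h1 ** S ** inv2 h1"
  have A1: "A ** h1 = h1 ** S" using h by (simp add: A_def)
  have A2: "A ** h2 = h2 ** R"
  proof -
    have "h2 = h1 ** g" using h by (simp add: g_def)
    then have "A ** h2 = h1 ** (S ** g)" using h by (simp add: A_def matrix_mul_assoc[symmetric])
    also have "S ** g = g ** R" using g by (simp add: R_def matrix_mul_assoc[symmetric])
    finally show ?thesis using \<open>h2 = h1 ** g\<close> by (simp add: matrix_mul_assoc)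
  qed
  show thesis
  proof (rule that)
    show "det A \<noteq> 0" using h S det_inv2_nz by (simp add: A_def det_mul)
    show "stab A 0 h1" unfolding stab_def frm_0 A1 using S by (intro eqv_K) auto
    show "stab A 0 h2" unfolding stab_def frm_0 A2 using RK detR by (rule eqv_K)
    show "\<nexists>c. A = mat c"
    proof
      assume "\<exists>c. A = mat c"
      then obtain c where "A = mat c" by blast
      then have "h1 ** S = h1 ** mat c" using A1 by (simp add: mat_comm)
      then have "inv2 h1 ** (h1 ** S) = inv2 h1 ** (h1 ** mat c)" by simp
      then have "S = mat c" using h by simp
      then show False using S(3) by blast
    qed
  qed
qed

text \<open>Write the quotient of the determinants as c^2 s with s in \<open>K\<close>: c is
  absorbed by a scalar and s by a right factor over \<open>K\<close>. Hence \<open>T\<close> is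
  transitive on sublines.\<close>

lemma exists_translate:
  assumes "CHAR('a) = 2 \<or> odd r" "det h \<noteq> 0" "det h' \<noteq> 0"
  obtains A where "det A = 1" "eqv h' (A ** h)"
proof -
  have "det h' / det h \<noteq> 0" using assms by simp
  then obtain c s where cs: "c \<noteq> 0" "s \<in> K" "s \<noteq> 0" "det h' / det h = c * c * s"
    using square_times_K[OF assms(1)] by blast
  define S where "S = M2 1 0 0 (1 / s)"
  have S: "MK S" "det S \<noteq> 0" using cs by (simp_all add: S_def K_divide)
  define A where "A = mat (1 / c) ** (h' ** S) ** inv2 h"
  have "det A * det h = (1 / c) * (1 / c) * (det h' * (1 / s))"
    using det_inv2[OF assms(2)] by (simp add: A_def det_mul S_def)
  also have "det h' = c * c * s * det h" using cs(4) assms(2) by (simp add: field_simps)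
  finally have "det A = 1" using cs assms(2) by simp
  moreover have "A ** h = mat (1 / c) ** (h' ** S)" using assms(2) by (simp add: A_def)
  then have "eqv h' (A ** h)" unfolding eqv_def using S cs by (intro exI[of _ "1 / c"] exI[of _ S]) simp
  ultimately show thesis by (rule that)
qed

end

section \<open>Saxl graphs\<close>

text \<open>The common neighbour gives a walk of length 2 between distinct vertices, while every
  walk joining the nonadjacent pair has at least two arcs.\<close>

lemma saxl_graph_diameter_2:
  assumes fin: "finite E"
    and common: "\<And>u v. u \<in> E \<Longrightarrow> v \<in> E \<Longrightarrow> u \<noteq> v \<Longrightarrow>
      \<exists>w\<in>E. w \<noteq> u \<and> w \<noteq> v \<and> is_base G E \<phi> {u, w} \<and> is_base G E \<phi> {v, w}"
    and nonadj: "u0 \<in> E" "v0 \<in> E" "u0 \<noteq> v0" "\<not> is_base G E \<phi> {u0, v0}"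
  shows "graph_diameter (saxl_graph G E \<phi>) = 2"
proof -
  let ?S = "saxl_graph G E \<phi>"
  interpret graph ?S by (rule graph_saxl_graph[OF fin])
  have verts: "verts ?S = E" by (simp add: saxl_graph_def)
  have cost: "awalk_cost (\<lambda>_. 1) p = real (length p)" for p :: "('a \<times> 'a) list"
    by (induction p) (auto simp: awalk_cost_def)
  have le: "\<mu> (\<lambda>_. 1) u v \<le> 2" if uv: "u \<in> E" "v \<in> E" for u v
  proof (cases "u = v")
    case True
    have "awalk u [] v" using uv True by (simp add: awalk_def verts)
    then have "\<mu> (\<lambda>_. 1) u v \<le> ereal (awalk_cost (\<lambda>_. 1) [])" by (rule min_cost_le_walk_cost)
    also have "\<dots> \<le> 2" by (simp add: cost)
    finally show ?thesis .
  next
    case False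
    obtain w where w: "w \<in> E" "w \<noteq> u" "w \<noteq> v" "is_base G E \<phi> {u, w}" "is_base G E \<phi> {v, w}"
      using common[OF uv False] by blast
    have "(u, w) \<in> arcs ?S" using uv w by (simp add: saxl_graph_def)
    moreover have "(w, v) \<in> arcs ?S" using uv w by (simp add: saxl_graph_def insert_commute)
    moreover have "tail ?S = fst" "head ?S = snd" by (simp_all add: saxl_graph_def)
    ultimately have "awalk u [(u, w), (w, v)] v" using uv by (simp add: awalk_def verts)
    then have "\<mu> (\<lambda>_. 1) u v \<le> ereal (awalk_cost (\<lambda>_. 1) [(u, w), (w, v)])" by (rule min_cost_le_walk_cost)
    also have "\<dots> \<le> 2" by (simp add: cost)
    finally show ?thesis .
  qed
  have ge: "2 \<le> \<mu> (\<lambda>_. 1) u0 v0"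
    unfolding \<mu>_def
  proof (rule INF_greatest)
    fix p assume "p \<in> {p. awalk u0 p v0}"
    then have p: "set p \<subseteq> arcs ?S" "cas u0 p v0" by (auto simp: awalk_def)
    have "2 \<le> length p"
    proof (cases p)
      case Nil
      then show ?thesis using p(2) nonadj(3) by simp
    next
      case (Cons e q)
      show ?thesis
      proof (cases q)
        case Nil
        then have "e \<in> arcs ?S" "tail ?S e = u0" "head ?S e = v0" using p Cons by auto
        then have "is_base G E \<phi> {u0, v0}" by (auto simp: saxl_graph_def)
        then show ?thesis using nonadj(4) by simp
      next
        case Cons': (Cons e' q')
        then show ?thesis using Cons by simp
      qed
    qed
    then show "2 \<le> ereal (awalk_cost (\<lambda>_. 1) p)" by (simp add: cost)
  qed
  show ?thesis unfolding graph_diameter_def verts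
  proof (rule antisym)
    show "(SUP u\<in>E. SUP v\<in>E. \<mu> (\<lambda>_. 1) u v) \<le> 2" by (intro SUP_least le)
    have "2 \<le> \<mu> (\<lambda>_. 1) u0 v0" by (rule ge)
    also have "\<dots> \<le> (SUP v\<in>E. \<mu> (\<lambda>_. 1) u0 v)" using nonadj(2) by (rule SUP_upper)
    also have "\<dots> \<le> (SUP u\<in>E. SUP v\<in>E. \<mu> (\<lambda>_. 1) u v)"
      using nonadj(1) by (rule SUP_upper)
    finally show "2 \<le> (SUP u\<in>E. SUP v\<in>E. \<mu> (\<lambda>_. 1) u v)" .
  qed
qed

lemma not_is_base:
  assumes "g \<in> carrier G" "g \<noteq> \<one>\<^bsub>G\<^esub>" "\<And>x. x \<in> B \<Longrightarrow> \<phi> g x = x"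
  shows "\<not> is_base G E \<phi> B"
proof
  assume "is_base G E \<phi> B"
  moreover have "g \<in> carrier G \<inter> (\<Inter>x\<in>B. stabilizer G \<phi> x)" using assms by (auto simp: stabilizer_def)
  ultimately show False using assms(2) by (auto simp: is_base_def)
qed

lemma (in group) rcoset_eq_iff:
  assumes "subgroup H G" "a \<in> carrier G" "b \<in> carrier G"
  shows "H #> a = H #> b \<longleftrightarrow> a \<otimes> inv b \<in> H"
proof
  assume "H #> a = H #> b"
  then have "a \<in> H #> b" using rcos_self[OF assms(2,1)] by simp
  then show "a \<otimes> inv b \<in> H" using subgroup.rcos_module_imp[OF assms(1) is_group assms(3)] by blast
next
  assume "a \<otimes> inv b \<in> H"
  then have "a \<in> H #> b" using subgroup.rcos_module_rev[OF assms(1) is_group assms(3,2)] by blast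
  then show "H #> a = H #> b" using repr_independence[OF _ assms(3,1)] by simp
qed

text \<open>Equal elements may have different exponents i and j; their automorphisms still agree on
  the coset of h, so the action on sublines is well defined.\<close>

lemma gam_act:
  fixes h :: "'a::finite_field^2^2"
  assumes "gam A i = gam B j" "det A \<noteq> 0" "det B \<noteq> 0" "det h \<noteq> 0"
  shows "prp (A ** frm i h) (B ** frm j h)"
proof -
  have "prp A B" using assms(1) by (simp add: gam_def prp_cos2)
  moreover have "frob_pow i (cos2 h) = frob_pow j (cos2 h)" using assms(1) by (simp add: gam_def)
  then have "prp (frm i h) (frm j h)" using assms(4) by (simp add: frob_pow_cos2 prp_cos2)
  ultimately show ?thesis by (rule prp_mult)
qed

lemma frm_inv2: "det h \<noteq> 0 \<Longrightarrow> frm i (inv2 h) = inv2 (frm i h)" for h :: "'a::finite_field^2^2"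
proof -
  assume h: "det h \<noteq> 0"
  have "frm i (inv2 h) = frm i (inv2 h) ** frm i h ** inv2 (frm i h)" using h by simp
  also have "frm i (inv2 h) ** frm i h = mat 1" unfolding frm_mult[symmetric] using h by (simp add: inv2_left)
  finally show ?thesis by simp
qed

lemma (in subfield) prp_eqv: "prp h h' \<Longrightarrow> eqv h h'"
  unfolding prp_def using eqv_smult by blast

section \<open>The action of G on sublines\<close>

locale subfield_action = subfield m r K for m r :: nat and K :: "'a::finite_field set" +
  fixes G M :: "(('a ^ 2 ^ 2) set \<times> (('a ^ 2 ^ 2) set \<Rightarrow> ('a ^ 2 ^ 2) set)) set" and h0 :: "'a ^ 2 ^ 2"
  assumes G_subgroup: "subgroup G PGammaL2" and T_G: "PSL2_in_PGammaL2 \<subseteq> G"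
    and M_max: "maximal_subgroup M (PGammaL2\<lparr>carrier := G\<rparr>)"
    and h0: "det h0 \<noteq> 0"
    and M_T: "M \<inter> PSL2_in_PGammaL2 = {gam (h0 ** S ** inv2 h0) 0 | S. MK S \<and> det S = 1}"
    and r_gt_1: "r > 1" and r_cases: "CHAR('a) = 2 \<or> odd r"
begin

abbreviation GG where "GG \<equiv> PGammaL2\<lparr>carrier := G\<rparr>"

sublocale P: group "PGammaL2 :: (('a ^ 2 ^ 2) set \<times> (('a ^ 2 ^ 2) set \<Rightarrow> ('a ^ 2 ^ 2) set)) monoid"
  by (rule group_PGammaL2)

sublocale GG: group GG
  by (rule P.subgroup_imp_group[OF G_subgroup])

lemma G_carrier: "G \<subseteq> carrier PGammaL2"
  using G_subgroup by (rule subgroup.subset)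

lemma G_cases:
  assumes "g \<in> G"
  obtains A i where "det A \<noteq> 0" "g = gam A i"
  using assms G_carrier unfolding carrier_PGammaL2 by blast

lemma M_subgroup: "subgroup M GG" and M_G: "M \<subseteq> G"
  using M_max subgroup.subset[of M GG] by (auto simp: maximal_subgroup_def)

lemma T_in_G: "det A = 1 \<Longrightarrow> gam A 0 \<in> G"
  using T_G by (auto simp: PSL2_in_PGammaL2_alt)

lemma stab_gam:
  assumes "gam A i = gam B j" "det A \<noteq> 0" "det B \<noteq> 0" "det h \<noteq> 0"
  shows "stab A i h \<longleftrightarrow> stab B j h"
proof -
  have "eqv (A ** frm i h) (B ** frm j h)" using gam_act[OF assms] by (rule prp_eqv)
  then show ?thesis unfolding stab_def by (meson eqv_sym eqv_trans)
qed

text \<open>\<open>M\<close> normalizes \<open>M\<close> \<inter> \<open>T\<close>, because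
  conjugation keeps determinant 1. In the frame h0 the element becomes a matrix B normalizing
  PSL(2,K) up to a Frobenius power, and \<open>normalizer_K\<close> applies.\<close>

lemma M_imp_stab:
  assumes g: "gam A i \<in> M" and A: "det A \<noteq> 0"
  shows "stab A i h0"
proof -
  define B where "B = inv2 h0 ** A ** frm i h0"
  have B: "det B \<noteq> 0" using A h0 det_inv2_nz by (simp add: B_def det_mul)
  have "eqv (mat 1) B"
  proof (rule normalizer_K[OF B])
    fix S assume S: "MK S" "det S = 1"
    \<comment> \<open>The Frobenius power of the element twists S0 into S; since it preserves
      \<open>K\<close> and determinant 1, any S can be reached.\<close>
    obtain S0 where S0: "frm i S0 = S" using frm_surj by blast
    then have S0K: "MK S0" "det S0 = 1" using S MK_frm_iff[of i S0] det_frm[of i S0] fr_inj[of "det S0" i 1] by auto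
    define X where "X = h0 ** S0 ** inv2 h0"
    have detX: "det X = 1" using S0K det_inv2[OF h0] by (simp add: X_def det_mul mult.commute)
    have XM: "gam X 0 \<in> M" using M_T S0K unfolding X_def by blast
    define Y where "Y = A ** frm i X ** inv2 A"
    have detY: "det Y = 1" using detX det_inv2[OF A] by (simp add: Y_def det_mul det_frm mult.commute)
    have YA: "Y ** A = A ** frm i X" using A by (simp add: Y_def)
    have "gam Y 0 \<otimes>\<^bsub>PGammaL2\<^esub> gam A i = gam A i \<otimes>\<^bsub>PGammaL2\<^esub> gam X 0"
      using A detX detY by (simp add: YA)
    then have "gam Y 0 \<otimes>\<^bsub>GG\<^esub> gam A i = gam A i \<otimes>\<^bsub>GG\<^esub> gam X 0" by simp
    then have "gam Y 0 = gam A i \<otimes>\<^bsub>GG\<^esub> gam X 0 \<otimes>\<^bsub>GG\<^esub> inv\<^bsub>GG\<^esub> gam A i"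
      using GG.inv_solve_right[of "gam Y 0" "gam A i \<otimes>\<^bsub>GG\<^esub> gam X 0" "gam A i"] g XM M_G T_in_G[OF detY]
        GG.m_closed[of "gam A i" "gam X 0"] by auto
    also have "\<dots> \<in> M" using g XM M_subgroup by (intro subgroup.m_closed subgroup.m_inv_closed) auto
    finally have "gam Y 0 \<in> M \<inter> PSL2_in_PGammaL2" using detY by (auto simp: PSL2_in_PGammaL2_alt)
    then obtain R where R: "MK R" "det R = 1" "gam Y 0 = gam (h0 ** R ** inv2 h0) 0" unfolding M_T by blast
    obtain c where c: "c \<noteq> 0" "Y = mat c ** (h0 ** R ** inv2 h0)"
      using gam_eq_iff[of "h0 ** R ** inv2 h0" 0 Y] R(3) by auto
    have "B ** S = inv2 h0 ** (A ** frm i X) ** frm i h0"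
      using h0 by (simp add: B_def X_def frm_mult frm_inv2 S0 matrix_mul_assoc[symmetric] inv2_left)
    also have "\<dots> = inv2 h0 ** (mat c ** (h0 ** R ** inv2 h0) ** A) ** frm i h0" unfolding YA[symmetric] c(2) ..
    also have "\<dots> = mat c ** (R ** B)"
      using h0 by (simp add: B_def matrix_mul_assoc[symmetric] mat_left_commute)
    finally show "\<exists>c R. c \<noteq> 0 \<and> MK R \<and> det R = 1 \<and> B ** S = mat c ** (R ** B)" using c R by blast
  qed
  then have "eqv (h0 ** mat 1) (h0 ** B)" by (rule eqv_mult)
  then show ?thesis using h0 by (simp add: stab_def B_def matrix_mul_assoc[symmetric])
qed

definition NM where "NM = {gam A i | A i. det A \<noteq> 0 \<and> gam A i \<in> G \<and> stab A i h0}"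

lemma NM_iff:
  assumes "gam A i \<in> G" "det A \<noteq> 0"
  shows "gam A i \<in> NM \<longleftrightarrow> stab A i h0"
proof
  assume "gam A i \<in> NM"
  then obtain B j where "gam A i = gam B j" "det B \<noteq> 0" "stab B j h0" unfolding NM_def by blast
  then show "stab A i h0" using stab_gam[of A i B j h0] assms h0 by simp
qed (use assms in \<open>auto simp: NM_def\<close>)

lemma NM_subgroup: "subgroup NM GG"
proof (rule GG.subgroupI)
  show "NM \<subseteq> carrier GG" by (auto simp: NM_def)
  have "gam (mat 1) 0 \<in> NM" unfolding NM_def using T_in_G[of "mat 1"] by (auto simp: stab_def intro!: exI[of _ "mat 1"])
  then show "NM \<noteq> {}" by auto
next
  fix g assume "g \<in> NM"
  then obtain A i where A: "g = gam A i" "det A \<noteq> 0" "g \<in> G" "stab A i h0" unfolding NM_def by blast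
  have "inv\<^bsub>GG\<^esub> g \<in> G" using GG.inv_closed[of g] A by simp
  then obtain B j where B: "det B \<noteq> 0" "inv\<^bsub>GG\<^esub> g = gam B j" by (rule G_cases)
  have "gam B j \<otimes>\<^bsub>GG\<^esub> gam A i = \<one>\<^bsub>GG\<^esub>" using GG.l_inv[of g] A B by simp
  then have "gam (B ** frm j A) (j + i) = gam (mat 1) 0" using A B by (simp add: one_PGammaL2)
  then have "prp (B ** frm j A ** frm (j + i) h0) (mat 1 ** frm 0 h0)"
    by (rule gam_act) (use A B h0 in \<open>simp_all add: det_mul\<close>)
  then have "eqv (B ** frm j (A ** frm i h0)) h0"
    using prp_eqv by (simp add: frm_mult frm_frm matrix_mul_assoc)
  moreover have "eqv (B ** frm j h0) (B ** frm j (A ** frm i h0))"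
    using A(4) eqv_act_iff[OF B(1)] unfolding stab_def by blast
  ultimately have "stab B j h0" unfolding stab_def using eqv_sym eqv_trans by blast
  then show "inv\<^bsub>GG\<^esub> g \<in> NM" using B \<open>inv\<^bsub>GG\<^esub> g \<in> G\<close> unfolding NM_def by auto
next
  fix g g' assume "g \<in> NM" "g' \<in> NM"
  then obtain A i B j where A: "g = gam A i" "det A \<noteq> 0" "g \<in> G" "stab A i h0"
    and B: "g' = gam B j" "det B \<noteq> 0" "g' \<in> G" "stab B j h0" unfolding NM_def by blast
  have "eqv (A ** frm i h0) (A ** frm i (B ** frm j h0))"
    using B(4) eqv_act_iff[OF A(2)] unfolding stab_def by blast
  with A(4) have "eqv h0 (A ** frm i (B ** frm j h0))" unfolding stab_def by (rule eqv_trans)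
  then have "stab (A ** frm i B) (i + j) h0" by (simp add: stab_def frm_mult frm_frm matrix_mul_assoc)
  moreover have "g \<otimes>\<^bsub>GG\<^esub> g' = gam (A ** frm i B) (i + j)" using A B by simp
  moreover have "g \<otimes>\<^bsub>GG\<^esub> g' \<in> G" using GG.m_closed[of g g'] A B by simp
  ultimately show "g \<otimes>\<^bsub>GG\<^esub> g' \<in> NM" using A B unfolding NM_def
    by (intro CollectI exI[of _ "A ** frm i B"] exI[of _ "i + j"]) (simp add: det_mul)
qed

text \<open>Maximality leaves only \<open>M\<close> and \<open>G\<close> for the stabilizer of the
  subline, and it is not \<open>G\<close>: a conjugate of z \<mapsto> z + b with b outside
  \<open>K\<close> lies in \<open>T\<close> and moves the subline.\<close>

lemma M_eq_NM: "M = NM"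
proof -
  have "M \<subseteq> NM"
  proof
    fix g assume g: "g \<in> M"
    then obtain A i where A: "det A \<noteq> 0" "g = gam A i" using M_G G_cases by blast
    then show "g \<in> NM" using NM_iff[of A i] M_imp_stab g M_G by auto
  qed
  then have "NM = M \<or> NM = G" using M_max NM_subgroup unfolding maximal_subgroup_def by simp
  moreover have "NM \<noteq> G"
  proof -
    obtain b where b: "b \<notin> K" using not_K_exists[OF r_gt_1] by blast
    define A where "A = h0 ** M2 1 b 0 1 ** inv2 h0"
    have detA: "det A = 1" using det_inv2[OF h0] by (simp add: A_def det_mul mult.commute)
    have "\<not> stab A 0 h0"
    proof
      assume "stab A 0 h0"
      moreover have "A ** h0 = h0 ** M2 1 b 0 1" using h0 by (simp add: A_def)
      ultimately have "eqv (h0 ** mat 1) (h0 ** M2 1 b 0 1)" by (simp add: stab_def)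
      then show False using upper_not_eqv[OF b] eqv_mult_iff[OF h0] by blast
    qed
    then have "gam A 0 \<notin> NM" using NM_iff[of A 0] T_in_G[OF detA] detA by simp
    then show ?thesis using T_in_G[OF detA] by auto
  qed
  ultimately show ?thesis by simp
qed

lemma M_iff: "gam A i \<in> G \<Longrightarrow> det A \<noteq> 0 \<Longrightarrow> gam A i \<in> M \<longleftrightarrow> stab A i h0"
  unfolding M_eq_NM by (rule NM_iff)

abbreviation \<Omega> where "\<Omega> \<equiv> rcosets\<^bsub>GG\<^esub> M"

abbreviation base where "base \<equiv> is_base GG \<Omega> (right_mult GG)"

lemma quotient_M_iff:
  assumes "gam A i \<in> G" "det A \<noteq> 0" "gam B j \<in> G" "det B \<noteq> 0"
  shows "inv\<^bsub>GG\<^esub> (gam A i) \<otimes>\<^bsub>GG\<^esub> gam B j \<in> M \<longleftrightarrow> eqv (A ** frm i h0) (B ** frm j h0)"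
proof -
  have "inv\<^bsub>GG\<^esub> (gam A i) \<in> G" using GG.inv_closed[of "gam A i"] assms by simp
  then obtain C k where C: "det C \<noteq> 0" "inv\<^bsub>GG\<^esub> (gam A i) = gam C k" by (rule G_cases)
  have CG: "gam C k \<in> G" using C \<open>inv\<^bsub>GG\<^esub> (gam A i) \<in> G\<close> by simp
  have "gam C k \<otimes>\<^bsub>GG\<^esub> gam A i = \<one>\<^bsub>GG\<^esub>" using GG.l_inv[of "gam A i"] assms C by simp
  then have "gam (C ** frm k A) (k + i) = gam (mat 1) 0" using C assms by (simp add: one_PGammaL2)
  then have "prp (C ** frm k A ** frm (k + i) h0) (mat 1 ** frm 0 h0)"
    by (rule gam_act) (use C assms h0 in \<open>simp_all add: det_mul\<close>)
  then have e: "eqv (C ** frm k (A ** frm i h0)) h0"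
    using prp_eqv by (simp add: frm_mult frm_frm matrix_mul_assoc)
  have "inv\<^bsub>GG\<^esub> (gam A i) \<otimes>\<^bsub>GG\<^esub> gam B j = gam (C ** frm k B) (k + j)" using C assms by simp
  moreover have "gam (C ** frm k B) (k + j) \<in> G"
    using GG.m_closed[of "gam C k" "gam B j"] CG assms C by simp
  ultimately have "inv\<^bsub>GG\<^esub> (gam A i) \<otimes>\<^bsub>GG\<^esub> gam B j \<in> M \<longleftrightarrow> eqv h0 (C ** frm k (B ** frm j h0))"
    using M_iff[of "C ** frm k B" "k + j"] C assms by (simp add: stab_def det_mul frm_mult frm_frm matrix_mul_assoc)
  also have "\<dots> \<longleftrightarrow> eqv (C ** frm k (A ** frm i h0)) (C ** frm k (B ** frm j h0))"
    using e eqv_sym eqv_trans by blast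
  also have "\<dots> \<longleftrightarrow> eqv (A ** frm i h0) (B ** frm j h0)" by (rule eqv_act_iff[OF C(1)])
  finally show ?thesis .
qed

text \<open>The coset \<open>M y\<^sup>-\<^sup>1\<close> corresponds to the subline \<open>y h\<^sub>0\<close>.\<close>

definition rep :: "_ set \<Rightarrow> 'a ^ 2 ^ 2 \<Rightarrow> bool" where
  "rep u h \<longleftrightarrow> (\<exists>Y k. det Y \<noteq> 0 \<and> gam Y k \<in> G \<and> u = M #>\<^bsub>GG\<^esub> inv\<^bsub>GG\<^esub> (gam Y k) \<and> eqv h (Y ** frm k h0))"

lemma rep_det: "rep u h \<Longrightarrow> det h \<noteq> 0"
proof -
  assume "rep u h"
  then obtain Y k where "det Y \<noteq> 0" "eqv h (Y ** frm k h0)" unfolding rep_def by blast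
  then show ?thesis using eqv_det[OF eqv_sym, of h "Y ** frm k h0"] h0 by (simp add: det_mul)
qed

lemma rep_exists:
  assumes "u \<in> \<Omega>"
  obtains h where "rep u h"
proof -
  obtain x where x: "x \<in> G" "u = M #>\<^bsub>GG\<^esub> x" using assms by (auto simp: RCOSETS_def)
  then have "inv\<^bsub>GG\<^esub> x \<in> G" using GG.inv_closed[of x] by simp
  then obtain Y k where Y: "det Y \<noteq> 0" "inv\<^bsub>GG\<^esub> x = gam Y k" by (rule G_cases)
  then have "u = M #>\<^bsub>GG\<^esub> inv\<^bsub>GG\<^esub> (gam Y k)" using x GG.inv_inv[of x] by (simp flip: Y(2))
  then have "rep u (Y ** frm k h0)" unfolding rep_def using Y \<open>inv\<^bsub>GG\<^esub> x \<in> G\<close>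
    by (intro exI[of _ Y] exI[of _ k]) simp
  then show thesis by (rule that)
qed

lemma rep_surj:
  assumes "det h \<noteq> 0"
  obtains u where "u \<in> \<Omega>" "rep u h"
proof -
  obtain A where A: "det A = 1" "eqv h (A ** h0)" using exists_translate[OF r_cases h0 assms] by blast
  have g: "gam A 0 \<in> G" by (rule T_in_G[OF A(1)])
  then have "M #>\<^bsub>GG\<^esub> inv\<^bsub>GG\<^esub> (gam A 0) \<in> \<Omega>" using GG.inv_closed[of "gam A 0"] by (auto simp: RCOSETS_def)
  moreover have "rep (M #>\<^bsub>GG\<^esub> inv\<^bsub>GG\<^esub> (gam A 0)) h"
    unfolding rep_def using A g by (intro exI[of _ A] exI[of _ 0]) simp
  ultimately show thesis by (rule that)
qed

lemma rep_eq_iff: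
  assumes "rep u h" "rep v h'"
  shows "u = v \<longleftrightarrow> eqv h h'"
proof -
  obtain Y k where Y: "det Y \<noteq> 0" "gam Y k \<in> G" "u = M #>\<^bsub>GG\<^esub> inv\<^bsub>GG\<^esub> (gam Y k)" "eqv h (Y ** frm k h0)"
    using assms(1) unfolding rep_def by blast
  obtain Z l where Z: "det Z \<noteq> 0" "gam Z l \<in> G" "v = M #>\<^bsub>GG\<^esub> inv\<^bsub>GG\<^esub> (gam Z l)" "eqv h' (Z ** frm l h0)"
    using assms(2) unfolding rep_def by blast
  have "u = v \<longleftrightarrow> inv\<^bsub>GG\<^esub> (gam Y k) \<otimes>\<^bsub>GG\<^esub> inv\<^bsub>GG\<^esub> (inv\<^bsub>GG\<^esub> (gam Z l)) \<in> M"
    unfolding Y(3) Z(3) using Y(2) Z(2) GG.inv_closed by (intro GG.rcoset_eq_iff M_subgroup) simp_all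
  also have "inv\<^bsub>GG\<^esub> (inv\<^bsub>GG\<^esub> (gam Z l)) = gam Z l" using Z(2) by (intro GG.inv_inv) simp
  also have "inv\<^bsub>GG\<^esub> (gam Y k) \<otimes>\<^bsub>GG\<^esub> gam Z l \<in> M \<longleftrightarrow> eqv (Y ** frm k h0) (Z ** frm l h0)"
    by (rule quotient_M_iff) fact+
  also have "\<dots> \<longleftrightarrow> eqv h h'" using Y(4) Z(4) eqv_sym eqv_trans by meson
  finally show ?thesis .
qed

text \<open>M y^-1 g = M y^-1 says that y^-1 g y is in \<open>M\<close>, the stabilizer of
  \<open>h0 L\<close>, that is, g stabilizes the subline y h0 L. The inverse in \<open>rep\<close>
  turns right multiplication into the left action.\<close>

lemma rep_stab:
  assumes u: "rep u h" and A: "gam A i \<in> G" "det A \<noteq> 0"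
  shows "right_mult GG (gam A i) u = u \<longleftrightarrow> stab A i h"
proof -
  obtain Y k where Y: "det Y \<noteq> 0" "gam Y k \<in> G" "u = M #>\<^bsub>GG\<^esub> inv\<^bsub>GG\<^esub> (gam Y k)" "eqv h (Y ** frm k h0)"
    using u unfolding rep_def by blast
  let ?y = "gam Y k" and ?g = "gam A i"
  have c: "?y \<in> carrier GG" "?g \<in> carrier GG" "inv\<^bsub>GG\<^esub> ?y \<in> carrier GG" using Y A GG.inv_closed[of "gam Y k"] by simp_all
  have "right_mult GG ?g u = M #>\<^bsub>GG\<^esub> (inv\<^bsub>GG\<^esub> ?y \<otimes>\<^bsub>GG\<^esub> ?g)"
    unfolding right_mult_def Y(3) using M_subgroup subgroup.subset c by (intro GG.coset_mult_assoc) blast+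
  then have "right_mult GG ?g u = u \<longleftrightarrow> inv\<^bsub>GG\<^esub> ?y \<otimes>\<^bsub>GG\<^esub> ?g \<otimes>\<^bsub>GG\<^esub> inv\<^bsub>GG\<^esub> (inv\<^bsub>GG\<^esub> ?y) \<in> M"
    unfolding Y(3) using c GG.m_closed by (simp only: GG.rcoset_eq_iff[OF M_subgroup])
  also have "inv\<^bsub>GG\<^esub> ?y \<otimes>\<^bsub>GG\<^esub> ?g \<otimes>\<^bsub>GG\<^esub> inv\<^bsub>GG\<^esub> (inv\<^bsub>GG\<^esub> ?y) = inv\<^bsub>GG\<^esub> ?y \<otimes>\<^bsub>GG\<^esub> (?g \<otimes>\<^bsub>GG\<^esub> ?y)"
    using c by (simp only: GG.inv_inv GG.m_assoc)
  also have gy: "?g \<otimes>\<^bsub>GG\<^esub> ?y = gam (A ** frm i Y) (i + k)" using A Y by simp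
  also have "inv\<^bsub>GG\<^esub> ?y \<otimes>\<^bsub>GG\<^esub> gam (A ** frm i Y) (i + k) \<in> M \<longleftrightarrow>
      eqv (Y ** frm k h0) (A ** frm i Y ** frm (i + k) h0)"
    using GG.m_closed[OF c(2,1)] A Y unfolding gy by (intro quotient_M_iff) (simp_all add: det_mul)
  also have "\<dots> \<longleftrightarrow> stab A i (Y ** frm k h0)" by (simp add: stab_def frm_mult frm_frm matrix_mul_assoc)
  also have "\<dots> \<longleftrightarrow> stab A i h" using stab_eqv[OF Y(4) A(2)] by simp
  finally show ?thesis .
qed

lemma trivial_is_base:
  assumes sub: "B \<subseteq> \<Omega>"
    and triv: "\<And>A i. det A \<noteq> 0 \<Longrightarrow> (\<And>u h. u \<in> B \<Longrightarrow> rep u h \<Longrightarrow> stab A i h) \<Longrightarrow>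
      trivial_pair A i"
  shows "base B"
  unfolding is_base_def
proof (intro conjI equalityI subsetI)
  fix g assume g: "g \<in> carrier GG \<inter> (\<Inter>x\<in>B. stabilizer GG (right_mult GG) x)"
  then have "g \<in> G" by simp
  then obtain A i where A: "det A \<noteq> 0" "g = gam A i" by (rule G_cases)
  have "stab A i h" if "u \<in> B" "rep u h" for u h
    using g rep_stab[OF that(2), of A i] that(1) A by (auto simp: stabilizer_def)
  then obtain c where "c \<noteq> 0" "A = mat c" "\<forall>x::'a. x ^ (CHAR('a) ^ i) = x" using triv[OF A(1)] by blast
  then have "g = \<one>\<^bsub>PGammaL2\<^esub>" unfolding A(2) using gam_eq_one[of i c] by simp
  then show "g \<in> {\<one>\<^bsub>GG\<^esub>}" by simp
next
  fix g assume "g \<in> {\<one>\<^bsub>GG\<^esub>}"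
  then have g: "g = gam (mat 1) 0" by (simp add: one_PGammaL2)
  have "gam (mat 1) 0 \<in> G" by (rule T_in_G) simp
  moreover have "right_mult GG (gam (mat 1) 0) u = u" if u: "u \<in> B" for u
  proof -
    obtain h where "rep u h" using sub u rep_exists by blast
    then show ?thesis using rep_stab[of u h "mat 1" 0] \<open>gam (mat 1) 0 \<in> G\<close> by (simp add: stab_def)
  qed
  ultimately show "g \<in> carrier GG \<inter> (\<Inter>x\<in>B. stabilizer GG (right_mult GG) x)"
    unfolding g by (auto simp: stabilizer_def)
qed (use sub in auto)

lemma adj_is_base:
  assumes "u \<in> \<Omega>" "v \<in> \<Omega>" "rep u h" "rep v h'" "adj h h'"
  shows "base {u, v}"
proof (rule trivial_is_base)
  fix A :: "'a^2^2" and i assume "det A \<noteq> 0" "\<And>w k. w \<in> {u, v} \<Longrightarrow> rep w k \<Longrightarrow> stab A i k"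
  then have "det A \<noteq> 0" "stab A i h" "stab A i h'" using assms by blast+
  then show "trivial_pair A i" using assms(5) unfolding adj_def by blast
qed (use assms in auto)

lemma stab_not_base:
  assumes A: "gam A 0 \<in> G" "det A \<noteq> 0" "\<nexists>c. A = mat c"
    and stab: "\<And>u. u \<in> B \<Longrightarrow> \<exists>h. rep u h \<and> stab A 0 h"
  shows "\<not> base B"
proof (rule not_is_base)
  show "gam A 0 \<in> carrier GG" using A by simp
  show "gam A 0 \<noteq> \<one>\<^bsub>GG\<^esub>"
  proof
    assume "gam A 0 = \<one>\<^bsub>GG\<^esub>"
    then have "gam (mat 1) 0 = gam A 0" by (simp add: one_PGammaL2)
    then show False using A(3) unfolding gam_eq_iff by auto
  qed
  fix u assume "u \<in> B"
  then show "right_mult GG (gam A 0) u = u" using stab rep_stab A by blast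
qed

text \<open>A conjugate of z \<mapsto> z + 1 stabilizes both the subline and its translate by some b
  outside \<open>K\<close>. The lower bounds for the base size and for the diameter both rest on
  this pair.\<close>

lemma translate_pair:
  assumes "rep u h"
  obtains v where "v \<in> \<Omega>" "v \<noteq> u" "\<not> base {u, v}"
proof -
  obtain b where b: "b \<notin> K" using not_K_exists[OF r_gt_1] by blast
  have h: "det h \<noteq> 0" by (rule rep_det[OF assms])
  obtain v where v: "v \<in> \<Omega>" "rep v (h ** M2 1 b 0 1)" using rep_surj[of "h ** M2 1 b 0 1"] h by (auto simp: det_mul)
  define A where "A = h ** M2 1 1 0 1 ** inv2 h"
  have detA: "det A = 1" using det_inv2[OF h] by (simp add: A_def det_mul mult.commute)
  have ns: "\<nexists>c. A = mat c"
  proof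
    assume "\<exists>c. A = mat c"
    then obtain c where "A = mat c" by blast
    moreover have "A ** h = h ** M2 1 1 0 1" using h by (simp add: A_def)
    ultimately have "inv2 h ** (h ** M2 1 1 0 1) = inv2 h ** (h ** mat c)" by (simp add: mat_comm)
    then show False using h by (simp add: mat_M2)
  qed
  have st: "stab A 0 (h ** M2 1 b 0 1)" for b unfolding A_def by (rule upper_stab[OF h])
  have "h ** M2 1 0 0 1 = h" unfolding mat_M2[symmetric] by simp
  then have "stab A 0 h" using st[of 0] by simp
  then have "\<not> base {u, v}"
    using T_in_G[OF detA] detA ns st[of b] assms v(2) by (intro stab_not_base[of A]) auto
  moreover have "v \<noteq> u"
  proof
    assume "v = u"
    then have "eqv (h ** mat 1) (h ** M2 1 b 0 1)" using rep_eq_iff[OF assms v(2)] by simp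
    then show False using eqv_mult_iff[OF h] upper_not_eqv[OF b] by blast
  qed
  ultimately show thesis using v(1) that by blast
qed

lemma finite_\<Omega>: "finite \<Omega>"
  by simp

text \<open>A base stays a base when a point is added, so B would make every pair containing u a
  base, against \<open>translate_pair\<close>.\<close>

lemma single_not_base:
  assumes "u \<in> \<Omega>" "B \<subseteq> {u}"
  shows "\<not> base B"
proof
  assume b: "base B"
  obtain h where "rep u h" using rep_exists[OF assms(1)] by blast
  then obtain v where v: "v \<in> \<Omega>" "\<not> base {u, v}" by (rule translate_pair) blast
  have "base {u, v}"
    unfolding is_base_def
  proof (intro conjI equalityI)
    show "{u, v} \<subseteq> \<Omega>" using assms v by simp
    show "carrier GG \<inter> (\<Inter>x\<in>{u, v}. stabilizer GG (right_mult GG) x) \<subseteq> {\<one>\<^bsub>GG\<^esub>}"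
      using b assms(2) unfolding is_base_def by blast
    have "right_mult GG (gam (mat 1) 0) w = w" if "w \<in> {u, v}" for w
    proof -
      have "w \<in> \<Omega>" using that assms v by auto
      then obtain k where "rep w k" by (rule rep_exists)
      then show ?thesis using rep_stab[of w k "mat 1" 0] T_in_G[of "mat 1"] by (simp add: stab_def)
    qed
    then show "{\<one>\<^bsub>GG\<^esub>} \<subseteq> carrier GG \<inter> (\<Inter>x\<in>{u, v}. stabilizer GG (right_mult GG) x)"
      using T_in_G[of "mat 1"] by (auto simp: stabilizer_def one_PGammaL2)
  qed
  then show False using v by blast
qed

section \<open>Base size and diameter\<close>

theorem odd_degree:
  assumes r: "odd r" and Q: "Q > 2"
  shows "base_size GG \<Omega> (right_mult GG) = 2" "graph_diameter (saxl_graph GG \<Omega> (right_mult GG)) = 2"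
proof -
  have common: "\<exists>w\<in>\<Omega>. w \<noteq> u \<and> w \<noteq> v \<and> base {u, w} \<and> base {v, w}"
    if uv: "u \<in> \<Omega>" "v \<in> \<Omega>" "u \<noteq> v" for u v
  proof -
    obtain h1 where h1: "rep u h1" using rep_exists[OF uv(1)] by blast
    obtain h2 where h2: "rep v h2" using rep_exists[OF uv(2)] by blast
    have ne: "\<not> eqv h1 h2" using rep_eq_iff[OF h1 h2] uv(3) by simp
    obtain h where h: "det h \<noteq> 0" "adj h1 h" "adj h2 h"
      by (rule common_neighbour[OF r r_gt_1 Q rep_det[OF h1] rep_det[OF h2] ne])
    obtain w where w: "w \<in> \<Omega>" "rep w h" using rep_surj[OF h(1)] by blast
    have b: "base {u, w}" "base {v, w}"
      using adj_is_base[OF uv(1) w(1) h1 w(2) h(2)] adj_is_base[OF uv(2) w(1) h2 w(2) h(3)] .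
    have "w \<noteq> u"
    proof
      assume "w = u"
      then show False using b(1) single_not_base[OF uv(1), of "{u, w}"] by simp
    qed
    moreover have "w \<noteq> v"
    proof
      assume "w = v"
      then show False using b(2) single_not_base[OF uv(2), of "{v, w}"] by simp
    qed
    ultimately show ?thesis using b w(1) by blast
  qed
  obtain u where u: "u \<in> \<Omega>" "rep u h0" using rep_surj[OF h0] by blast
  obtain v where v: "v \<in> \<Omega>" "v \<noteq> u" "\<not> base {u, v}" by (rule translate_pair[OF u(2)])
  obtain w where w: "w \<in> \<Omega>" "w \<noteq> u" "base {u, w}" using common[OF u(1) v(1)] v(2) by metis
  show "base_size GG \<Omega> (right_mult GG) = 2"
    unfolding base_size_def
  proof (rule Least_equality)
    show "\<exists>B. finite B \<and> base B \<and> card B = 2"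
      using w by (intro exI[of _ "{u, w}"]) auto
    fix k assume "\<exists>B. finite B \<and> base B \<and> card B = k"
    then obtain B where B: "finite B" "base B" "card B = k" by blast
    show "2 \<le> k"
    proof (rule ccontr)
      assume "\<not> 2 \<le> k"
      then have "card B = 0 \<or> card B = 1" using B(3) by linarith
      then have "B = {} \<or> (\<exists>x. B = {x})" using B(1) by (auto simp: card_1_singleton_iff)
      moreover have "B \<subseteq> \<Omega>" using B by (simp add: is_base_def)
      ultimately obtain x where "x \<in> \<Omega>" "B \<subseteq> {x}" using u by auto
      then show False using single_not_base B by blast
    qed
  qed
  show "graph_diameter (saxl_graph GG \<Omega> (right_mult GG)) = 2"
    by (rule saxl_graph_diameter_2[OF finite_\<Omega> common u(1) v(1) not_sym[OF v(2)] v(3)])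
qed

theorem quadratic:
  assumes r: "r = 2" and p: "CHAR('a) = 2" and Q: "Q > 2"
  shows "base_size GG \<Omega> (right_mult GG) \<noteq> 2"
proof
  assume bs: "base_size GG \<Omega> (right_mult GG) = 2"
  \<comment> \<open>The least base size can be used only if some base exists; the whole set is one
    because the action is faithful.\<close>
  have "base \<Omega>"
  proof (rule trivial_is_base)
    fix A :: "'a^2^2" and i assume A: "det A \<noteq> 0" and st: "\<And>u h. u \<in> \<Omega> \<Longrightarrow> rep u h \<Longrightarrow> stab A i h"
    have "stab A i h" if h: "det h \<noteq> 0" for h
    proof -
      obtain u where "u \<in> \<Omega>" "rep u h" by (rule rep_surj[OF h])
      then show ?thesis by (rule st)
    qed
    then show "trivial_pair A i"
      by (rule stab_all_trivial[OF r_gt_1 A])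
  qed simp
  then have "\<exists>k B. finite B \<and> base B \<and> card B = k" using finite_\<Omega> by blast
  then have "\<exists>B. finite B \<and> base B \<and> card B = base_size GG \<Omega> (right_mult GG)"
    unfolding base_size_def by (rule LeastI_ex)
  then obtain B where B: "base B" "card B = 2" unfolding bs by blast
  obtain u v where uv: "B = {u, v}" using B(2) by (auto simp: card_2_iff)
  have "u \<in> \<Omega>" "v \<in> \<Omega>" using B(1) unfolding uv is_base_def by auto
  obtain h1 where h1: "rep u h1" using rep_exists[OF \<open>u \<in> \<Omega>\<close>] by blast
  obtain h2 where h2: "rep v h2" using rep_exists[OF \<open>v \<in> \<Omega>\<close>] by blast
  obtain A where A: "det A \<noteq> 0" "\<nexists>c. A = mat c" "stab A 0 h1" "stab A 0 h2"
    by (rule quadratic_common_stabilizer[OF r Q rep_det[OF h1] rep_det[OF h2]])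
  \<comment> \<open>In characteristic 2 the determinant is a square, so A has a multiple of
    determinant 1 and its class lies in \<open>T\<close>, hence in \<open>G\<close>.\<close>
  obtain d :: 'a where "d ^ (CHAR('a) ^ 1) = det A" using frob_surj by blast
  then have d: "det A = d * d" by (simp add: p power2_eq_square)
  then have d0: "d \<noteq> 0" using A by auto
  have "det (mat (1 / d) ** A) = 1" using d d0 by (simp add: det_mul)
  then have "gam (mat (1 / d) ** A) 0 \<in> G" by (rule T_in_G)
  moreover have "gam (mat (1 / d) ** A) 0 = gam A 0"
    unfolding gam_eq_iff using d0 by (intro exI[of _ d]) (simp add: mat_mult_mat)
  ultimately have "gam A 0 \<in> G" by simp
  then have "\<not> base B" unfolding uv
    using A h1 h2 by (intro stab_not_base[of A]) auto
  then show False using B(1) by blast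
qed

end

section \<open>From the abstract isomorphism to a subline\<close>

lemma CHAR_eq_prime:
  assumes "prime p" "CARD('a::finite_field) = p ^ n"
  shows "CHAR('a) = p"
proof -
  have "CHAR('a) dvd p ^ n" using CHAR_dvd_CARD[where 'a='a] assms(2) by simp
  then have "CHAR('a) dvd p" using prime_dvd_power CHAR_prime by blast
  then show ?thesis using primes_dvd_imp_eq CHAR_prime assms(1) by blast
qed

text \<open>Choosing matrices of determinant 1 for the values of the inverse isomorphism gives a
  \<open>proj_rep\<close>, and its standard form describes all of H.\<close>

lemma PSL2_subgroup_form:
  fixes H :: "(('a::finite_field ^ 2 ^ 2) set \<times> (('a ^ 2 ^ 2) set \<Rightarrow> ('a ^ 2 ^ 2) set)) set"
  assumes char: "CHAR('a) = CHAR('b::finite_field)"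
    and H_T: "H \<subseteq> PSL2_in_PGammaL2"
    and H_closed: "\<And>x y. x \<in> H \<Longrightarrow> y \<in> H \<Longrightarrow> x \<otimes>\<^bsub>PGammaL2\<^esub> y \<in> H"
    and iso: "PGammaL2\<lparr>carrier := H\<rparr> \<cong> (PSL2 :: ('b::finite_field ^ 2 ^ 2) set monoid)"
  obtains h and \<alpha> :: "'b::finite_field \<Rightarrow> 'a" where "det h \<noteq> 0" "\<And>x y. \<alpha> (x + y) = \<alpha> x + \<alpha> y" "\<And>x y. \<alpha> (x * y) = \<alpha> x * \<alpha> y"
    "\<alpha> 1 = 1" "H = {gam (h ** map_matrix \<alpha> S ** inv2 h) 0 | S. det S = 1}"
proof -
  let ?P = "PSL2 :: ('b ^ 2 ^ 2) set monoid"
  obtain f where f: "f \<in> iso (PGammaL2\<lparr>carrier := H\<rparr>) ?P" using iso unfolding is_iso_def by blast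
  have fhom: "f (x \<otimes>\<^bsub>PGammaL2\<^esub> y) = f x \<otimes>\<^bsub>PGL2\<^esub> f y" if "x \<in> H" "y \<in> H" for x y
    using f that by (auto simp: iso_def hom_def PSL2_def)
  have fbij: "bij_betw f H PSL2_carrier" using f by (simp add: iso_def PSL2_def)
  define g where "g = inv_into H f"
  have gbij: "bij_betw g PSL2_carrier H" unfolding g_def by (rule bij_betw_inv_into[OF fbij])
  have cosP: "cos2 S \<in> PSL2_carrier" if "det S = 1" for S :: "'b^2^2" using that by (simp add: PSL2_carrier_def)
  have fg: "f (g X) = X" if "X \<in> PSL2_carrier" for X using bij_betw_inv_into_right[OF fbij that] by (simp add: g_def)
  have gH: "g X \<in> H" if "X \<in> PSL2_carrier" for X using gbij that by (rule bij_betwE[THEN bspec])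
  have ginj: "g X = g Y \<longleftrightarrow> X = Y" if "X \<in> PSL2_carrier" "Y \<in> PSL2_carrier" for X Y
    using fg[OF that(1)] fg[OF that(2)] by metis
  have gmult: "g (cos2 S) \<otimes>\<^bsub>PGammaL2\<^esub> g (cos2 R) = g (cos2 (S ** R))" if "det S = 1" "det R = 1" for S R
  proof -
    have SR: "det (S ** R) = 1" using that by (simp add: det_mul)
    have "f (g (cos2 S) \<otimes>\<^bsub>PGammaL2\<^esub> g (cos2 R)) = cos2 S \<otimes>\<^bsub>PGL2\<^esub> cos2 R"
      using fhom gH cosP that fg by simp
    also have "\<dots> = f (g (cos2 (S ** R)))" using that SR by (simp add: cos2_mult fg cosP)
    finally show ?thesis
      by (rule inj_onD[OF bij_betw_imp_inj_on[OF fbij]]) (intro H_closed gH cosP that SR)+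
  qed
  define F where "F = (\<lambda>S. SOME X. det X = 1 \<and> g (cos2 S) = gam X 0)"
  have F: "det (F S) = 1 \<and> g (cos2 S) = gam (F S) 0" if "det S = 1" for S
  proof -
    have "g (cos2 S) \<in> PSL2_in_PGammaL2" using gH[OF cosP[OF that]] H_T by blast
    then have "\<exists>X. det X = 1 \<and> g (cos2 S) = gam X 0" unfolding PSL2_in_PGammaL2_alt by blast
    then show ?thesis unfolding F_def by (rule someI_ex)
  qed
  interpret PG: group "PGammaL2 :: (('a ^ 2 ^ 2) set \<times> _) monoid" by (rule group_PGammaL2)
  \<comment> \<open>The identity is recognized as an idempotent, since the chosen matrix for it may
    be any scalar of determinant 1.\<close>
  have F1: "gam (F (mat 1)) 0 = \<one>\<^bsub>PGammaL2\<^esub>"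
  proof -
    have "gam (F (mat 1)) 0 \<otimes>\<^bsub>PGammaL2\<^esub> gam (F (mat 1)) 0 = gam (F (mat 1)) 0"
      using gmult[of "mat 1" "mat 1"] F[of "mat 1"] by simp
    moreover have c: "gam (F (mat 1)) 0 \<in> carrier PGammaL2" using F[of "mat 1"] by simp
    ultimately show ?thesis using PG.l_cancel_one[OF c c] by (simp only:)
  qed
  interpret proj_rep F
  proof
    show "CHAR('a) = CHAR('b)" by (rule char)
    fix S :: "'b^2^2" assume S: "det S = 1"
    show "det (F S) = 1" using F[OF S] by simp
    have "prp (mat 1) (F S) \<longleftrightarrow> gam (mat 1) 0 = gam (F S) 0" by (simp add: gam_eq_iff prp_def)
    also have "\<dots> \<longleftrightarrow> g (cos2 (mat 1)) = g (cos2 S)" using F1 F[OF S] F[of "mat 1"] by (simp add: one_PGammaL2)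
    also have "\<dots> \<longleftrightarrow> cos2 (mat 1) = cos2 S" using S by (intro ginj cosP) simp_all
    also have "\<dots> \<longleftrightarrow> prp (mat 1) S" by (rule prp_cos2)
    finally show "prp (mat 1) (F S) \<longleftrightarrow> prp (mat 1) S" .
  next
    fix S R :: "'b^2^2" assume SR: "det S = 1" "det R = 1"
    then have "det (S ** R) = 1" by (simp add: det_mul)
    then have "gam (F S ** F R) 0 = gam (F (S ** R)) 0" using gmult[OF SR] F SR by simp
    then show "prp (F S ** F R) (F (S ** R))" by (simp add: gam_eq_iff prp_def)
  qed
  obtain h \<alpha> where h: "det h \<noteq> 0" "\<And>x y. \<alpha> (x + y) = \<alpha> x + \<alpha> y" "\<And>x y. \<alpha> (x * y) = \<alpha> x * \<alpha> y" "\<alpha> 1 = 1"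
    "\<And>S. det S = 1 \<Longrightarrow> prp (h ** map_matrix \<alpha> S ** inv2 h) (F S)"
    by (rule standard_form) blast
  have gF: "g (cos2 S) = gam (h ** map_matrix \<alpha> S ** inv2 h) 0" if "det S = 1" for S
    using F[OF that] h(5)[OF that] by (simp add: gam_def prp_cos2[symmetric])
  have "H = g ` PSL2_carrier" using gbij by (simp add: bij_betw_def)
  also have "\<dots> = {gam (h ** map_matrix \<alpha> S ** inv2 h) 0 | S. det S = 1}"
    unfolding PSL2_carrier_def using gF by (auto simp: image_iff)
  finally show thesis by (rule that[OF h(1-4)])
qed

text \<open>The embedding \<alpha> of the field with p^m elements is not known explicitly, but its
  range is: it consists of solutions of x^Q = x and has Q elements, so it is \<open>K\<close>. Hence
  the entrywise images of SL(2,p^m) are exactly the matrices over \<open>K\<close> of determinant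
  1.\<close>

lemma subfield_action_of_iso:
  fixes G M :: "(('a::finite_field ^ 2 ^ 2) set \<times> (('a ^ 2 ^ 2) set \<Rightarrow> ('a ^ 2 ^ 2) set)) set"
  assumes card: "CARD('a) = CHAR('a) ^ (m * r)" and m: "m > 0" and r: "r > 1" "CHAR('a) = 2 \<or> odd r"
    and G: "subgroup G PGammaL2" "PSL2_in_PGammaL2 \<subseteq> G"
    and M: "maximal_subgroup M (PGammaL2\<lparr>carrier := G\<rparr>)"
    and char: "CHAR('b::finite_field) = CHAR('a)" and cardb: "CARD('b::finite_field) = CHAR('a) ^ m"
    and iso: "PGammaL2\<lparr>carrier := M \<inter> PSL2_in_PGammaL2\<rparr> \<cong> (PSL2 :: ('b::finite_field ^ 2 ^ 2) set monoid)"
  obtains h where "subfield_action m r {x::'a. x ^ (CHAR('a) ^ m) = x} G M h"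
proof -
  define K where "K = {x::'a. x ^ (CHAR('a) ^ m) = x}"
  interpret subfield m r K by unfold_locales (use card m r in \<open>auto simp: K_def\<close>)
  have closed: "x \<otimes>\<^bsub>PGammaL2\<^esub> y \<in> M \<inter> PSL2_in_PGammaL2"
    if xy: "x \<in> M \<inter> PSL2_in_PGammaL2" "y \<in> M \<inter> PSL2_in_PGammaL2" for x y
  proof -
    have "subgroup M (PGammaL2\<lparr>carrier := G\<rparr>)" using M by (simp add: maximal_subgroup_def)
    then have "x \<otimes>\<^bsub>PGammaL2\<^esub> y \<in> M" using subgroup.m_closed[of M "PGammaL2\<lparr>carrier := G\<rparr>" x y] xy by simp
    moreover obtain A B where "x = gam A 0" "det A = 1" "y = gam B 0" "det B = 1"
      using xy unfolding PSL2_in_PGammaL2_alt by blast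
    then have "x \<otimes>\<^bsub>PGammaL2\<^esub> y = gam (A ** B) 0" "det (A ** B) = 1" by (simp_all add: det_mul)
    then have "x \<otimes>\<^bsub>PGammaL2\<^esub> y \<in> PSL2_in_PGammaL2" unfolding PSL2_in_PGammaL2_alt by blast
    ultimately show ?thesis by blast
  qed
  obtain h and \<alpha> :: "'b \<Rightarrow> 'a" where h: "det h \<noteq> 0" "\<And>x y. \<alpha> (x + y) = \<alpha> x + \<alpha> y" "\<And>x y. \<alpha> (x * y) = \<alpha> x * \<alpha> y"
    "\<alpha> 1 = 1" "M \<inter> PSL2_in_PGammaL2 = {gam (h ** map_matrix \<alpha> S ** inv2 h) 0 | S. det S = 1}"
    by (rule PSL2_subgroup_form[OF char[symmetric] _ closed iso]) blast+
  have a0: "\<alpha> 0 = 0"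
  proof -
    have "\<alpha> 0 + \<alpha> 0 = \<alpha> 0 + 0" using h(2)[of 0 0] by (simp only: add_0_right)
    then show ?thesis by (simp only: add_left_cancel)
  qed
  have am: "\<alpha> (- x) = - \<alpha> x" for x using h(2)[of x "- x"] a0 by (simp add: eq_neg_iff_add_eq_0 add.commute)
  have ad: "\<alpha> (x - y) = \<alpha> x - \<alpha> y" for x y using h(2)[of x "- y"] am by simp
  have ainj: "inj \<alpha>"
  proof (rule injI)
    fix x y assume "\<alpha> x = \<alpha> y"
    then have z: "\<alpha> (x - y) = 0" by (simp add: ad)
    show "x = y"
    proof (rule ccontr)
      assume "x \<noteq> y"
      then have "(x - y) * (1 / (x - y)) = 1" by simp
      then have "\<alpha> (x - y) * \<alpha> (1 / (x - y)) = 1" using h(3,4) by metis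
      then show False using z by simp
    qed
  qed
  have apow: "\<alpha> (x ^ k) = \<alpha> x ^ k" for x k by (induction k) (simp_all add: h(3,4))
  have "range \<alpha> \<subseteq> K"
  proof
    fix y assume "y \<in> range \<alpha>"
    then obtain x where "y = \<alpha> x" by blast
    then show "y \<in> K" using apow[of x Q] finite_field_power_card_eq_same[of x] cardb by (simp add: K_iff Q_def)
  qed
  moreover have "card (range \<alpha>) = card K" using ainj cardb by (simp add: card_image card_K Q_def)
  ultimately have aK: "range \<alpha> = K" by (intro card_subset_eq) simp_all
  have adet: "det (map_matrix \<alpha> S) = \<alpha> (det S)" for S :: "'b^2^2"
    by (rule M2_cases[of S]) (simp add: ad h(3))
  have im: "map_matrix \<alpha> ` {S :: 'b^2^2. det S = 1} = {S. MK S \<and> det S = 1}"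
  proof (intro equalityI subsetI)
    fix X assume "X \<in> map_matrix \<alpha> ` {S :: 'b^2^2. det S = 1}"
    then obtain S :: "'b^2^2" where S: "det S = 1" "X = map_matrix \<alpha> S" by blast
    obtain a b c d where Sd: "S = M2 a b c d" by (rule M2_cases)
    have "MK X" unfolding S(2) Sd using aK by auto
    then show "X \<in> {S. MK S \<and> det S = 1}" using S adet h(4) by simp
  next
    fix X :: "'a^2^2" assume "X \<in> {S. MK S \<and> det S = 1}"
    then have X: "MK X" "det X = 1" by simp_all
    obtain a b c d where Xd: "X = M2 a b c d" by (rule M2_cases)
    have "a \<in> range \<alpha>" "b \<in> range \<alpha>" "c \<in> range \<alpha>" "d \<in> range \<alpha>" using X(1) unfolding Xd aK by auto
    then obtain a' b' c' d' where "a = \<alpha> a'" "b = \<alpha> b'" "c = \<alpha> c'" "d = \<alpha> d'" by blast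
    then have e: "X = map_matrix \<alpha> (M2 a' b' c' d')" using Xd by simp
    have "\<alpha> (det (M2 a' b' c' d')) = \<alpha> 1" using X(2) unfolding e adet h(4) .
    then have "det (M2 a' b' c' d') = 1" using ainj by (rule injD[rotated])
    then show "X \<in> map_matrix \<alpha> ` {S :: 'b^2^2. det S = 1}" using e by blast
  qed
  have "M \<inter> PSL2_in_PGammaL2 = (\<lambda>S. gam (h ** S ** inv2 h) 0) ` (map_matrix \<alpha> ` {S :: 'b^2^2. det S = 1})"
    unfolding h(5) by blast
  also have "\<dots> = {gam (h ** S ** inv2 h) 0 | S. MK S \<and> det S = 1}" unfolding im by blast
  finally have MT: "M \<inter> PSL2_in_PGammaL2 = {gam (h ** S ** inv2 h) 0 | S. MK S \<and> det S = 1}" .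
  have "subfield_action m r K G M h"
    by (intro subfield_action.intro subfield_axioms subfield_action_axioms.intro G M h(1) MT r)
  then show thesis unfolding K_def by (rule that)
qed

theorem theorem3p11:
  fixes p n m :: nat
    and T G M :: "(('a::finite_field ^ 2 ^ 2) set \<times> (('a ^ 2 ^ 2) set \<Rightarrow> ('a ^ 2 ^ 2) set)) set"
  defines "T \<equiv> PSL2_in_PGammaL2"
  assumes "prime p"
    and "CARD('a) = p ^ n" and "p ^ n \<ge> 5"
    and "subgroup G PGammaL2" and "T \<subseteq> G"
    and "m > 0" and "p ^ m > 2"
    and "(m dvd n \<and> prime (n div m) \<and> odd (n div m)) \<or> (p = 2 \<and> n = 2 * m)"
    and "maximal_subgroup M (PGammaL2\<lparr>carrier := G\<rparr>)"
    and "CARD('b::finite_field) = p ^ m"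
    and "PGammaL2\<lparr>carrier := M \<inter> T\<rparr> \<cong> (PSL2 :: ('b ^ 2 ^ 2) set monoid)"
  defines "\<G> \<equiv> PGammaL2\<lparr>carrier := G\<rparr>"
  defines "\<Omega> \<equiv> rcosets\<^bsub>\<G>\<^esub> M"
  shows "(base_size \<G> \<Omega> (right_mult \<G>) = 2 \<longleftrightarrow> m dvd n \<and> prime (n div m) \<and> odd (n div m)) \<and>
         (m dvd n \<and> prime (n div m) \<and> odd (n div m) \<longrightarrow>
            graph_diameter (saxl_graph \<G> \<Omega> (right_mult \<G>)) = 2)"
proof -
  have n: "n > 0" using \<open>p ^ n \<ge> 5\<close> by (cases n) auto
  have char: "CHAR('a) = p" "CHAR('b) = p"
    using CHAR_eq_prime \<open>prime p\<close> \<open>CARD('a) = p ^ n\<close> \<open>CARD('b) = p ^ m\<close> by blast+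
  have nonempty: "\<exists>h. subfield_action m r {x::'a. x ^ (CHAR('a) ^ m) = x} G M h"
    if nr: "n = m * r" "r > 1" "p = 2 \<or> odd r" for r
  proof -
    obtain h where "subfield_action m r {x::'a. x ^ (CHAR('a) ^ m) = x} G M h"
    proof (rule subfield_action_of_iso[where 'b='b, of m r G M])
      show "CARD('a) = CHAR('a) ^ (m * r)" "CARD('b) = CHAR('a) ^ m" "CHAR('b) = CHAR('a)"
        using \<open>CARD('a) = p ^ n\<close> \<open>CARD('b) = p ^ m\<close> nr(1) unfolding char by simp_all
      show "m > 0" "r > 1" "CHAR('a) = 2 \<or> odd r" using \<open>m > 0\<close> nr(2,3) unfolding char by simp_all
      show "subgroup G PGammaL2" "maximal_subgroup M (PGammaL2\<lparr>carrier := G\<rparr>)" by fact+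
      show "PSL2_in_PGammaL2 \<subseteq> G" using \<open>T \<subseteq> G\<close> unfolding T_def .
      show "PGammaL2\<lparr>carrier := M \<inter> PSL2_in_PGammaL2\<rparr> \<cong> (PSL2 :: ('b ^ 2 ^ 2) set monoid)"
        using \<open>PGammaL2\<lparr>carrier := M \<inter> T\<rparr> \<cong> PSL2\<close> unfolding T_def .
    qed
    then show ?thesis ..
  qed
  show ?thesis
  proof (cases "m dvd n \<and> prime (n div m) \<and> odd (n div m)")
    case True
    define r where "r = n div m"
    have r: "n = m * r" "r > 1" "odd r" using True prime_gt_1_nat by (auto simp: r_def)
    obtain h where "subfield_action m r {x::'a. x ^ (CHAR('a) ^ m) = x} G M h" using nonempty[OF r(1,2)] r(3) by blast
    then interpret subfield_action m r "{x::'a. x ^ (CHAR('a) ^ m) = x}" G M h .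
    have "Q > 2" using \<open>p ^ m > 2\<close> by (simp add: Q_def char)
    then show ?thesis using odd_degree[OF r(3)] True unfolding \<G>_def \<Omega>_def by blast
  next
    case False
    then have r: "p = 2" "n = m * 2" using assms(9) by auto
    obtain h where "subfield_action m 2 {x::'a. x ^ (CHAR('a) ^ m) = x} G M h" using nonempty[OF r(2)] r(1) by auto
    then interpret subfield_action m 2 "{x::'a. x ^ (CHAR('a) ^ m) = x}" G M h .
    have "Q > 2" using \<open>p ^ m > 2\<close> by (simp add: Q_def char)
    then show ?thesis using quadratic char r False unfolding \<G>_def \<Omega>_def by blast
  qed
qed

end
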